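(* For any prime power $q$, integer $d<q$ and constant $\delta>0$, let $\rho=1/q$, $\epsilon'=\frac{(1-\rho)^d-(1-\rho d)}{\rho d}$ and $\epsilon=\frac{\rho(d-1)}{2}$. There exist a constant $D$ and, for all sufficiently large $N$, a bipartite graph $G$ on $[N]\cup[M]$ with largest left degree $D$ and largest right degree $d$ that has the following two properties: (1) $G$ is a $\big(\rho N,(1-\epsilon'-2\delta)D\big)$-expander; (2) the objective value of the vertex expansion of $\rho N$-subsets of $G$ in the $\Omega(N)$-level Lasserre hierarchy is at most $(1-\epsilon+\delta)D\cdot\rho N$.
   Context: A bipartite graph $G=([N],[M],E)$ is a $(k,a)$-expander if every $S\subseteq[N]$ with $|S|=k$ has $|\Gamma(S)|\ge a\cdot k$, where $\Gamma(S)$ is the neighbor set. Lasserre relaxation: for $G$, $\rho\in(0,1)$ and integer $t\ge1$, the $t$-level Lasserre relaxation for the vertex expansion of $\rho N$-subsets has real variables $y_S(f)$ for all $S\subseteq[N]$ of size at most $2t+\max(1,\max_j|\Gamma(j)|)$ and $f\in\{0,1\}^S$, with $y_\emptyset=1$ and $y_{S\cup T}(f\circ g):=0$ if $f,g$ disagree on $S\cap T$ ($f\circ g$ the combined assignment). Constraints: (i) the matrix indexed by $(S,f)$, $|S|\le t$, with entries $y_{S\cup T}(f\circ g)$ is PSD; (ii) the matrix with entries $\sum_{i=1}^N y_{S\cup T\cup\{i\}}(f\circ g\circ 1_i)-\rho N\,y_{S\cup T}(f\circ g)$ ($1_i$ assigns $1$ to $i$) is PSD. Objective: minimize $\sum_{j\in[M]}(1-y_{\Gamma(j)}(\vec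 0))$; the objective value at level $t$ is the optimum. "$\Omega(N)$-level" means level $t=\lfloor cN\rfloor$ for a constant $c>0$ independent of $N$. *)

theory Defs
  imports "HOL-Number_Theory.Prime_Powers" "HOL-Library.Extended_Real"
begin

text \<open>A bipartite graph \<open>([N], [M], E)\<close> is given by its edge set of pairs (left vertex, right vertex);
  the two sides are tagged by position, so \<open>{1..N}\<close> and \<open>{1..M}\<close> need not be disjoint.\<close>

definition bipartite_graph :: "nat \<Rightarrow> nat \<Rightarrow> (nat \<times> nat) set \<Rightarrow> bool" where
  "bipartite_graph N M E \<longleftrightarrow> E \<subseteq> {1..N} \<times> {1..M}"

definition left_nbrs :: "(nat \<times> nat) set \<Rightarrow> nat set \<Rightarrow> nat set" where
  "left_nbrs E S = {j. \<exists>i\<in>S. (i, j) \<in> E}"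

definition right_nbrs :: "(nat \<times> nat) set \<Rightarrow> nat \<Rightarrow> nat set" where
  "right_nbrs E j = {i. (i, j) \<in> E}"

definition largest_left_degree :: "nat \<Rightarrow> (nat \<times> nat) set \<Rightarrow> nat" where
  "largest_left_degree N E = (MAX i\<in>{1..N}. card (left_nbrs E {i}))"

definition largest_right_degree :: "nat \<Rightarrow> (nat \<times> nat) set \<Rightarrow> nat" where
  "largest_right_degree M E = (MAX j\<in>{1..M}. card (right_nbrs E j))"

definition expander :: "nat \<Rightarrow> (nat \<times> nat) set \<Rightarrow> nat \<Rightarrow> real \<Rightarrow> bool" where
  "expander N E k a \<longleftrightarrow>
     (\<forall>S. S \<subseteq> {1..N} \<and> card S = k \<longrightarrow> real (card (left_nbrs E S)) \<ge> a * real k)"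

text \<open>A pair \<open>(S, f)\<close> with \<open>f \<in> {0,1}\<^sup>S\<close> is encoded as a partial map \<open>f\<close> with domain \<open>S\<close>
  (\<open>True\<close> is 1), so that \<open>y\<^sub>S(f)\<close> is \<open>y f\<close>. For agreeing \<open>f\<close>, \<open>g\<close> the combined assignment
  on the union of the domains is \<open>f ++ g\<close>.\<close>

type_synonym assignment = "nat \<rightharpoonup> bool"

definition agree :: "assignment \<Rightarrow> assignment \<Rightarrow> bool" where
  "agree f g \<longleftrightarrow> (\<forall>i \<in> dom f \<inter> dom g. f i = g i)"

definition comb2 :: "(assignment \<Rightarrow> real) \<Rightarrow> assignment \<Rightarrow> assignment \<Rightarrow> real" where
  "comb2 y f g = (if agree f g then y (f ++ g) else 0)"

definition comb3 :: "(assignment \<Rightarrow> real) \<Rightarrow> assignment \<Rightarrow> assignment \<Rightarrow> assignment \<Rightarrow> real" where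
  "comb3 y f g h = (if agree f g then comb2 y (f ++ g) h else 0)"

definition lasserre_index :: "nat \<Rightarrow> nat \<Rightarrow> assignment set" where
  "lasserre_index N t = {f. dom f \<subseteq> {1..N} \<and> card (dom f) \<le> t}"

definition psd_on :: "'a set \<Rightarrow> ('a \<Rightarrow> 'a \<Rightarrow> real) \<Rightarrow> bool" where
  "psd_on I A \<longleftrightarrow>
     (\<forall>a\<in>I. \<forall>b\<in>I. A a b = A b a) \<and>
     (\<forall>x :: 'a \<Rightarrow> real. (\<Sum>a\<in>I. \<Sum>b\<in>I. x a * A a b * x b) \<ge> 0)"

text \<open>Only the values of \<open>y\<close> at assignments to at most \<open>2t + max 1 (max\<^sub>j |\<Gamma>(j)|)\<close> left vertices
  enter the constraints and the objective, so \<open>y\<close> may be taken total: its other values are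
  irrelevant and add nothing to the program.\<close>

definition lasserre_feasible :: "nat \<Rightarrow> real \<Rightarrow> nat \<Rightarrow> (assignment \<Rightarrow> real) \<Rightarrow> bool" where
  "lasserre_feasible N \<rho> t y \<longleftrightarrow>
     y Map.empty = 1 \<and>
     psd_on (lasserre_index N t) (comb2 y) \<and>
     psd_on (lasserre_index N t)
       (\<lambda>f g. (\<Sum>i=1..N. comb3 y f g [i \<mapsto> True]) - \<rho> * real N * comb2 y f g)"

definition all_zero :: "nat set \<Rightarrow> assignment" where
  "all_zero S = (\<lambda>i. if i \<in> S then Some False else None)"

definition lasserre_objective ::
    "nat \<Rightarrow> (nat \<times> nat) set \<Rightarrow> (assignment \<Rightarrow> real) \<Rightarrow> real" where
  "lasserre_objective M E y = (\<Sum>j=1..M. 1 - y (all_zero (right_nbrs E j)))"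

text \<open>The infimum is taken in the extended reals, so that an infeasible program would have
  value \<open>\<infinity>\<close>.\<close>

definition lasserre_value ::
    "nat \<Rightarrow> nat \<Rightarrow> (nat \<times> nat) set \<Rightarrow> real \<Rightarrow> nat \<Rightarrow> ereal" where
  "lasserre_value N M E \<rho> t =
     (INF y\<in>{y. lasserre_feasible N \<rho> t y}. ereal (lasserre_objective M E y))"

end

theory Submission
  imports "HOL-Algebra.Algebraic_Closure" "HOL-Number_Theory.Residues" "HOL-Analysis.Convex"
    "HOL-Library.Function_Algebras" Defs
begin

text \<open>
  Up to a bounded number of isolated left vertices, left vertices are pairs (variable \<open>v\<close>, value \<open>a\<close>)
  with \<open>a\<close> in the field \<open>\<F>\<close> of order \<open>q\<close>, and an assignment \<open>x\<close> selects the pairs \<open>(v, x v)\<close>, exactly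
  one per variable; so the cardinality constraint holds identically. A right vertex with neighbours
  \<open>(v\<^sub>k, s\<^sub>k)\<close>, \<open>k < d\<close>, becomes the constraint that \<open>(x v\<^sub>k - s\<^sub>k)\<^sub>k\<close> has the form
  \<open>(a + b \<alpha>\<^sub>k + \<alpha>\<^sub>k\<^sup>2)\<^sub>k\<close> for fixed distinct \<open>\<alpha>\<^sub>k\<close>. Such vectors are pairwise uniform and have at most two
  zeros, whence the right vertex is covered with probability exactly
  \<open>d/q - d(d-1)/(2q\<^sup>2) = (1 - \<epsilon>) \<rho> d\<close>.

  For random constraints every small set of constraints covers so many variables that a product of
  few dual words depends on a number of variables proportional to the number of words used. Hence
  the signed measure whose Fourier coefficients are the values forced by short derivations, and zero
  elsewhere, is positive on squares of functions of few variables: low-weight characters fall into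
  classes modulo derivability, and on each class the form is a square. Concentration and a union bound
  over all vertex sets give the expansion of the random graph and show that cutting all left degrees
  down to their mean \<open>D\<close> removes few edges.
\<close>

section \<open>Finite fields\<close>

text \<open>Every dual word has at least three nontrivial characters, because a line takes arbitrary
  values at any two points. A derivation with s words thus has at least 3 s nontrivial incidences,
  which can cancel only at shared variables. If any s constraints cover at least d s - 6 s / 5
  variables, at most 12 s / 5 incidences lie at shared variables and 3 s / 5 survive. The loss 6/5
  is squeezed from both sides: it is below 3/2 so that something survives, and above 1 so that
  random constraints achieve it for all s up to a constant fraction of the variables, the choice of
  s constraints being outweighed by the power 6 s / 5 of the density of s among the variables. For
  two constraints the bound is too weak: it lets them share two variables, and the surviving weight
  could be 2, which would spoil pairwise uniformity. The expected number of such pairs is bounded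
  independently of N, so one constraint of each is given up, at cost at most 1 in the
  objective.\<close>

lemma (in cring) binomial_expansion:
  fixes n :: nat
  assumes x: "x \<in> carrier R" and y: "y \<in> carrier R"
  shows "(x \<oplus> y) [^] n = (\<Oplus>k\<in>{..n}. [(n choose k)] \<cdot> (x [^] k \<otimes> y [^] (n - k)))"
proof (induction n)
  case 0
  then show ?case using x y by simp
next
  case (Suc n)
  let ?t = "\<lambda>m k. x [^] k \<otimes> y [^] (m - k :: nat)"
  let ?S = "\<lambda>m. \<Oplus>k\<in>{..m}. [(m choose k)] \<cdot> ?t m k"
  have c[simp]: "[(a::nat)] \<cdot> (x [^] (k::nat) \<otimes> y [^] (l::nat)) \<in> carrier R" for a k l using x y by simp
  have A: "x \<otimes> ?S n = (\<Oplus>k\<in>{..n}. [(n choose k)] \<cdot> ?t (Suc n) (Suc k))"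
  proof -
    have "x \<otimes> ?S n = (\<Oplus>k\<in>{..n}. x \<otimes> [(n choose k)] \<cdot> ?t n k)"
      by (rule finsum_rdistr) (use x y in auto)
    also have "\<dots> = (\<Oplus>k\<in>{..n}. [(n choose k)] \<cdot> ?t (Suc n) (Suc k))"
    proof (rule finsum_cong')
      fix k assume "k \<in> {..n}"
      have "x \<otimes> [(n choose k)] \<cdot> ?t n k = [(n choose k)] \<cdot> (x \<otimes> ?t n k)"
        using x y by (simp add: add_pow_rdistr)
      also have "x \<otimes> ?t n k = ?t (Suc n) (Suc k)"
        using x y by (simp add: m_assoc m_lcomm)
      finally show "x \<otimes> [(n choose k)] \<cdot> ?t n k = [(n choose k)] \<cdot> ?t (Suc n) (Suc k)" .
    qed (use x y in auto)
    finally show ?thesis .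
  qed
  have B: "y \<otimes> ?S n = (\<Oplus>k\<in>{..n}. [(n choose k)] \<cdot> ?t (Suc n) k)"
  proof -
    have "y \<otimes> ?S n = (\<Oplus>k\<in>{..n}. y \<otimes> [(n choose k)] \<cdot> ?t n k)"
      by (rule finsum_rdistr) (use x y in auto)
    also have "\<dots> = (\<Oplus>k\<in>{..n}. [(n choose k)] \<cdot> ?t (Suc n) k)"
    proof (rule finsum_cong')
      fix k assume k: "k \<in> {..n}"
      have "y \<otimes> [(n choose k)] \<cdot> ?t n k = [(n choose k)] \<cdot> (y \<otimes> ?t n k)"
        using x y by (simp add: add_pow_rdistr)
      also have "y \<otimes> ?t n k = ?t (Suc n) k"
      proof -
        have "y [^] (Suc n - k) = y \<otimes> y [^] (n - k)" using y k by (simp add: Suc_diff_le m_comm)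
        then show ?thesis using x y m_lcomm[of y "x [^] k" "y [^] (n - k)"] by simp
      qed
      finally show "y \<otimes> [(n choose k)] \<cdot> ?t n k = [(n choose k)] \<cdot> ?t (Suc n) k" .
    qed (use x y in auto)
    finally show ?thesis .
  qed
  have "?S (Suc n) = (\<Oplus>k\<in>{..n}. [(Suc n choose Suc k)] \<cdot> ?t (Suc n) (Suc k)) \<oplus> [(Suc n choose 0)] \<cdot> ?t (Suc n) 0"
    by (rule finsum_Suc2) (use x y in auto)
  also have "(\<Oplus>k\<in>{..n}. [(Suc n choose Suc k)] \<cdot> ?t (Suc n) (Suc k))
      = (\<Oplus>k\<in>{..n}. [(n choose k)] \<cdot> ?t (Suc n) (Suc k) \<oplus> [(n choose Suc k)] \<cdot> ?t (Suc n) (Suc k))"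
    by (rule finsum_cong') (use x y in \<open>auto simp: add.nat_pow_mult\<close>)
  also have "\<dots> = (\<Oplus>k\<in>{..n}. [(n choose k)] \<cdot> ?t (Suc n) (Suc k)) \<oplus> (\<Oplus>k\<in>{..n}. [(n choose Suc k)] \<cdot> ?t (Suc n) (Suc k))"
    by (rule finsum_addf) (use x y in auto)
  also have "\<dots> \<oplus> [(Suc n choose 0)] \<cdot> ?t (Suc n) 0
      = x \<otimes> ?S n \<oplus> ((\<Oplus>k\<in>{..n}. [(n choose Suc k)] \<cdot> ?t (Suc n) (Suc k)) \<oplus> [(n choose 0)] \<cdot> ?t (Suc n) 0)"
    unfolding A using x y by (simp add: a_assoc)
  also have "(\<Oplus>k\<in>{..n}. [(n choose Suc k)] \<cdot> ?t (Suc n) (Suc k)) \<oplus> [(n choose 0)] \<cdot> ?t (Suc n) 0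
      = (\<Oplus>k\<in>{..Suc n}. [(n choose k)] \<cdot> ?t (Suc n) k)"
    by (rule finsum_Suc2[symmetric]) (use x y in auto)
  also have "\<dots> = y \<otimes> ?S n" unfolding B using x y by (simp add: binomial_eq_0)
  also have "x \<otimes> ?S n \<oplus> y \<otimes> ?S n = (x \<oplus> y) \<otimes> ?S n"
    using x y by (simp add: l_distr)
  also have "\<dots> = (x \<oplus> y) [^] Suc n" unfolding Suc[symmetric] using x y nat_pow_Suc2[of "x \<oplus> y" n] by simp
  finally show ?case ..
qed

lemma (in cring) add_pow_zero_of_dvd:
  fixes p n :: nat
  assumes "[p] \<cdot> \<one> = \<zero>" "p dvd n" "a \<in> carrier R"
  shows "[n] \<cdot> a = \<zero>"
proof -
  obtain k where k: "n = p * k" using assms(2) by blast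
  have "[p] \<cdot> a = [p] \<cdot> (\<one> \<otimes> a)" using assms(3) by simp
  also have "\<dots> = ([p] \<cdot> \<one>) \<otimes> a" using assms(3) by (simp add: add_pow_ldistr)
  finally have "[p] \<cdot> a = \<zero>" using assms(1,3) by simp
  then show ?thesis unfolding k using assms(3) add.nat_pow_pow[of a k p] by simp
qed

text \<open>The inner binomial coefficients of a prime exponent are divisible by \<open>p\<close>,
  so only the two end terms survive; iteration passes from \<open>p\<close> to \<open>p ^ m\<close>.
  The identity is stated in a commutative ring because it is used both in a field and in the
  polynomial ring over it.\<close>

lemma (in cring) frobenius_add:
  fixes p :: nat
  assumes p: "prime p" "[p] \<cdot> \<one> = \<zero>" and xy: "x \<in> carrier R" "y \<in> carrier R"
  shows "(x \<oplus> y) [^] (p ^ m) = x [^] (p ^ m) \<oplus> y [^] (p ^ m)"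
proof (induction m)
  case (Suc m)
  have one: "(a \<oplus> b) [^] p = a [^] p \<oplus> b [^] p" if ab: "a \<in> carrier R" "b \<in> carrier R" for a b
  proof -
    obtain r where r: "p = Suc (Suc r)" using prime_ge_2_nat[OF p(1)] by (metis add_2_eq_Suc le_Suc_ex)
    let ?f = "\<lambda>k. [(p choose k)] \<cdot> (a [^] k \<otimes> b [^] (p - k))"
    have f: "?f \<in> A \<rightarrow> carrier R" for A using ab by auto
    have mid: "?f (Suc k) = \<zero>" if "k \<le> r" for k
    proof -
      have "p dvd (p choose Suc k)" using p(1) that r by (intro dvd_choose_prime) auto
      then show ?thesis using add_pow_zero_of_dvd[OF p(2)] ab by simp
    qed
    have "(a \<oplus> b) [^] p = (\<Oplus>k\<in>{..p}. ?f k)" by (rule binomial_expansion[OF ab])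
    also have "\<dots> = ?f p \<oplus> (\<Oplus>k\<in>{..Suc r}. ?f k)"
      unfolding r by (rule finsum_Suc) (use ab in auto)
    also have "(\<Oplus>k\<in>{..Suc r}. ?f k) = (\<Oplus>k\<in>{..r}. ?f (Suc k)) \<oplus> ?f 0"
      by (rule finsum_Suc2) (use ab in auto)
    also have "(\<Oplus>k\<in>{..r}. ?f (Suc k)) = (\<Oplus>k\<in>{..r}. \<zero>)"
      by (rule finsum_cong') (use mid in auto)
    finally show ?thesis using ab by simp
  qed
  have "(x \<oplus> y) [^] (p ^ Suc m) = ((x \<oplus> y) [^] (p ^ m)) [^] p"
    using xy by (simp add: nat_pow_pow mult.commute)
  also have "\<dots> = (x [^] (p ^ m)) [^] p \<oplus> (y [^] (p ^ m)) [^] p"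
    unfolding Suc using xy by (intro one) auto
  also have "\<dots> = x [^] (p ^ Suc m) \<oplus> y [^] (p ^ Suc m)"
    using xy by (simp add: nat_pow_pow mult.commute)
  finally show ?case .
qed (use xy in simp)

lemma hom_add_pow:
  fixes n :: nat
  assumes "h \<in> ring_hom R S" "ring R" "ring S" "a \<in> carrier R"
  shows "h (add_pow R n a) = add_pow S n (h a)"
proof -
  interpret R: ring R by fact
  interpret S: ring S by fact
  interpret ring_hom_ring R S h using assms by (intro ring_hom_ringI2) auto
  show ?thesis using assms(4) by (induction n) auto
qed


text \<open>For a root \<open>a\<close> and \<open>Y = X - a\<close>, additivity of the Frobenius map gives
  \<open>X\<^sup>q - X = Y\<^sup>q - Y = Y (Y\<^sup>q\<^sup>-\<^sup>1 - 1)\<close>, so every root is simple.\<close>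

lemma (in field) card_frobenius_fixed:
  fixes p m :: nat
  assumes p: "prime p" "[p] \<cdot> \<one> = \<zero>" and m: "0 < m"
    and split: "\<And>P. P \<in> carrier (poly_ring R) \<Longrightarrow> splitted P"
  shows "card {x \<in> carrier R. x [^] (p ^ m) = x} = p ^ m"
proof -
  define q where "q = p ^ m"
  have q2: "2 \<le> q" using prime_ge_2_nat[OF p(1)] m unfolding q_def
    by (metis One_nat_def Suc_leI order_trans power_increasing power_one_right prime_gt_0_nat p(1))
  let ?P = "poly_ring R"
  interpret UP: domain ?P using univ_poly_is_domain[OF carrier_is_subring] .
  have X: "X \<in> carrier ?P" using var_closed(1)[OF carrier_is_subring] .
  have hom: "poly_of_const \<in> ring_hom R ?P"
    using canonical_embedding_is_hom[OF carrier_is_subring] by simp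
  interpret C: ring_hom_ring R ?P poly_of_const
    using canonical_embedding_ring_hom[OF carrier_is_subring] by simp
  have charP: "add_pow ?P p \<one>\<^bsub>?P\<^esub> = \<zero>\<^bsub>?P\<^esub>"
    using hom_add_pow[OF hom ring_axioms UP.ring_axioms, of \<one> p] p(2) C.hom_one C.hom_zero by simp
  define Q where "Q = X [^]\<^bsub>?P\<^esub> q \<ominus>\<^bsub>?P\<^esub> X"
  have Q: "Q \<in> carrier ?P" using X by (simp add: Q_def)
  have evalQ: "eval Q x = x [^] q \<ominus> x" if x: "x \<in> carrier R" for x
  proof -
    interpret E: ring_hom_ring ?P R "\<lambda>p. eval p x" using eval_ring_hom[OF carrier_is_subring x] .
    show ?thesis using X eval_var[OF x] E.hom_nat_pow[OF X, of q] by (simp add: Q_def a_minus_def)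
  qed
  have degQ: "degree Q = q"
  proof -
    have "X [^]\<^bsub>?P\<^esub> q = monom \<one> q" using unitary_monom_eq_var_pow[OF carrier_is_subring] by simp
    moreover have "\<ominus>\<^bsub>?P\<^esub> X = [\<ominus> \<one>, \<zero>]"
      unfolding univ_poly_a_inv_def'[OF carrier_is_subring X] by (simp add: var_def)
    ultimately have "Q = poly_add (monom \<one> q) [\<ominus> \<one>, \<zero>]"
      by (simp add: Q_def a_minus_def univ_poly_add)
    moreover have "polynomial (carrier R) (monom \<one> q)"
      by (rule monom_is_polynomial[OF carrier_is_subring]) simp
    moreover have "polynomial (carrier R) [\<ominus> \<one>, \<zero>]"
      unfolding polynomial_def by (auto simp: minus_equality)
    ultimately show ?thesis
      using poly_add_degree_eq[OF carrier_is_subring, of "monom \<one> q" "[\<ominus> \<one>, \<zero>]"] q2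
      by (simp add: monom_def)
  qed
  have Qne: "Q \<noteq> []" using degQ q2 by auto
  have root: "is_root Q x \<longleftrightarrow> x \<in> carrier R \<and> x [^] q = x" for x
    unfolding is_root_def using Qne by (auto simp: evalQ)
  have simple: "count (roots Q) a = 1" if "a \<in># roots Q" for a
  proof -
    have a: "a \<in> carrier R" "a [^] q = a" using that roots_mem_iff_is_root[OF Q] root by auto
    define Y where "Y = [\<one>, \<ominus> a]"
    define A where "A = poly_of_const a"
    have Y: "Y \<in> carrier ?P" using a unfolding Y_def sym[OF univ_poly_carrier] polynomial_def by simp
    have A: "A \<in> carrier ?P" using a by (simp add: A_def)
    have XYA: "X = Y \<oplus>\<^bsub>?P\<^esub> A"
      unfolding Y_def A_def univ_poly_add poly_of_const_def using a by (auto simp: var_def l_neg)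
    have Aq: "A [^]\<^bsub>?P\<^esub> q = A"
      using C.hom_nat_pow[of a q] a by (simp add: A_def)
    have "X [^]\<^bsub>?P\<^esub> q = Y [^]\<^bsub>?P\<^esub> q \<oplus>\<^bsub>?P\<^esub> A"
      using UP.frobenius_add[OF p(1) charP Y A, of m] Aq unfolding XYA q_def by simp
    then have "Q = (Y [^]\<^bsub>?P\<^esub> q \<oplus>\<^bsub>?P\<^esub> A) \<ominus>\<^bsub>?P\<^esub> (Y \<oplus>\<^bsub>?P\<^esub> A)" by (simp add: Q_def XYA[symmetric])
    also have "\<dots> = Y [^]\<^bsub>?P\<^esub> q \<ominus>\<^bsub>?P\<^esub> Y"
      using Y A UP.nat_pow_closed[OF Y, of q] by algebra
    also have "Y [^]\<^bsub>?P\<^esub> q = Y \<otimes>\<^bsub>?P\<^esub> Y [^]\<^bsub>?P\<^esub> (q - 1)"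
      using UP.nat_pow_Suc2[OF Y, of "q - 1"] q2 by simp
    also have "Y \<otimes>\<^bsub>?P\<^esub> Y [^]\<^bsub>?P\<^esub> (q - 1) \<ominus>\<^bsub>?P\<^esub> Y = Y \<otimes>\<^bsub>?P\<^esub> (Y [^]\<^bsub>?P\<^esub> (q - 1) \<ominus>\<^bsub>?P\<^esub> \<one>\<^bsub>?P\<^esub>)"
      using Y UP.nat_pow_closed[OF Y, of "q - 1"] by algebra
    finally have QY: "Q = Y \<otimes>\<^bsub>?P\<^esub> (Y [^]\<^bsub>?P\<^esub> (q - 1) \<ominus>\<^bsub>?P\<^esub> \<one>\<^bsub>?P\<^esub>)" .
    define P1 where "P1 = Y [^]\<^bsub>?P\<^esub> (q - 1) \<ominus>\<^bsub>?P\<^esub> \<one>\<^bsub>?P\<^esub>"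
    have P1: "P1 \<in> carrier ?P" using Y by (simp add: P1_def)
    have "P1 \<noteq> []"
    proof
      assume "P1 = []"
      then have "P1 = \<zero>\<^bsub>?P\<^esub>" by (simp add: univ_poly_zero)
      then have "Q = \<zero>\<^bsub>?P\<^esub>" using QY Y unfolding P1_def[symmetric] by simp
      then show False using Qne by (simp add: univ_poly_zero)
    qed
    then have r: "roots Q = add_mset a (roots P1)"
      using poly_mult_degree_one_monic_imp_same_roots[OF a(1) P1] QY by (simp add: P1_def Y_def)
    interpret E: ring_hom_ring ?P R "\<lambda>p. eval p a" using eval_ring_hom[OF carrier_is_subring a(1)] .
    have "eval Y a = \<zero>" using a by (simp add: Y_def r_neg)
    then have "eval P1 a = \<zero> [^] (q - 1) \<ominus> \<one>"
      using Y E.hom_one E.hom_nat_pow[OF Y, of "q - 1"] by (simp add: P1_def a_minus_def)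
    also have "\<dots> = \<ominus> \<one>" using q2 by (simp add: nat_pow_zero a_minus_def)
    finally have "eval P1 a \<noteq> \<zero>" by (metis a_inv_closed minus_minus minus_zero one_closed one_not_zero)
    then have "a \<notin># roots P1" using roots_mem_iff_is_root[OF P1] by (simp add: is_root_def)
    then show ?thesis using r by (simp add: not_in_iff)
  qed
  \<comment> \<open>Splitting supplies \<open>q\<close> roots counted with multiplicity, and
    simplicity makes them distinct.\<close>
  have "size (roots Q) = q" using split[OF Q] degQ by (simp add: splitted_def)
  moreover have "size (roots Q) = card (set_mset (roots Q))"
    using simple by (simp add: size_multiset_overloaded_eq)
  moreover have "set_mset (roots Q) = {x \<in> carrier R. x [^] q = x}"
    using roots_mem_iff_is_root[OF Q] root by auto
  ultimately show ?thesis by (simp add: q_def)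
qed

text \<open>The field of order \<open>p ^ m\<close> is realised as the fixed set of the
  \<open>m\<close>-fold Frobenius map inside an algebraic closure of the integers mod
  \<open>p\<close>; the type of \<open>L\<close> is the one in which that closure is built.\<close>

lemma exists_field_card_frobenius_fixed:
  fixes p m :: nat
  assumes p: "prime p" and m: "0 < m"
  obtains L :: "((int list \<times> nat) multiset \<Rightarrow> int) ring"
  where "field L" "add_pow L p \<one>\<^bsub>L\<^esub> = \<zero>\<^bsub>L\<^esub>" "card {x \<in> carrier L. x [^]\<^bsub>L\<^esub> (p ^ m) = x} = p ^ m"
proof -
  interpret R: residues_prime p "residue_ring (int p)" using p by unfold_locales
  let ?R = "residue_ring (int p)"
  have charR: "add_pow ?R p \<one>\<^bsub>?R\<^esub> = \<zero>\<^bsub>?R\<^esub>"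
  proof -
    have "add_pow ?R k \<one>\<^bsub>?R\<^esub> = int k mod int p" for k :: nat
      by (induction k) (auto simp: R.res_one_eq R.res_zero_eq R.res_add_eq mod_add_left_eq mod_add_right_eq add.commute)
    then show ?thesis by (simp add: R.res_zero_eq)
  qed
  obtain L :: "((int list \<times> nat) multiset \<Rightarrow> int) ring"
    where L: "algebraic_closure L (R.indexed_const ` carrier ?R)" "R.indexed_const \<in> ring_hom ?R L"
    using R.exists_closure by blast
  interpret L: algebraic_closure L "R.indexed_const ` carrier ?R" by fact
  have charL: "add_pow L p \<one>\<^bsub>L\<^esub> = \<zero>\<^bsub>L\<^esub>"
    using hom_add_pow[OF L(2) R.ring_axioms L.ring_axioms R.one_closed, of p] charR
      ring_hom_one[OF L(2)] ring_hom_zero[OF L(2) R.ring_axioms L.ring_axioms] by simp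
  show ?thesis
    using that[of L] L.field_axioms charL L.card_frobenius_fixed[OF p charL m L.roots_over_carrier] by blast
qed

section \<open>Pseudo-expectations from short derivations\<close>

text \<open>On unimodular values pointwise conjugation is inversion, so this is the inverse in the
  groups of characters, which are plain sets of functions under pointwise multiplication.\<close>

definition conj_family :: "(nat \<Rightarrow> nat \<Rightarrow> complex) \<Rightarrow> nat \<Rightarrow> nat \<Rightarrow> complex" where
  "conj_family g = (\<lambda>v x. cnj (g v x))"

lemma conj_family_apply [simp]: "conj_family g v x = cnj (g v x)"
  by (simp add: conj_family_def)

lemma conj_family_mult: "conj_family (g * h) = conj_family g * conj_family h"
  by (simp add: fun_eq_iff)

lemma conj_family_conj [simp]: "conj_family (conj_family g) = g"
  by (simp add: fun_eq_iff)

lemma conj_family_one [simp]: "conj_family 1 = 1"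
  by (simp add: fun_eq_iff)

text \<open>\<open>\<Phi>\<close> is the character group of \<open>\<F>\<close> (elements are labelled by \<open>0, \<dots>, q - 1\<close>, characters take the
  value 1 at larger labels), \<open>C\<close> the group of tuples of characters that are trivial on all
  \<open>(a + b \<alpha>\<^sub>k)\<^sub>k\<close>, and \<open>\<gamma> h\<close> the value of \<open>h\<close> at \<open>(\<alpha>\<^sub>k\<^sup>2)\<^sub>k\<close>.\<close>

locale char_code =
  fixes q d :: nat and \<Phi> :: "(nat \<Rightarrow> complex) set"
    and C :: "(nat \<Rightarrow> nat \<Rightarrow> complex) set"
    and \<gamma> :: "(nat \<Rightarrow> nat \<Rightarrow> complex) \<Rightarrow> complex"
  assumes q_pos: "q > 0"
    and finite_chars: "finite \<Phi>"
    and one_char: "1 \<in> \<Phi>"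
    and mult_char: "\<And>f g. f \<in> \<Phi> \<Longrightarrow> g \<in> \<Phi> \<Longrightarrow> f * g \<in> \<Phi>"
    and cnj_char: "\<And>f. f \<in> \<Phi> \<Longrightarrow> (\<lambda>x. cnj (f x)) \<in> \<Phi>"
    and unimodular: "\<And>f x. f \<in> \<Phi> \<Longrightarrow> f x * cnj (f x) = 1"
    and sum_char: "\<And>f. f \<in> \<Phi> \<Longrightarrow> f \<noteq> 1 \<Longrightarrow> (\<Sum>x<q. f x) = 0"
    and sum_chars: "\<And>x y. x < q \<Longrightarrow> y < q \<Longrightarrow>
           (\<Sum>f\<in>\<Phi>. f x * cnj (f y)) = (if x = y then of_nat q else 0)"
    and finite_code: "finite C"
    and code_chars: "\<And>h k. h \<in> C \<Longrightarrow> h k \<in> \<Phi>"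
    and one_code: "1 \<in> C"
    and mult_code: "\<And>h h'. h \<in> C \<Longrightarrow> h' \<in> C \<Longrightarrow> h * h' \<in> C"
    and cnj_code: "\<And>h. h \<in> C \<Longrightarrow> conj_family h \<in> C"
    and code_weight: "\<And>h. h \<in> C \<Longrightarrow> h \<noteq> 1 \<Longrightarrow> 3 \<le> card {k. k < d \<and> h k \<noteq> 1}"
    and gamma_mult: "\<And>h h'. h \<in> C \<Longrightarrow> h' \<in> C \<Longrightarrow> \<gamma> (h * h') = \<gamma> h * \<gamma> h'"
    and gamma_unimodular: "\<And>h. h \<in> C \<Longrightarrow> \<gamma> h * cnj (\<gamma> h) = 1"
    and code_triple: "\<And>k l m. k < l \<Longrightarrow> l < m \<Longrightarrow> m < d \<Longrightarrow>
           \<exists>h\<in>C. (\<forall>i. i \<notin> {k, l, m} \<longrightarrow> h i = 1) \<and> \<gamma> h \<noteq> 1"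
begin

lemma prod_char:
  assumes "finite A" "\<And>i. i \<in> A \<Longrightarrow> f i \<in> \<Phi>"
  shows "(\<lambda>a. \<Prod>i\<in>A. f i a) \<in> \<Phi>"
  using assms
proof (induction A rule: finite_induct)
  case empty
  then show ?case using one_char by (simp add: one_fun_def)
next
  case (insert i A)
  then have "f i * (\<lambda>a. \<Prod>i\<in>A. f i a) \<in> \<Phi>" by (intro mult_char) auto
  then show ?case using insert by (simp add: times_fun_def)
qed

lemma gamma_one: "\<gamma> 1 = 1"
proof -
  have "\<gamma> 1 * \<gamma> 1 = \<gamma> 1" using gamma_mult[OF one_code one_code] by simp
  moreover have "\<gamma> 1 \<noteq> 0" using gamma_unimodular[OF one_code] by auto
  ultimately show ?thesis by simp
qed

lemma gamma_cnj:
  assumes "h \<in> C" shows "\<gamma> (conj_family h) = cnj (\<gamma> h)"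
proof -
  have "h * conj_family h = 1"
    using unimodular[OF code_chars[OF assms]] by (simp add: fun_eq_iff)
  then have "\<gamma> h * \<gamma> (conj_family h) = \<gamma> h * cnj (\<gamma> h)"
    using gamma_mult[OF assms cnj_code[OF assms]] gamma_one gamma_unimodular[OF assms] by simp
  moreover have "\<gamma> h \<noteq> 0" using gamma_unimodular[OF assms] by auto
  ultimately show ?thesis by simp
qed

end


section \<open>Elementary counting\<close>

lemma card_eq_sum_fibres:
  assumes "finite A" "finite B" "f ` A \<subseteq> B"
  shows "card A = (\<Sum>y\<in>B. card {a\<in>A. f a = y})"
  using sum.group[OF assms, of "\<lambda>_. 1::nat"] by simp

text \<open>A fibre of size \<open>c\<close> contributes \<open>c\<close> colliding elements if
  \<open>c \<ge> 2\<close> and none if \<open>c = 1\<close>, in either case at most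
  \<open>2 * c - 2\<close>. Applied to incidences mapped to their variables, this bounds the
  incidences at shared variables by twice the shortfall of the cover.\<close>

lemma card_non_injective_le:
  assumes "finite A"
  shows "card {a\<in>A. \<exists>b\<in>A. b \<noteq> a \<and> f b = f a} + 2 * card (f ` A) \<le> 2 * card A"
proof -
  let ?N = "{a\<in>A. \<exists>b\<in>A. b \<noteq> a \<and> f b = f a}"
  let ?F = "\<lambda>y. {a\<in>A. f a = y}"
  have fib: "card {a\<in>?N. f a = y} + 2 \<le> 2 * card (?F y)" if y: "y \<in> f ` A" for y
  proof (cases "card (?F y) \<ge> 2")
    case True
    have "card {a\<in>?N. f a = y} \<le> card (?F y)" by (rule card_mono) (use assms in auto)
    then show ?thesis using True by linarith
  next
    case False
    obtain a where a: "a \<in> A" "f a = y" using y by auto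
    have "card (?F y) \<noteq> 0" using a assms by auto
    then have 1: "card (?F y) = 1" using False by linarith
    then obtain c where c: "?F y = {c}" by (auto simp: card_1_singleton_iff)
    have e: "{a\<in>?N. f a = y} = {}"
    proof (rule ccontr)
      assume "{a\<in>?N. f a = y} \<noteq> {}"
      then obtain x z where "x \<in> A" "z \<in> A" "z \<noteq> x" "f z = y" "f x = y" by auto
      then have "x \<in> ?F y" "z \<in> ?F y" by auto
      then show False using c \<open>z \<noteq> x\<close> by simp
    qed
    show ?thesis unfolding e 1 by simp
  qed
  have "card ?N + 2 * card (f ` A) = (\<Sum>y\<in>f ` A. card {a\<in>?N. f a = y} + 2)"
  proof -
    have "card ?N = (\<Sum>y\<in>f ` A. card {a\<in>?N. f a = y})"
      by (rule card_eq_sum_fibres) (use assms in auto)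
    then show ?thesis by (simp only: sum.distrib) simp
  qed
  also have "\<dots> \<le> (\<Sum>y\<in>f ` A. 2 * card (?F y))" by (rule sum_mono) (rule fib)
  also have "\<dots> = 2 * card A"
    using card_eq_sum_fibres[of A "f ` A" f] assms by (simp add: sum_distrib_left)
  finally show ?thesis .
qed

lemma ex_three_less:
  fixes B :: "nat set"
  assumes "finite B" "3 \<le> card B"
  obtains k l m where "k < l" "l < m" "k \<in> B" "l \<in> B" "m \<in> B"
proof -
  have ne: "B \<noteq> {}" using assms by auto
  have "B - {Min B, Max B} \<noteq> {}"
  proof
    assume "B - {Min B, Max B} = {}"
    then have "B \<subseteq> {Min B, Max B}" by auto
    then have "card B \<le> card {Min B, Max B}" by (intro card_mono) auto
    also have "\<dots> \<le> 2" by (simp add: card_insert_if)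
    finally show False using assms by simp
  qed
  then obtain l where l: "l \<in> B" "l \<noteq> Min B" "l \<noteq> Max B" by auto
  have "Min B \<le> l" "l \<le> Max B" using l assms by auto
  then have "Min B < l" "l < Max B" using l by auto
  then show ?thesis using that l assms ne Min_in Max_in by blast
qed

text \<open>Constraint \<open>j\<close> asks that the differences of the field elements labelled
  \<open>x (w j k)\<close> and \<open>b j k\<close> form one of the monic quadratic vectors.
  \<open>T\<close> bounds the arity and the number of variables of the functions that get squared;
  \<open>16 * T\<close> accommodates the quotient of two derivations with \<open>8 * T\<close> words
  each.\<close>

locale expanding_system = char_code +
  fixes n T :: nat and J :: "nat set" and w b :: "nat \<Rightarrow> nat \<Rightarrow> nat"
  assumes finite_constraints: "finite J"
    and var_less: "\<And>j k. j \<in> J \<Longrightarrow> k < d \<Longrightarrow> w j k < n"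
    and var_inj: "\<And>j. j \<in> J \<Longrightarrow> inj_on (w j) {..<d}"
    and shift_less: "\<And>j k. j \<in> J \<Longrightarrow> k < d \<Longrightarrow> b j k < q"
    and arity_le: "d \<le> T"
    and expansion: "\<And>I. I \<subseteq> J \<Longrightarrow> card I \<le> 16 * T \<Longrightarrow>
           5 * d * card I \<le> 5 * card (\<Union>j\<in>I. w j ` {..<d}) + 6 * card I"
    and pair_expansion: "\<And>i j. i \<in> J \<Longrightarrow> j \<in> J \<Longrightarrow> i \<noteq> j \<Longrightarrow>
           2 * d \<le> card (w i ` {..<d} \<union> w j ` {..<d}) + 1"
begin

definition supp :: "(nat \<Rightarrow> nat \<Rightarrow> nat \<Rightarrow> complex) \<Rightarrow> nat set" where
  "supp h = {j\<in>J. h j \<noteq> 1}"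

text \<open>A derivation picks a dual word \<open>h j\<close> for each constraint \<open>j\<close>; multiplying these constraints
  forces the character \<open>lam h\<close> to take the value \<open>rhs h\<close>.\<close>

definition derivations :: "nat \<Rightarrow> (nat \<Rightarrow> nat \<Rightarrow> nat \<Rightarrow> complex) set" where
  "derivations s = {h. (\<forall>j\<in>J. h j \<in> C) \<and> (\<forall>j. j \<notin> J \<longrightarrow> h j = 1) \<and> card (supp h) \<le> s}"

definition cj :: "(nat \<Rightarrow> nat \<Rightarrow> nat \<Rightarrow> complex) \<Rightarrow> nat \<Rightarrow> nat \<Rightarrow> nat \<Rightarrow> complex" where
  "cj h = (\<lambda>j. conj_family (h j))"

definition lam :: "(nat \<Rightarrow> nat \<Rightarrow> nat \<Rightarrow> complex) \<Rightarrow> nat \<Rightarrow> nat \<Rightarrow> complex" where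
  "lam h = (\<lambda>v a. \<Prod>j\<in>J. \<Prod>k<d. if w j k = v then h j k a else 1)"

definition rhs :: "(nat \<Rightarrow> nat \<Rightarrow> nat \<Rightarrow> complex) \<Rightarrow> complex" where
  "rhs h = (\<Prod>j\<in>J. \<gamma> (h j) * (\<Prod>k<d. h j k (b j k)))"

definition ch :: "(nat \<Rightarrow> nat \<Rightarrow> complex) \<Rightarrow> (nat \<Rightarrow> nat) \<Rightarrow> complex" where
  "ch g x = (\<Prod>v<n. g v (x v))"

text \<open>Requiring \<open>g v = 1\<close> for \<open>v \<ge> n\<close> leaves one family per
  character, so that equality of families replaces equality of functions on
  \<open>points\<close>.\<close>

definition chars :: "(nat \<Rightarrow> nat \<Rightarrow> complex) set" where
  "chars = {g. (\<forall>v. g v \<in> \<Phi>) \<and> (\<forall>v\<ge>n. g v = 1)}"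

definition wt :: "(nat \<Rightarrow> nat \<Rightarrow> complex) \<Rightarrow> nat" where
  "wt g = card {v. v < n \<and> g v \<noteq> 1}"

definition points :: "(nat \<Rightarrow> nat) set" where
  "points = (\<Pi>\<^sub>E v\<in>{..<n}. {..<q})"

lemma finite_points: "finite points"
  by (auto simp: points_def intro: finite_PiE)

lemma chars_mult: "g \<in> chars \<Longrightarrow> g' \<in> chars \<Longrightarrow> g * g' \<in> chars"
  by (auto simp: chars_def mult_char)

lemma chars_cnj: "g \<in> chars \<Longrightarrow> conj_family g \<in> chars"
  by (auto simp: chars_def conj_family_def cnj_char fun_eq_iff)

lemma chars_mult_cnj: "g \<in> chars \<Longrightarrow> g * conj_family g = 1"
  using unimodular by (auto simp: chars_def fun_eq_iff)

lemma ch_mult: "ch (g * g') x = ch g x * ch g' x"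
  by (simp add: ch_def prod.distrib)

lemma ch_cnj: "ch (conj_family g) x = cnj (ch g x)"
  by (simp add: ch_def)

lemma ch_one [simp]: "ch 1 x = 1"
  by (simp add: ch_def)

lemma wt_one [simp]: "wt 1 = 0"
  by (simp add: wt_def)

lemma wt_cnj: "wt (conj_family g) = wt g"
proof -
  have "conj_family g v = 1 \<longleftrightarrow> g v = 1" for v
    by (simp add: fun_eq_iff)
  then show ?thesis by (simp add: wt_def)
qed

lemma wt_mult_le: "wt (g * g') \<le> wt g + wt g'"
proof -
  have "wt (g * g') \<le> card ({v. v < n \<and> g v \<noteq> 1} \<union> {v. v < n \<and> g' v \<noteq> 1})"
    unfolding wt_def by (rule card_mono) auto
  also have "\<dots> \<le> wt g + wt g'" unfolding wt_def by (rule card_Un_le)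
  finally show ?thesis .
qed

lemma finite_chars_family: "finite chars"
proof -
  have "chars \<subseteq> {f. \<forall>x. (x \<in> {..<n} \<longrightarrow> f x \<in> \<Phi>) \<and> (x \<notin> {..<n} \<longrightarrow> f x = 1)}"
    by (auto simp: chars_def)
  then show ?thesis
    by (rule finite_subset) (rule finite_set_of_finite_funs, auto simp: finite_chars)
qed

section \<open>The group of derivations, their characters and forced values\<close>

lemma derivations_subset: "h \<in> derivations s \<Longrightarrow> s \<le> s' \<Longrightarrow> h \<in> derivations s'"
  by (auto simp: derivations_def)

lemma finite_derivations: "finite (derivations s)"
proof -
  have "derivations s \<subseteq> {f. \<forall>x. (x \<in> J \<longrightarrow> f x \<in> C) \<and> (x \<notin> J \<longrightarrow> f x = 1)}"
    by (auto simp: derivations_def)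
  then show ?thesis
    by (rule finite_subset) (rule finite_set_of_finite_funs, auto simp: finite_code finite_constraints)
qed

lemma derivations_one: "1 \<in> derivations s"
  by (auto simp: derivations_def supp_def one_code)

lemma supp_mult: "supp (h * h') \<subseteq> supp h \<union> supp h'"
  by (auto simp: supp_def)

lemma finite_supp: "finite (supp h)"
  using finite_constraints by (simp add: supp_def)

lemma derivations_mult:
  assumes "h \<in> derivations s" "h' \<in> derivations s'"
  shows "h * h' \<in> derivations (s + s')"
proof -
  have "card (supp (h * h')) \<le> card (supp h \<union> supp h')"
    by (rule card_mono) (auto simp: finite_supp supp_mult)
  also have "\<dots> \<le> card (supp h) + card (supp h')" by (rule card_Un_le)
  also have "\<dots> \<le> s + s'" using assms by (intro add_mono) (auto simp: derivations_def)
  finally show ?thesis using assms by (auto simp: derivations_def mult_code)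
qed

lemma supp_cj: "supp (cj h) = supp h"
proof -
  have "conj_family g = 1 \<longleftrightarrow> g = 1" for g
    by (metis conj_family_conj conj_family_one)
  then show ?thesis by (simp add: supp_def cj_def)
qed

lemma derivations_cj: "h \<in> derivations s \<Longrightarrow> cj h \<in> derivations s"
  using supp_cj[of h] by (auto simp: derivations_def cj_def cnj_code)

lemma derivation_char: "h \<in> derivations s \<Longrightarrow> h j k \<in> \<Phi>"
  by (cases "j \<in> J") (auto simp: derivations_def code_chars one_char)

lemma derivation_mult_cj: "h \<in> derivations s \<Longrightarrow> h * cj h = 1"
  using unimodular[OF derivation_char] by (auto simp: fun_eq_iff cj_def)

lemma lam_mult: "lam (h * h') = lam h * lam h'"
proof -
  have "lam (h * h') v a = lam h v a * lam h' v a" for v a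
    unfolding lam_def prod.distrib[symmetric] by (intro prod.cong refl) auto
  then show ?thesis by (simp add: fun_eq_iff)
qed

lemma lam_cj: "lam (cj h) = conj_family (lam h)"
proof -
  have "lam (cj h) v a = cnj (lam h v a)" for v a
    unfolding lam_def cj_def cnj_prod by (intro prod.cong refl) auto
  then show ?thesis by (simp add: fun_eq_iff)
qed

lemma lam_one [simp]: "lam 1 = 1"
proof -
  have "lam 1 v a = 1" for v a unfolding lam_def by (intro prod.neutral ballI) auto
  then show ?thesis by (simp add: fun_eq_iff)
qed

lemma lam_chars:
  assumes "h \<in> derivations s" shows "lam h \<in> chars"
proof -
  have "lam h v \<in> \<Phi>" for v
  proof -
    have "(\<lambda>a. \<Prod>j\<in>J. \<Prod>k<d. (if w j k = v then h j k else 1) a) \<in> \<Phi>"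
      by (intro prod_char[where f = "\<lambda>j a. \<Prod>k<d. (if w j k = v then h j k else 1) a"]
          prod_char[where f = "\<lambda>k. if w j k = v then h j k else 1" for j])
        (auto simp: finite_constraints one_char derivation_char[OF assms])
    moreover have "lam h v = (\<lambda>a. \<Prod>j\<in>J. \<Prod>k<d. (if w j k = v then h j k else 1) a)"
      by (auto simp: lam_def fun_eq_iff intro!: prod.cong)
    ultimately show ?thesis by simp
  qed
  moreover have "lam h v = 1" if "v \<ge> n" for v
  proof -
    have "w j k \<noteq> v" if "j \<in> J" "k < d" for j k
      using var_less[OF that] \<open>v \<ge> n\<close> by auto
    then show ?thesis by (auto simp: lam_def fun_eq_iff intro!: prod.neutral)
  qed
  ultimately show ?thesis by (auto simp: chars_def)
qed

lemma ch_lam: "ch (lam h) x = (\<Prod>j\<in>J. \<Prod>k<d. h j k (x (w j k)))"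
proof -
  have "ch (lam h) x = (\<Prod>j\<in>J. \<Prod>k<d. \<Prod>v<n. if w j k = v then h j k (x v) else 1)"
    unfolding ch_def lam_def
    by (subst prod.swap, rule prod.cong, rule refl, subst prod.swap, rule refl)
  also have "\<dots> = (\<Prod>j\<in>J. \<Prod>k<d. h j k (x (w j k)))"
    by (intro prod.cong refl) (simp add: prod.delta' var_less)
  finally show ?thesis .
qed

lemma rhs_mult:
  assumes "h \<in> derivations s" "h' \<in> derivations s'"
  shows "rhs (h * h') = rhs h * rhs h'"
proof -
  have "\<gamma> (h j * h' j) = \<gamma> (h j) * \<gamma> (h' j)" if "j \<in> J" for j
    using assms that by (auto simp: derivations_def gamma_mult)
  then have "rhs (h * h') = (\<Prod>j\<in>J. (\<gamma> (h j) * (\<Prod>k<d. h j k (b j k))) * (\<gamma> (h' j) * (\<Prod>k<d. h' j k (b j k))))"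
    unfolding rhs_def by (intro prod.cong) (auto simp: prod.distrib)
  then show ?thesis by (simp add: rhs_def prod.distrib)
qed

lemma rhs_one [simp]: "rhs 1 = 1"
  by (simp add: rhs_def gamma_one)

lemma rhs_cj:
  assumes "h \<in> derivations s" shows "rhs (cj h) = cnj (rhs h)"
proof -
  have "\<gamma> (conj_family (h j)) = cnj (\<gamma> (h j))" if "j \<in> J" for j
    using assms that by (auto simp: derivations_def gamma_cnj)
  then show ?thesis unfolding rhs_def cj_def by (simp)
qed

lemma rhs_nonzero:
  assumes "h \<in> derivations s" shows "rhs h \<noteq> 0"
proof
  assume "rhs h = 0"
  then have "rhs (h * cj h) = 0" using rhs_mult[OF assms derivations_cj[OF assms]] by simp
  then show False using derivation_mult_cj[OF assms] by simp
qed

text \<open>A derivation using \<open>s\<close> constraints has at least \<open>3 s\<close> nontrivial incidences; expansion leaves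
  so few shared variables that many of these survive uncancelled.\<close>

lemma wt_lam_ge:
  assumes "h \<in> derivations (16 * T)"
  shows "3 * card (supp h) + 2 * card (\<Union>j\<in>supp h. w j ` {..<d}) \<le> wt (lam h) + 2 * d * card (supp h)"
proof -
  let ?A = "supp h \<times> {..<d}"
  let ?w = "\<lambda>(j, k). w j k"
  \<comment> \<open>\<open>N\<close> consists of the incidences whose variable is met by another
    incidence, \<open>P\<close> of those carrying a nontrivial character. At an incidence in
    \<open>P - N\<close> the product defining \<open>lam h\<close> has a single nontrivial factor,
    and different such incidences have different variables.\<close>
  define N where "N = {a\<in>?A. \<exists>b\<in>?A. b \<noteq> a \<and> ?w b = ?w a}"
  define P where "P = {(j, k). j \<in> supp h \<and> k < d \<and> h j k \<noteq> 1}"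
  have finA: "finite ?A" using finite_supp by simp
  have img: "?w ` ?A = (\<Union>j\<in>supp h. w j ` {..<d})" by auto
  have N: "card N + 2 * card (\<Union>j\<in>supp h. w j ` {..<d}) \<le> 2 * d * card (supp h)"
    using card_non_injective_le[OF finA, of ?w] unfolding N_def img
    by (simp add: card_cartesian_product mult.commute mult.left_commute)
  have PA: "P \<subseteq> ?A" by (auto simp: P_def)
  then have finP: "finite P" using finA finite_subset by blast
  have "P = (SIGMA j:supp h. {k. k < d \<and> h j k \<noteq> 1})" by (auto simp: P_def)
  then have "card P = (\<Sum>j\<in>supp h. card {k. k < d \<and> h j k \<noteq> 1})"
    using finite_supp by (simp add: card_SigmaI)
  also have "\<dots> \<ge> (\<Sum>j\<in>supp h. 3)"
    by (rule sum_mono) (use assms in \<open>auto simp: supp_def derivations_def intro!: code_weight\<close>)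
  finally have P: "3 * card (supp h) \<le> card P" by (simp add: mult.commute)
  have single: "lam h v = h j k" if jk: "(j, k) \<in> P - N" "v = w j k" for j k v
  proof -
    have j: "j \<in> J" "k < d" "(j, k) \<in> ?A" using jk by (auto simp: P_def supp_def)
    have uniq: "i = j \<and> l = k" if "i \<in> supp h" "l < d" "w i l = w j k" for i l
      using jk j that by (auto simp: N_def)
    have "lam h v a = h j k a" for a
    proof -
      have "(\<Prod>l<d. if w i l = v then h i l a else 1) = (if i = j then h j k a else 1)"
        if "i \<in> J" for i
      proof -
        have "(\<Prod>l<d. if w i l = v then h i l a else 1)
            = (\<Prod>l<d. if l = k then (if i = j then h j k a else 1) else 1)"
        proof (rule prod.cong[OF refl])
          fix l assume l: "l \<in> {..<d}"
          show "(if w i l = v then h i l a else 1) = (if l = k then (if i = j then h j k a else 1) else 1)"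
          proof (cases "i \<in> supp h")
            case True
            then show ?thesis using uniq[of i l] l jk(2) by auto
          next
            case False
            then have "h i = 1" using that by (auto simp: supp_def)
            then show ?thesis using False j by auto
          qed
        qed
        also have "\<dots> = (if i = j then h j k a else 1)" using j by (simp add: prod.delta)
        finally show ?thesis .
      qed
      then have "lam h v a = (\<Prod>i\<in>J. if i = j then h j k a else 1)"
        by (simp add: lam_def)
      then show ?thesis using j finite_constraints by (simp add: prod.delta)
    qed
    then show ?thesis by blast
  qed
  have inj: "inj_on ?w (P - N)"
  proof (rule inj_onI)
    fix x y assume xy: "x \<in> P - N" "y \<in> P - N" "?w x = ?w y"
    show "x = y"
    proof (rule ccontr)
      assume "x \<noteq> y"
      then have "\<exists>b\<in>?A. b \<noteq> x \<and> ?w b = ?w x" using xy PA by (intro bexI[of _ y]) auto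
      then have "x \<in> N" using xy PA unfolding N_def by blast
      then show False using xy by simp
    qed
  qed
  have sub: "?w ` (P - N) \<subseteq> {v. v < n \<and> lam h v \<noteq> 1}"
    using single var_less by (fastforce simp: P_def supp_def)
  have "card (P - N) \<le> wt (lam h)"
    unfolding wt_def using card_mono[OF _ sub] card_image[OF inj] by simp
  moreover have "card P \<le> card (P - N) + card N"
  proof -
    have "finite N" using finA by (simp add: N_def)
    then have "card P \<le> card ((P - N) \<union> N)" using finP by (intro card_mono) auto
    then show ?thesis using card_Un_le[of "P - N" N] by linarith
  qed
  ultimately show ?thesis using N P by linarith
qed

text \<open>With \<open>s\<close> words and shortfall at most \<open>6 * s / 5\<close> the surviving
  weight is at least \<open>3 * s - 12 * s / 5 = 3 * s / 5\<close>; the factor \<open>5 / 3\<close>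
  is rounded up to 2. Low weight thus bounds the length of a derivation.\<close>

lemma supp_le_wt:
  assumes "h \<in> derivations (16 * T)"
  shows "card (supp h) \<le> 2 * wt (lam h)"
proof -
  have "5 * d * card (supp h) \<le> 5 * card (\<Union>j\<in>supp h. w j ` {..<d}) + 6 * card (supp h)"
    by (rule expansion) (use assms in \<open>auto simp: supp_def derivations_def\<close>)
  then show ?thesis using wt_lam_ge[OF assms] by linarith
qed

text \<open>The estimate \<open>3 * s / 5\<close> reaches 3 from \<open>s = 5\<close> on. For
  \<open>s = 3\<close> and \<open>s = 4\<close> integrality limits the shortfall to 3 and 4, leaving
  weights 3 and 4; a single constraint has no shared variable; for \<open>s = 2\<close> at most one
  variable is shared, by \<open>pair_expansion\<close>.\<close>

lemma wt_lam_ge_3: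
  assumes "h \<in> derivations (16 * T)" "h \<noteq> 1"
  shows "3 \<le> wt (lam h)"
proof -
  let ?s = "card (supp h)" and ?c = "card (\<Union>j\<in>supp h. w j ` {..<d})"
  have exp: "5 * d * ?s \<le> 5 * ?c + 6 * ?s"
    by (rule expansion) (use assms in \<open>auto simp: supp_def derivations_def\<close>)
  note ge = wt_lam_ge[OF assms(1)]
  have "supp h \<noteq> {}"
  proof
    assume "supp h = {}"
    then have "h j = 1" for j using assms by (cases "j \<in> J") (auto simp: supp_def derivations_def)
    then show False using assms(2) by (auto simp: fun_eq_iff)
  qed
  then have "?s \<noteq> 0" by (simp add: finite_supp)
  consider "?s = 1" | "?s = 2" | "?s = 3" | "?s = 4" | "?s \<ge> 5" using \<open>?s \<noteq> 0\<close> by linarith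
  then show ?thesis
  proof cases
    case 1
    then obtain j where j: "supp h = {j}" by (auto simp: card_1_singleton_iff)
    then have "j \<in> J" by (auto simp: supp_def)
    then have "?c = d" using var_inj[of j] j by (simp add: card_image)
    then show ?thesis using ge 1 by simp
  next
    case 2
    then obtain i j where ij: "supp h = {i, j}" "i \<noteq> j" by (auto simp: card_2_iff)
    then have "i \<in> J" "j \<in> J" by (auto simp: supp_def)
    then have "2 * d \<le> ?c + 1" using pair_expansion[of i j] ij by simp
    then show ?thesis using ge 2 by simp
  next
    case 5
    then show ?thesis using ge exp by linarith
  next
    case 3
    then show ?thesis using ge exp unfolding 3 by presburger
  next
    case 4
    then show ?thesis using ge exp unfolding 4 by presburger
  qed
qed

text \<open>The quotient of two derivations of one character has the trivial character, of weight 0,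
  and so is trivial by \<open>wt_lam_ge_3\<close>. In particular no character is forced to two
  different values.\<close>

lemma derivation_unique:
  assumes "h \<in> derivations (8 * T)" "h' \<in> derivations (8 * T)" "lam h = lam h'"
  shows "h = h'"
proof -
  have D: "h * cj h' \<in> derivations (16 * T)"
    using derivations_mult[OF assms(1) derivations_cj[OF assms(2)]] by simp
  have "lam (h * cj h') = 1"
    using assms(3) chars_mult_cnj[OF lam_chars[OF assms(2)]] by (simp add: lam_mult lam_cj)
  then have "h * cj h' = 1" using wt_lam_ge_3[OF D] by fastforce
  moreover have "h * (h' * cj h') = (h * cj h') * h'" by (simp only: ac_simps)
  ultimately show ?thesis using derivation_mult_cj[OF assms(2)] by simp
qed

text \<open>Fourier inversion. The range \<open>8 * T\<close> leaves room for products: a derivable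
  character of weight at most \<open>2 * T\<close> is derived with at most \<open>4 * T\<close>
  words, and two such derivations multiply to one with at most \<open>8 * T\<close>.\<close>

definition mass :: "(nat \<Rightarrow> nat) \<Rightarrow> complex" where
  "mass x = (\<Sum>h\<in>derivations (8 * T). rhs h * cnj (ch (lam h) x)) / of_nat q ^ n"

definition pE :: "((nat \<Rightarrow> nat) \<Rightarrow> complex) \<Rightarrow> complex" where
  "pE p = (\<Sum>x\<in>points. mass x * p x)"

section \<open>Fourier coefficients and multiplicativity of the pseudo-expectation\<close>

lemma pE_cong: "(\<And>x. x \<in> points \<Longrightarrow> p x = p' x) \<Longrightarrow> pE p = pE p'"
  by (simp add: pE_def)

lemma pE_sum: "pE (\<lambda>x. \<Sum>i\<in>A. p i x) = (\<Sum>i\<in>A. pE (p i))"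
  unfolding pE_def sum_distrib_left by (rule sum.swap)

lemma pE_add: "pE (\<lambda>x. p x + p' x) = pE p + pE p'"
  by (simp add: pE_def algebra_simps sum.distrib)

lemma pE_diff: "pE (\<lambda>x. p x - p' x) = pE p - pE p'"
  by (simp add: pE_def algebra_simps sum_subtractf)

lemma pE_scale: "pE (\<lambda>x. c * p x) = c * pE p"
  by (simp add: pE_def algebra_simps sum_distrib_left)

lemma sum_ch:
  assumes "g \<in> chars"
  shows "(\<Sum>x\<in>points. ch g x) = (if g = 1 then of_nat q ^ n else 0)"
proof -
  have "(\<Sum>x\<in>points. ch g x) = (\<Prod>v<n. \<Sum>a<q. g v a)"
    unfolding points_def ch_def by (subst prod_sum_PiE) auto
  also have "\<dots> = (if g = 1 then of_nat q ^ n else 0)"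
  proof (cases "g = 1")
    case False
    then obtain v where v: "g v \<noteq> 1" by (auto simp: fun_eq_iff)
    then have "v < n" using assms by (auto simp: chars_def not_less[symmetric])
    moreover have "(\<Sum>a<q. g v a) = 0" using v assms by (intro sum_char) (auto simp: chars_def)
    ultimately show ?thesis using False by (auto intro!: prod_zero)
  qed simp
  finally show ?thesis .
qed

lemma pE_ch:
  assumes "g \<in> chars"
  shows "pE (ch g) = (\<Sum>h\<in>derivations (8 * T). if lam h = g then rhs h else 0)"
proof -
  have eq: "(\<Sum>x\<in>points. cnj (ch (lam h) x) * ch g x) = (if lam h = g then of_nat q ^ n else 0)"
    if h: "h \<in> derivations (8 * T)" for h
  proof -
    have "(\<Sum>x\<in>points. cnj (ch (lam h) x) * ch g x) = (\<Sum>x\<in>points. ch (conj_family (lam h) * g) x)"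
      by (simp add: ch_mult ch_cnj)
    also have "\<dots> = (if conj_family (lam h) * g = 1 then of_nat q ^ n else 0)"
      by (intro sum_ch chars_mult chars_cnj lam_chars[OF h] assms)
    also have "conj_family (lam h) * g = 1 \<longleftrightarrow> lam h = g"
    proof
      assume "conj_family (lam h) * g = 1"
      then have "lam h * (conj_family (lam h) * g) = lam h" by simp
      then have "(lam h * conj_family (lam h)) * g = lam h" by (simp only: ac_simps)
      then show "lam h = g" using chars_mult_cnj[OF lam_chars[OF h]] by simp
    next
      assume "lam h = g"
      then show "conj_family (lam h) * g = 1"
        using chars_mult_cnj[OF lam_chars[OF h]] by (simp add: mult.commute)
    qed
    finally show ?thesis .
  qed
  have "pE (ch g) = (\<Sum>x\<in>points. \<Sum>h\<in>derivations (8 * T).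
      rhs h / of_nat q ^ n * (cnj (ch (lam h) x) * ch g x))"
    unfolding pE_def mass_def sum_divide_distrib sum_distrib_right
    by (intro sum.cong refl) simp
  also have "\<dots> = (\<Sum>h\<in>derivations (8 * T). rhs h / of_nat q ^ n *
      (\<Sum>x\<in>points. cnj (ch (lam h) x) * ch g x))"
    by (subst sum.swap) (simp add: sum_distrib_left)
  also have "\<dots> = (\<Sum>h\<in>derivations (8 * T). if lam h = g then rhs h else 0)"
    using q_pos by (intro sum.cong refl) (simp add: eq)
  finally show ?thesis .
qed

lemma pE_ch_lam:
  assumes "h \<in> derivations (8 * T)" shows "pE (ch (lam h)) = rhs h"
proof -
  have "pE (ch (lam h)) = (\<Sum>h'\<in>derivations (8 * T). if h' = h then rhs h' else 0)"
    unfolding pE_ch[OF lam_chars[OF assms]]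
    by (intro sum.cong refl) (use assms derivation_unique in auto)
  then show ?thesis using assms by (simp add: finite_derivations)
qed

lemma pE_ch_nonzeroE:
  assumes "g \<in> chars" "pE (ch g) \<noteq> 0" "wt g \<le> 2 * T"
  obtains h where "h \<in> derivations (4 * T)" "lam h = g" "pE (ch g) = rhs h"
proof -
  have "\<exists>h\<in>derivations (8 * T). lam h = g"
  proof (rule ccontr)
    assume "\<not> (\<exists>h\<in>derivations (8 * T). lam h = g)"
    then have "pE (ch g) = 0" unfolding pE_ch[OF assms(1)] by (intro sum.neutral) auto
    then show False using assms(2) by simp
  qed
  then obtain h where h: "h \<in> derivations (8 * T)" "lam h = g" by blast
  have "card (supp h) \<le> 4 * T"
    using supp_le_wt[OF derivations_subset[OF h(1)]] h(2) assms(3) by simp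
  then have "h \<in> derivations (4 * T)" using h(1) by (auto simp: derivations_def)
  then show ?thesis using that h pE_ch_lam by blast
qed

text \<open>If both values are nonzero, the two derivations multiply. If \<open>g'\<close> is not
  derivable, neither is \<open>g * g'\<close>, since dividing a derivation of the product by one of
  \<open>g\<close> would derive \<open>g'\<close>.\<close>

lemma pE_ch_mult:
  assumes "g \<in> chars" "g' \<in> chars" "wt g \<le> 2 * T" "wt g' \<le> 2 * T" "wt (g * g') \<le> 2 * T"
    and "pE (ch g) \<noteq> 0"
  shows "pE (ch (g * g')) = pE (ch g) * pE (ch g')"
proof -
  obtain h where h: "h \<in> derivations (4 * T)" "lam h = g" "pE (ch g) = rhs h"
    using pE_ch_nonzeroE assms by blast
  show ?thesis
  proof (cases "pE (ch g') = 0")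
    case False
    then obtain h' where h': "h' \<in> derivations (4 * T)" "lam h' = g'" "pE (ch g') = rhs h'"
      using pE_ch_nonzeroE assms by blast
    have "h * h' \<in> derivations (8 * T)" using derivations_mult[OF h(1) h'(1)] by simp
    then show ?thesis using pE_ch_lam[of "h * h'"] rhs_mult[OF h(1) h'(1)] h h' by (simp add: lam_mult)
  next
    case True
    have "pE (ch (g * g')) = 0"
    proof (rule ccontr)
      assume "pE (ch (g * g')) \<noteq> 0"
      then obtain h' where h': "h' \<in> derivations (4 * T)" "lam h' = g * g'"
        using pE_ch_nonzeroE assms chars_mult by metis
      have D: "cj h * h' \<in> derivations (8 * T)"
        using derivations_mult[OF derivations_cj[OF h(1)] h'(1)] by simp
      have "lam (cj h * h') = conj_family g * (g * g')" using h h' by (simp add: lam_mult lam_cj)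
      also have "\<dots> = (g * conj_family g) * g'" by (simp only: ac_simps)
      also have "\<dots> = g'" using chars_mult_cnj[OF assms(1)] by simp
      finally have "lam (cj h * h') = g'" .
      then have "pE (ch g') \<noteq> 0" using pE_ch_lam[OF D] rhs_nonzero[OF D] by simp
      then show False using True by simp
    qed
    then show ?thesis using True by simp
  qed
qed

lemma pE_ch_cnj:
  assumes "g \<in> chars" "wt g \<le> 2 * T"
  shows "pE (ch (conj_family g)) = cnj (pE (ch g))"
proof -
  have *: "pE (ch (conj_family g)) = cnj (pE (ch g))"
    if g: "g \<in> chars" "wt g \<le> 2 * T" "pE (ch g) \<noteq> 0" for g
  proof -
    obtain h where h: "h \<in> derivations (4 * T)" "lam h = g" "pE (ch g) = rhs h"
      by (rule pE_ch_nonzeroE[OF g(1,3,2)])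
    have "cj h \<in> derivations (8 * T)" using derivations_cj[OF h(1)] derivations_subset by auto
    then show ?thesis using pE_ch_lam[of "cj h"] rhs_cj[OF h(1)] h by (simp add: lam_cj)
  qed
  show ?thesis
  proof (cases "pE (ch g) = 0")
    case True
    then show ?thesis using *[of "conj_family g"] chars_cnj[OF assms(1)] assms(2) by (auto simp: wt_cnj)
  qed (use * assms in blast)
qed

lemma pE_ch_one: "pE (ch 1) = 1"
  using pE_ch_lam[OF derivations_one] by simp

text \<open>This is pairwise uniformity: up to two variables the pseudo-expectation is that of the
  uniform distribution, because a nontrivial derived character has weight at least 3.\<close>

lemma pE_ch_light:
  assumes "g \<in> chars" "wt g \<le> 2"
  shows "pE (ch g) = (if g = 1 then 1 else 0)"
proof (cases "g = 1")
  case False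
  have "lam h \<noteq> g" if "h \<in> derivations (8 * T)" for h
  proof
    assume "lam h = g"
    moreover have "h \<in> derivations (16 * T)" using derivations_subset[OF that] by simp
    ultimately show False using wt_lam_ge_3[of h] False assms(2) by fastforce
  qed
  then have "pE (ch g) = 0" unfolding pE_ch[OF assms(1)] by (intro sum.neutral) auto
  then show ?thesis using False by simp
qed (simp add: pE_ch_one)

section \<open>Positivity on the span of the low characters\<close>

definition low :: "(nat \<Rightarrow> nat \<Rightarrow> complex) set" where
  "low = {g\<in>chars. wt g \<le> T}"

text \<open>The moment matrix in the basis of low characters, as conjugating \<open>ch g'\<close>
  gives the character of the inverse family.\<close>

definition kap :: "(nat \<Rightarrow> nat \<Rightarrow> complex) \<Rightarrow> (nat \<Rightarrow> nat \<Rightarrow> complex) \<Rightarrow> complex" where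
  "kap g g' = pE (ch (g * conj_family g'))"

lemma low_diff:
  assumes "g \<in> low" "g' \<in> low"
  shows "g * conj_family g' \<in> chars" "wt (g * conj_family g') \<le> 2 * T"
  using assms wt_mult_le[of g "conj_family g'"] by (auto simp: low_def chars_mult chars_cnj wt_cnj)

text \<open>Together with \<open>kap_cnj\<close> and \<open>kap_refl\<close> this cocycle identity
  makes \<open>kap g g' \<noteq> 0\<close> an equivalence relation on \<open>low\<close>, and it
  determines a whole block from any one of its rows.\<close>

lemma kap_trans:
  assumes "g1 \<in> low" "g2 \<in> low" "g3 \<in> low" "kap g1 g2 \<noteq> 0"
  shows "kap g1 g3 = kap g1 g2 * kap g2 g3"
proof -
  have "(g1 * conj_family g2) * (g2 * conj_family g3) = g1 * (g2 * conj_family g2) * conj_family g3"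
    by (simp only: ac_simps)
  also have "\<dots> = g1 * conj_family g3" using chars_mult_cnj[of g2] assms by (simp add: low_def)
  finally have eq: "(g1 * conj_family g2) * (g2 * conj_family g3) = g1 * conj_family g3" .
  show ?thesis
    using pE_ch_mult[of "g1 * conj_family g2" "g2 * conj_family g3"] low_diff assms
    unfolding kap_def eq by auto
qed

lemma kap_cnj:
  assumes "g \<in> low" "g' \<in> low" shows "kap g' g = cnj (kap g g')"
proof -
  have "g' * conj_family g = conj_family (g * conj_family g')"
    by (simp add: conj_family_mult mult.commute)
  then show ?thesis using pE_ch_cnj[OF low_diff[OF assms]] by (simp add: kap_def)
qed

lemma kap_refl: "g \<in> low \<Longrightarrow> kap g g = 1"
  using chars_mult_cnj by (simp add: kap_def low_def pE_ch_one)

lemma finite_low: "finite low"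
  using finite_chars_family by (simp add: low_def)

text \<open>The kernel is block diagonal with rank-one blocks: averaging over the block of \<open>g\<^sub>0\<close> writes the
  form as a sum of squares.\<close>

lemma kap_psd:
  "0 \<le> Re (\<Sum>g\<in>low. \<Sum>g'\<in>low. p g * cnj (p g') * kap g g')"
proof -
  define m where "m g = card {g0\<in>low. kap g g0 \<noteq> 0}" for g
  define s where "s g0 = (\<Sum>g\<in>low. p g * kap g g0)" for g0
  have m_eq: "m g = m g0" if "g \<in> low" "g0 \<in> low" "kap g g0 \<noteq> 0" for g g0
  proof -
    have "kap g0 g \<noteq> 0" using kap_cnj[OF that(1,2)] that(3) by simp
    then have "kap g g1 \<noteq> 0 \<longleftrightarrow> kap g0 g1 \<noteq> 0" if "g1 \<in> low" for g1
      using kap_trans[of g g0 g1] kap_trans[of g0 g g1] \<open>g \<in> low\<close> \<open>g0 \<in> low\<close> \<open>kap g g0 \<noteq> 0\<close> that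
      by (metis mult_zero_right)
    then show ?thesis unfolding m_def by (metis (mono_tags, lifting))
  qed
  have m_pos: "m g \<noteq> 0" if "g \<in> low" for g
    using that kap_refl[OF that] finite_low by (auto simp: m_def)
  \<comment> \<open>Each of the \<open>m g\<close> members \<open>g0\<close> of the block of
    \<open>g\<close> contributes the same value \<open>kap g g' / m g\<close>; members of other
    blocks contribute 0.\<close>
  have key: "kap g g' = (\<Sum>g0\<in>low. kap g g0 * cnj (kap g' g0) / of_nat (m g0))"
    if g: "g \<in> low" "g' \<in> low" for g g'
  proof -
    have "(\<Sum>g0\<in>low. kap g g0 * cnj (kap g' g0) / of_nat (m g0))
        = (\<Sum>g0\<in>low. if kap g g0 \<noteq> 0 then kap g g' / of_nat (m g) else 0)"
    proof (rule sum.cong[OF refl])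
      fix g0 assume g0: "g0 \<in> low"
      show "kap g g0 * cnj (kap g' g0) / of_nat (m g0) = (if kap g g0 \<noteq> 0 then kap g g' / of_nat (m g) else 0)"
        using kap_trans[OF g(1) g0 g(2)] kap_cnj[OF g(2) g0] m_eq[OF g(1) g0] by auto
    qed
    also have "\<dots> = kap g g'"
    proof -
      have "(\<Sum>g0\<in>low. if kap g g0 \<noteq> 0 then kap g g' / of_nat (m g) else 0)
          = (\<Sum>g0\<in>{g0\<in>low. kap g g0 \<noteq> 0}. kap g g' / of_nat (m g))"
        by (rule sum.inter_filter[OF finite_low, symmetric])
      also have "\<dots> = of_nat (m g) * (kap g g' / of_nat (m g))"
        by (simp add: m_def)
      finally show ?thesis using m_pos[OF g(1)] by simp
    qed
    finally show ?thesis ..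
  qed
  have "(\<Sum>g\<in>low. \<Sum>g'\<in>low. p g * cnj (p g') * kap g g')
      = (\<Sum>g\<in>low. \<Sum>g'\<in>low. \<Sum>g0\<in>low. (p g * kap g g0) * cnj (p g' * kap g' g0) / of_nat (m g0))"
  proof (intro sum.cong refl)
    fix g g' assume g: "g \<in> low" "g' \<in> low"
    show "p g * cnj (p g') * kap g g'
        = (\<Sum>g0\<in>low. (p g * kap g g0) * cnj (p g' * kap g' g0) / of_nat (m g0))"
      unfolding key[OF g] sum_distrib_left by (intro sum.cong refl) simp
  qed
  also have "\<dots> = (\<Sum>g0\<in>low. \<Sum>g\<in>low. \<Sum>g'\<in>low. (p g * kap g g0) * cnj (p g' * kap g' g0) / of_nat (m g0))"
    by (rule trans[OF sum.cong[OF refl sum.swap] sum.swap])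
  also have "\<dots> = (\<Sum>g0\<in>low. s g0 * cnj (s g0) / of_nat (m g0))"
    unfolding s_def cnj_sum sum_product sum_divide_distrib by (rule refl)
  also have "\<dots> = (\<Sum>g0\<in>low. of_real ((cmod (s g0))\<^sup>2 / real (m g0)))"
    by (intro sum.cong refl) (simp add: complex_norm_square[symmetric])
  finally have "(\<Sum>g\<in>low. \<Sum>g'\<in>low. p g * cnj (p g') * kap g g')
      = of_real (\<Sum>g0\<in>low. (cmod (s g0))\<^sup>2 / real (m g0))" by simp
  then show ?thesis by (simp only: Re_complex_of_real) (auto intro!: sum_nonneg)
qed

section \<open>Functions of few variables as combinations of low characters\<close>

definition local :: "nat set \<Rightarrow> ((nat \<Rightarrow> nat) \<Rightarrow> 'a) \<Rightarrow> bool" where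
  "local A p \<longleftrightarrow> (\<forall>x\<in>points. \<forall>y\<in>points. (\<forall>v\<in>A. x v = y v) \<longrightarrow> p x = p y)"

definition ext :: "nat set \<Rightarrow> (nat \<Rightarrow> nat \<Rightarrow> complex) \<Rightarrow> nat \<Rightarrow> nat \<Rightarrow> complex" where
  "ext A g = (\<lambda>v. if v \<in> A then g v else 1)"

lemma ch_ext: "A \<subseteq> {..<n} \<Longrightarrow> ch (ext A g) x = (\<Prod>v\<in>A. g v (x v))"
proof -
  assume A: "A \<subseteq> {..<n}"
  have "ch (ext A g) x = (\<Prod>v<n. if v \<in> A then g v (x v) else 1)"
    unfolding ch_def ext_def by (intro prod.cong refl) auto
  also have "\<dots> = (\<Prod>v\<in>{..<n} \<inter> A. g v (x v))" by (subst prod.inter_restrict) auto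
  also have "{..<n} \<inter> A = A" using A by auto
  finally show ?thesis .
qed

lemma ext_chars:
  assumes "A \<subseteq> {..<n}" "g \<in> (\<Pi>\<^sub>E v\<in>A. \<Phi>)"
  shows "ext A g \<in> chars" "wt (ext A g) \<le> card A"
proof -
  show "ext A g \<in> chars" using assms by (auto simp: chars_def ext_def one_char)
  show "wt (ext A g) \<le> card A" unfolding wt_def ext_def
    by (rule card_mono) (use assms finite_subset in auto)
qed

text \<open>The tensor product over \<open>v \<in> A\<close> of the one-variable expansion
  \<open>sum_chars\<close>.\<close>

lemma indicator_expansion:
  assumes "A \<subseteq> {..<n}" "x \<in> points" "z \<in> points"
  shows "(if \<forall>v\<in>A. x v = z v then 1 else 0)
    = (\<Sum>g\<in>(\<Pi>\<^sub>E v\<in>A. \<Phi>). (\<Prod>v\<in>A. cnj (g v (z v))) / of_nat q ^ card A * ch (ext A g) x)"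
proof -
  have finA: "finite A" using assms finite_subset by blast
  have "(if \<forall>v\<in>A. x v = z v then 1 else 0) = (\<Prod>v\<in>A. if x v = z v then 1 else (0::complex))"
    using finA by (induction A rule: finite_induct) auto
  also have "\<dots> = (\<Prod>v\<in>A. (\<Sum>f\<in>\<Phi>. f (x v) * cnj (f (z v))) / of_nat q)"
  proof (rule prod.cong[OF refl])
    fix v assume "v \<in> A"
    then have "x v < q" "z v < q" using assms by (auto simp: points_def PiE_def Pi_def)
    then show "(if x v = z v then 1 else 0) = (\<Sum>f\<in>\<Phi>. f (x v) * cnj (f (z v))) / of_nat q"
      using q_pos by (simp add: sum_chars)
  qed
  also have "\<dots> = (\<Prod>v\<in>A. \<Sum>f\<in>\<Phi>. f (x v) * cnj (f (z v))) / of_nat q ^ card A"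
    by (simp add: prod_dividef)
  also have "(\<Prod>v\<in>A. \<Sum>f\<in>\<Phi>. f (x v) * cnj (f (z v)))
     = (\<Sum>g\<in>(\<Pi>\<^sub>E v\<in>A. \<Phi>). \<Prod>v\<in>A. g v (x v) * cnj (g v (z v)))"
    by (rule prod_sum_PiE) (auto simp: finA finite_chars)
  finally show ?thesis
    by (simp add: ch_ext[OF assms(1)] prod.distrib sum_divide_distrib algebra_simps)
qed

definition spanned :: "((nat \<Rightarrow> nat) \<Rightarrow> complex) \<Rightarrow> bool" where
  "spanned p \<longleftrightarrow> (\<exists>c. \<forall>x\<in>points. p x = (\<Sum>g\<in>low. c g * ch g x))"

lemma spanned_sum:
  assumes "\<And>i. i \<in> A \<Longrightarrow> spanned (p i)"
  shows "spanned (\<lambda>x. \<Sum>i\<in>A. c i * p i x)"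
proof -
  obtain f where f: "\<And>i x. i \<in> A \<Longrightarrow> x \<in> points \<Longrightarrow> p i x = (\<Sum>g\<in>low. f i g * ch g x)"
    using assms unfolding spanned_def by metis
  have "(\<Sum>i\<in>A. c i * p i x) = (\<Sum>g\<in>low. (\<Sum>i\<in>A. c i * f i g) * ch g x)" if "x \<in> points" for x
  proof -
    have "(\<Sum>i\<in>A. c i * p i x) = (\<Sum>i\<in>A. \<Sum>g\<in>low. c i * f i g * ch g x)"
      using f that by (intro sum.cong refl) (simp add: sum_distrib_left algebra_simps)
    also have "\<dots> = (\<Sum>g\<in>low. (\<Sum>i\<in>A. c i * f i g) * ch g x)"
      by (subst sum.swap) (simp add: sum_distrib_right)
    finally show ?thesis .
  qed
  then show ?thesis unfolding spanned_def by (intro exI[of _ "\<lambda>g. \<Sum>i\<in>A. c i * f i g"]) simp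
qed

lemma spanned_low: "g \<in> low \<Longrightarrow> spanned (ch g)"
  unfolding spanned_def
  by (rule exI[of _ "\<lambda>g'. if g' = g then 1 else 0"])
     (simp add: finite_low sum.delta' if_distrib[of "\<lambda>c. c * _"] cong: if_cong)

lemma spanned_cong:
  "spanned p \<Longrightarrow> (\<And>x. x \<in> points \<Longrightarrow> p' x = p x) \<Longrightarrow> spanned p'"
  unfolding spanned_def by auto

lemma local_spanned:
  assumes "A \<subseteq> {..<n}" "card A \<le> T" "local A p"
  shows "spanned p"
proof -
  \<comment> \<open>One representative for each restriction to \<open>A\<close>; off
    \<open>A\<close> the default value is 0, a legal label since \<open>q > 0\<close>.\<close>
  define Z where "Z = {z\<in>points. \<forall>v. v < n \<longrightarrow> v \<notin> A \<longrightarrow> z v = 0}"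
  have finZ: "finite Z" using finite_points by (simp add: Z_def)
  have rep: "p x = (\<Sum>z\<in>Z. p z * (if \<forall>v\<in>A. x v = z v then 1 else 0))" if x: "x \<in> points" for x
  proof -
    define z0 where "z0 = (\<lambda>v. if v < n then (if v \<in> A then x v else 0) else undefined)"
    have z0: "z0 \<in> Z" using x q_pos assms(1) by (auto simp: Z_def z0_def points_def PiE_def extensional_def)
    have agree: "\<forall>v\<in>A. x v = z0 v" using assms(1) by (auto simp: z0_def)
    have uniq: "z = z0" if "z \<in> Z" "\<forall>v\<in>A. x v = z v" for z
    proof
      fix v show "z v = z0 v"
        using that by (auto simp: Z_def z0_def points_def PiE_def extensional_def)
    qed
    have "(\<Sum>z\<in>Z. p z * (if \<forall>v\<in>A. x v = z v then 1 else 0)) = (\<Sum>z\<in>Z. if z = z0 then p z0 else 0)"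
      by (intro sum.cong refl) (use uniq agree in auto)
    also have "\<dots> = p z0" using z0 finZ by simp
    also have "\<dots> = p x"
    proof -
      have "z0 \<in> points" using z0 by (simp add: Z_def)
      then show ?thesis using assms(3) x agree unfolding local_def by (metis (no_types))
    qed
    finally show ?thesis ..
  qed
  have "spanned (\<lambda>x. if \<forall>v\<in>A. x v = z v then 1 else 0)" if "z \<in> Z" for z
  proof -
    have "spanned (\<lambda>x. \<Sum>g\<in>(\<Pi>\<^sub>E v\<in>A. \<Phi>). (\<Prod>v\<in>A. cnj (g v (z v))) / of_nat q ^ card A * ch (ext A g) x)"
    proof (intro spanned_sum spanned_low)
      fix g assume "g \<in> (\<Pi>\<^sub>E v\<in>A. \<Phi>)"
      then show "ext A g \<in> low"
        using ext_chars[OF assms(1), of g] assms(2) by (simp add: low_def)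
    qed
    then show ?thesis
      by (rule spanned_cong) (use that in \<open>simp add: indicator_expansion[OF assms(1)] Z_def\<close>)
  qed
  then have "spanned (\<lambda>x. \<Sum>z\<in>Z. p z * (if \<forall>v\<in>A. x v = z v then 1 else 0))"
    by (rule spanned_sum)
  then show ?thesis by (rule spanned_cong) (use rep in simp)
qed

lemma pE_square_nonneg:
  fixes p :: "(nat \<Rightarrow> nat) \<Rightarrow> real"
  assumes "spanned (\<lambda>x. of_real (p x))"
  shows "0 \<le> Re (pE (\<lambda>x. of_real ((p x)\<^sup>2)))"
proof -
  obtain c where c: "\<And>x. x \<in> points \<Longrightarrow> of_real (p x) = (\<Sum>g\<in>low. c g * ch g x)"
    using assms unfolding spanned_def by blast
  have "pE (\<lambda>x. of_real ((p x)\<^sup>2))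
      = pE (\<lambda>x. \<Sum>g\<in>low. \<Sum>g'\<in>low. c g * cnj (c g') * ch (g * conj_family g') x)"
  proof (rule pE_cong)
    fix x assume x: "x \<in> points"
    have "complex_of_real ((p x)\<^sup>2) = of_real (p x) * cnj (of_real (p x))"
      by (simp add: power2_eq_square)
    also have "\<dots> = (\<Sum>g\<in>low. \<Sum>g'\<in>low. c g * cnj (c g') * ch (g * conj_family g') x)"
      unfolding c[OF x] cnj_sum sum_product by (simp add: ch_mult ch_cnj algebra_simps)
    finally show "complex_of_real ((p x)\<^sup>2) = \<dots>" .
  qed
  also have "\<dots> = (\<Sum>g\<in>low. \<Sum>g'\<in>low. c g * cnj (c g') * kap g g')"
    by (simp add: pE_sum pE_scale kap_def)
  finally show ?thesis using kap_psd by simp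
qed

text \<open>An indicator is its own square, so positivity on squares suffices.\<close>

lemma pE_local_nonneg:
  fixes P :: "(nat \<Rightarrow> nat) \<Rightarrow> bool"
  assumes "A \<subseteq> {..<n}" "card A \<le> T" "local A P"
  shows "0 \<le> Re (pE (\<lambda>x. if P x then 1 else 0))"
proof -
  have "local A (\<lambda>x. complex_of_real (if P x then 1 else 0))"
    using assms(3) unfolding local_def by metis
  then have "0 \<le> Re (pE (\<lambda>x. of_real ((if P x then 1 else 0)\<^sup>2)))"
    by (intro pE_square_nonneg local_spanned[OF assms(1,2)])
  moreover have "(\<lambda>x. complex_of_real ((if P x then 1 else 0)\<^sup>2)) = (\<lambda>x. if P x then 1 else 0)"
    by auto
  ultimately show ?thesis by simp
qed

lemma pE_one: "pE (\<lambda>x. 1) = 1"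
  using pE_ch_one by (simp add: ch_def pE_def)

text \<open>Of the Fourier expansion of the indicator only the trivial character survives, by
  \<open>pE_ch_light\<close>, and its coefficient is \<open>1 / q ^ card A\<close>.\<close>

lemma pE_light_indicator:
  assumes "A \<subseteq> {..<n}" "card A \<le> 2" "\<And>v. v \<in> A \<Longrightarrow> a v < q"
  shows "pE (\<lambda>x. if \<forall>v\<in>A. x v = a v then 1 else 0) = 1 / of_nat q ^ card A"
proof -
  define z where "z = (\<lambda>v. if v < n then (if v \<in> A then a v else 0) else undefined)"
  have z: "z \<in> points"
    using assms(3) q_pos by (auto simp: z_def points_def PiE_def extensional_def)
  have zA: "z v = a v" if "v \<in> A" for v using that assms(1) by (auto simp: z_def)
  let ?one = "\<lambda>v\<in>A. (1 :: nat \<Rightarrow> complex)"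
  have one: "?one \<in> (\<Pi>\<^sub>E v\<in>A. \<Phi>)" by (auto simp: one_char)
  have finA: "finite A" using assms finite_subset by blast
  have fin: "finite (\<Pi>\<^sub>E v\<in>A. \<Phi>)" using finA by (simp add: finite_PiE finite_chars)
  have ext_one: "ext A g = 1 \<longleftrightarrow> g = ?one" if "g \<in> (\<Pi>\<^sub>E v\<in>A. \<Phi>)" for g
  proof
    assume "ext A g = 1"
    then have "(if v \<in> A then g v else 1) = 1" for v by (simp add: ext_def fun_eq_iff)
    then have "g v = 1" if "v \<in> A" for v using that by metis
    then have "g v = ?one v" for v
      using \<open>g \<in> _\<close> by (cases "v \<in> A") (auto simp: PiE_def extensional_def)
    then show "g = ?one" by blast
  qed (auto simp: ext_def fun_eq_iff)
  have "pE (\<lambda>x. if \<forall>v\<in>A. x v = a v then 1 else 0)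
      = pE (\<lambda>x. \<Sum>g\<in>(\<Pi>\<^sub>E v\<in>A. \<Phi>). (\<Prod>v\<in>A. cnj (g v (z v))) / of_nat q ^ card A * ch (ext A g) x)"
  proof (rule pE_cong)
    fix x assume x: "x \<in> points"
    have "(\<forall>v\<in>A. x v = a v) \<longleftrightarrow> (\<forall>v\<in>A. x v = z v)" using zA by auto
    then show "(if \<forall>v\<in>A. x v = a v then 1 else 0)
      = (\<Sum>g\<in>(\<Pi>\<^sub>E v\<in>A. \<Phi>). (\<Prod>v\<in>A. cnj (g v (z v))) / of_nat q ^ card A * ch (ext A g) x)"
      using indicator_expansion[OF assms(1) x z] by simp
  qed
  also have "\<dots> = (\<Sum>g\<in>(\<Pi>\<^sub>E v\<in>A. \<Phi>). (\<Prod>v\<in>A. cnj (g v (z v))) / of_nat q ^ card A * pE (ch (ext A g)))"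
    by (simp only: pE_sum pE_scale)
  also have "\<dots> = (\<Sum>g\<in>(\<Pi>\<^sub>E v\<in>A. \<Phi>). if g = ?one then 1 / of_nat q ^ card A else 0)"
  proof (rule sum.cong[OF refl])
    fix g assume g: "g \<in> (\<Pi>\<^sub>E v\<in>A. \<Phi>)"
    have "pE (ch (ext A g)) = (if g = ?one then 1 else 0)"
      using pE_ch_light[of "ext A g"] ext_chars[OF assms(1) g] assms(2) ext_one[OF g] by simp
    then show "(\<Prod>v\<in>A. cnj (g v (z v))) / of_nat q ^ card A * pE (ch (ext A g))
        = (if g = ?one then 1 / of_nat q ^ card A else 0)"
      by simp
  qed
  also have "\<dots> = 1 / of_nat q ^ card A" using one fin by simp
  finally show ?thesis .
qed

text \<open>Three zeros of a monic quadratic are refuted by one dual word on the positions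
  \<open>k\<close>, \<open>l\<close>, \<open>m\<close>: its constraint forces the value
  \<open>\<gamma> c * \<beta>\<close>, whereas wherever \<open>p\<close> is nonzero,
  \<open>x\<close> equals \<open>b\<close> at these positions and the value is
  \<open>\<beta>\<close>. As \<open>\<gamma> c \<noteq> 1\<close>, nothing is left.\<close>

lemma pE_three_zeros:
  assumes j: "j \<in> J" and klm: "k < l" "l < m" "m < d"
    and loc: "local (w j ` {..<d}) p"
    and van: "\<And>x. x \<in> points \<Longrightarrow> p x \<noteq> 0 \<Longrightarrow> \<forall>i\<in>{k, l, m}. x (w j i) = b j i"
  shows "pE p = 0"
proof -
  obtain c where c: "c \<in> C" "\<And>i. i \<notin> {k, l, m} \<Longrightarrow> c i = 1" "\<gamma> c \<noteq> 1"
    using code_triple[OF klm] by auto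
  define h where "h = (\<lambda>i. if i = j then c else 1)"
  have "supp h \<subseteq> {j}" by (auto simp: supp_def h_def split: if_splits)
  then have "card (supp h) \<le> 1" using card_mono[of "{j}" "supp h"] by simp
  then have h1: "h \<in> derivations 1"
    using j c(1) by (auto simp: derivations_def h_def one_code)
  have d3: "3 \<le> T" using klm arity_le by linarith
  define \<beta> where "\<beta> = (\<Prod>i<d. c i (b j i))"
  have "\<beta> * cnj \<beta> = 1"
    using unimodular[OF code_chars[OF c(1)]] by (simp add: \<beta>_def prod.distrib[symmetric])
  then have \<beta>: "\<beta> \<noteq> 0" by auto
  have rhs: "rhs h = \<gamma> c * \<beta>"
  proof -
    have "rhs h = (\<Prod>i\<in>J. if i = j then \<gamma> c * \<beta> else 1)"
      unfolding rhs_def by (intro prod.cong refl) (auto simp: h_def \<beta>_def gamma_one)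
    then show ?thesis using j finite_constraints by simp
  qed
  have chh: "ch (lam h) x = (\<Prod>i<d. c i (x (w j i)))" for x
  proof -
    have "ch (lam h) x = (\<Prod>i\<in>J. if i = j then (\<Prod>i<d. c i (x (w j i))) else 1)"
      unfolding ch_lam by (intro prod.cong refl) (auto simp: h_def)
    then show ?thesis using j finite_constraints by simp
  qed
  have cardA: "w j ` {..<d} \<subseteq> {..<n}" "card (w j ` {..<d}) \<le> T"
    using var_less[OF j] arity_le card_image_le[of "{..<d}" "w j"] by auto
  have wth: "wt (lam h) \<le> T"
  proof -
    have "v \<in> w j ` {..<d}" if "v < n" "lam h v \<noteq> 1" for v
    proof (rule ccontr)
      assume "v \<notin> w j ` {..<d}"
      then have "lam h v a = 1" for a
        unfolding lam_def by (intro prod.neutral ballI) (auto simp: h_def)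
      then show False using that by (auto simp: fun_eq_iff)
    qed
    then have "{v. v < n \<and> lam h v \<noteq> 1} \<subseteq> w j ` {..<d}" by blast
    then have "wt (lam h) \<le> card (w j ` {..<d})" unfolding wt_def by (intro card_mono) auto
    then show ?thesis using cardA by simp
  qed
  have h8: "h \<in> derivations (8 * T)" using derivations_subset[OF h1] d3 by simp
  note lamc = lam_chars[OF h8]
  have nz: "pE (ch (lam h)) \<noteq> 0" using pE_ch_lam[OF h8] rhs_nonzero[OF h8] by simp
  obtain f where f: "\<And>x. x \<in> points \<Longrightarrow> p x = (\<Sum>g\<in>low. f g * ch g x)"
    using local_spanned[OF cardA loc] unfolding spanned_def by blast
  \<comment> \<open>Against low characters \<open>lam h\<close> acts as the constant
    \<open>rhs h\<close>: its weight is at most \<open>T\<close>, so all products stay within weight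
    \<open>2 * T\<close> and \<open>pE_ch_mult\<close> applies.\<close>
  have "pE (\<lambda>x. ch (lam h) x * p x) = pE (\<lambda>x. \<Sum>g\<in>low. f g * ch (lam h * g) x)"
    by (rule pE_cong) (simp add: f ch_mult sum_distrib_left algebra_simps)
  also have "\<dots> = (\<Sum>g\<in>low. f g * pE (ch (lam h * g)))" by (simp only: pE_sum pE_scale)
  also have "\<dots> = (\<Sum>g\<in>low. rhs h * (f g * pE (ch g)))"
  proof (rule sum.cong[OF refl])
    fix g assume g: "g \<in> low"
    have "pE (ch (lam h * g)) = pE (ch (lam h)) * pE (ch g)"
      by (rule pE_ch_mult) (use g wth lamc nz wt_mult_le[of "lam h" g] in \<open>auto simp: low_def\<close>)
    then show "f g * pE (ch (lam h * g)) = rhs h * (f g * pE (ch g))"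
      using pE_ch_lam[OF h8] by simp
  qed
  also have "\<dots> = rhs h * pE (\<lambda>x. \<Sum>g\<in>low. f g * ch g x)"
    by (simp only: pE_sum pE_scale sum_distrib_left)
  also have "pE (\<lambda>x. \<Sum>g\<in>low. f g * ch g x) = pE p"
    by (rule pE_cong) (simp add: f)
  finally have 1: "pE (\<lambda>x. ch (lam h) x * p x) = rhs h * pE p" .
  have "pE (\<lambda>x. ch (lam h) x * p x) = pE (\<lambda>x. \<beta> * p x)"
  proof (rule pE_cong)
    fix x assume x: "x \<in> points"
    show "ch (lam h) x * p x = \<beta> * p x"
    proof (cases "p x = 0")
      case False
      have "c i (x (w j i)) = c i (b j i)" for i
        using van[OF x False] c(2)[of i] by (cases "i \<in> {k, l, m}") auto
      then show ?thesis by (simp add: chh \<beta>_def)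
    qed simp
  qed
  then have "pE (\<lambda>x. ch (lam h) x * p x) = \<beta> * pE p" by (simp only: pE_scale)
  then have "\<gamma> c * (\<beta> * pE p) = \<beta> * pE p" using 1 rhs by (simp only: mult.assoc)
  then show ?thesis using c(3) \<beta> by auto
qed

section \<open>The pseudo-probability that a right vertex is not covered\<close>

definition zeros :: "nat \<Rightarrow> (nat \<Rightarrow> nat) \<Rightarrow> nat set" where
  "zeros j x = {k. k < d \<and> x (w j k) = b j k}"

lemma local_zeros: "local (w j ` {..<d}) (\<lambda>x. F (zeros j x))"
proof -
  have "zeros j x = zeros j y" if "\<forall>v\<in>w j ` {..<d}. x v = y v" for x y
    using that by (auto simp: zeros_def)
  then show ?thesis unfolding local_def by metis
qed

text \<open>For \<open>z \<le> 2\<close> the indicator of \<open>z = 0\<close> is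
  \<open>1 - z + z * (z - 1) / 2\<close>. Zero sets of size at least 3 have pseudo-probability 0, so
  only the first two moments of the number of zeros enter, and these are the uniform ones.\<close>

lemma pE_no_zeros:
  assumes j: "j \<in> J"
  shows "pE (\<lambda>x. if zeros j x = {} then 1 else 0)
    = of_real (1 - real d / real q + real d * (real d - 1) / (2 * (real q)\<^sup>2))"
proof -
  define r where "r B = 1 - of_nat (card B) + (of_nat (card B) ^ 2 - of_nat (card B)) / (2::complex)" for B :: "nat set"
  define \<B> where "\<B> = {B. B \<subseteq> {..<d} \<and> 3 \<le> card B}"
  have fin\<B>: "finite \<B>" by (simp add: \<B>_def)
  have finz: "finite (zeros j x)" "zeros j x \<subseteq> {..<d}" for x by (auto simp: zeros_def)
  define I where "I k x = (if x (w j k) = b j k then 1 else (0::complex))" for k and x :: "nat \<Rightarrow> nat"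
  have Z: "of_nat (card (zeros j x)) = (\<Sum>k<d. I k x)" for x
  proof -
    have "(\<Sum>k<d. I k x) = (\<Sum>k\<in>{k\<in>{..<d}. x (w j k) = b j k}. 1)"
      unfolding I_def by (rule sum.inter_filter[symmetric]) simp
    also have "{k\<in>{..<d}. x (w j k) = b j k} = zeros j x" by (auto simp: zeros_def)
    finally show ?thesis by simp
  qed
  \<comment> \<open>The polynomial \<open>r\<close> differs from the indicator only on zero sets of
    three or more positions; the sum over \<open>\<B>\<close> corrects it there and is then
    annihilated by \<open>zero\<close>.\<close>
  have expand: "(if zeros j x = {} then 1 else 0) = r (zeros j x) - (\<Sum>B\<in>\<B>. r B * (if zeros j x = B then 1 else 0))" for x
  proof (cases "zeros j x \<in> \<B>")
    case True
    then have "zeros j x \<noteq> {}" by (auto simp: \<B>_def)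
    moreover have "(\<Sum>B\<in>\<B>. r B * (if zeros j x = B then 1 else 0)) = (\<Sum>B\<in>\<B>. if B = zeros j x then r B else 0)"
      by (intro sum.cong refl) auto
    ultimately show ?thesis using True fin\<B> by simp
  next
    case False
    then have "card (zeros j x) < 3" using finz by (auto simp: \<B>_def)
    then consider "card (zeros j x) = 0" | "card (zeros j x) = 1" | "card (zeros j x) = 2" by linarith
    then have "r (zeros j x) = (if zeros j x = {} then 1 else 0)"
      by cases (use finz in \<open>auto simp: r_def\<close>)
    moreover have "(\<Sum>B\<in>\<B>. r B * (if zeros j x = B then 1 else 0)) = 0"
      by (rule sum.neutral) (use False in auto)
    ultimately show ?thesis by simp
  qed
  have zero: "pE (\<lambda>x. if zeros j x = B then 1 else 0) = 0" if B: "B \<in> \<B>" for B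
  proof -
    have "finite B" using B finite_subset by (auto simp: \<B>_def)
    then obtain k l m where klm: "k < l" "l < m" "k \<in> B" "l \<in> B" "m \<in> B"
      using B ex_three_less unfolding \<B>_def by blast
    then have "m < d" using B by (auto simp: \<B>_def)
    show ?thesis
    proof (rule pE_three_zeros[OF j klm(1,2) \<open>m < d\<close> local_zeros])
      fix x assume "(if zeros j x = B then 1 else (0::complex)) \<noteq> 0"
      then show "\<forall>i\<in>{k, l, m}. x (w j i) = b j i"
        using klm by (auto simp: zeros_def split: if_splits)
    qed
  qed
  have single: "pE (I k) = 1 / of_nat q" if "k < d" for k
    using pE_light_indicator[of "{w j k}" "\<lambda>_. b j k"] var_less[OF j that] shift_less[OF j that]
    by (simp add: I_def[abs_def])
  have pair: "pE (\<lambda>x. I k x * I l x) = (if k = l then 1 / of_nat q else 1 / of_nat q ^ 2)"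
    if kl: "k < d" "l < d" for k l
  proof (cases "k = l")
    case True
    then have "(\<lambda>x. I k x * I l x) = I k" by (auto simp: I_def)
    then show ?thesis using single[OF kl(1)] True by simp
  next
    case False
    then have ne: "w j k \<noteq> w j l" using var_inj[OF j] kl by (auto simp: inj_on_def)
    have "(\<lambda>x. I k x * I l x) = (\<lambda>x. if \<forall>v\<in>{w j k, w j l}. x v = (if v = w j k then b j k else b j l) then 1 else 0)"
      using ne by (auto simp: I_def fun_eq_iff)
    moreover have "pE (\<lambda>x. if \<forall>v\<in>{w j k, w j l}. x v = (if v = w j k then b j k else b j l) then 1 else 0)
       = 1 / of_nat q ^ card {w j k, w j l}"
      by (rule pE_light_indicator) (use kl var_less[OF j] shift_less[OF j] ne in auto)
    ultimately show ?thesis using False ne by (simp add: power2_eq_square)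
  qed
  have EZ: "pE (\<lambda>x. of_nat (card (zeros j x))) = of_nat d / of_nat q"
    unfolding Z pE_sum by (simp add: single)
  have EZ2: "pE (\<lambda>x. of_nat (card (zeros j x)) ^ 2)
      = of_nat d / of_nat q + of_nat d * (of_nat d - 1) / of_nat q ^ 2"
  proof -
    have "pE (\<lambda>x. of_nat (card (zeros j x)) ^ 2) = (\<Sum>k<d. \<Sum>l<d. pE (\<lambda>x. I k x * I l x))"
      unfolding Z power2_eq_square sum_product by (simp only: pE_sum)
    also have "\<dots> = (\<Sum>k<d. \<Sum>l<d. 1 / of_nat q ^ 2 + (if k = l then 1 / of_nat q - 1 / of_nat q ^ 2 else 0))"
      by (intro sum.cong refl) (simp add: pair)
    also have "\<dots> = (\<Sum>k<d. of_nat d / of_nat q ^ 2 + (1 / of_nat q - 1 / of_nat q ^ 2))"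
      by (intro sum.cong refl) (simp add: sum.distrib)
    also have "\<dots> = of_nat d / of_nat q + of_nat d * (of_nat d - 1) / of_nat q ^ 2"
      by (simp add: algebra_simps add_divide_distrib diff_divide_distrib)
    finally show ?thesis .
  qed
  have "pE (\<lambda>x. if zeros j x = {} then 1 else 0)
      = pE (\<lambda>x. r (zeros j x)) - (\<Sum>B\<in>\<B>. r B * pE (\<lambda>x. if zeros j x = B then 1 else 0))"
    unfolding expand by (simp only: pE_diff pE_sum pE_scale)
  also have "\<dots> = pE (\<lambda>x. r (zeros j x))" using zero by simp
  also have "\<dots> = pE (\<lambda>x. (1 - of_nat (card (zeros j x))) + (1 / 2) * (of_nat (card (zeros j x)) ^ 2 - of_nat (card (zeros j x))))"
    by (rule pE_cong) (simp add: r_def)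
  also have "\<dots> = 1 - of_nat d / of_nat q + (1 / 2) * (of_nat d * (of_nat d - 1) / of_nat q ^ 2)"
    by (simp only: pE_add pE_diff pE_scale pE_one EZ EZ2) simp
  also have "\<dots> = of_real (1 - real d / real q + real d * (real d - 1) / (2 * (real q)\<^sup>2))"
    by simp
  finally show ?thesis .
qed

end

section \<open>The Lasserre solution\<close>

context expanding_system
begin

text \<open>Left vertices \<open>u > n q\<close> are the isolated ones; they are always selected.\<close>

definition val :: "(nat \<Rightarrow> nat) \<Rightarrow> nat \<Rightarrow> bool" where
  "val x u \<longleftrightarrow> (u \<le> n * q \<longrightarrow> x ((u - 1) div q) = (u - 1) mod q)"

definition sat :: "(nat \<Rightarrow> nat) \<Rightarrow> assignment \<Rightarrow> bool" where
  "sat x f \<longleftrightarrow> (\<forall>u\<in>dom f. f u = Some (val x u))"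

text \<open>Nonnegativity on squares was shown for real parts, so the real part is what enters the
  program.\<close>

definition ysol :: "assignment \<Rightarrow> real" where
  "ysol f = Re (pE (\<lambda>x. if sat x f then 1 else 0))"

lemma sat_combine: "agree f g \<Longrightarrow> sat x (f ++ g) \<longleftrightarrow> sat x f \<and> sat x g"
proof -
  assume ag: "agree f g"
  have app: "(f ++ g) u = (if u \<in> dom g then g u else f u)" for u
    by (simp add: map_add_dom_app_simps)
  have fg: "f u = g u" if "u \<in> dom f" "u \<in> dom g" for u using ag that by (auto simp: agree_def)
  show ?thesis
  proof
    assume "sat x (f ++ g)"
    then have "\<forall>u\<in>dom g \<union> dom f. (if u \<in> dom g then g u else f u) = Some (val x u)"
      unfolding sat_def app dom_map_add .
    then have s: "(if u \<in> dom g then g u else f u) = Some (val x u)" if "u \<in> dom f \<union> dom g" for u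
      using that by blast
    have "f u = Some (val x u)" if "u \<in> dom f" for u
      using s[of u] fg[OF that] that by (cases "u \<in> dom g") auto
    moreover have "g u = Some (val x u)" if "u \<in> dom g" for u using s[of u] that by simp
    ultimately show "sat x f \<and> sat x g" by (simp add: sat_def)
  next
    assume "sat x f \<and> sat x g"
    then show "sat x (f ++ g)" unfolding sat_def app dom_map_add by auto
  qed
qed

lemma sat_agree: "sat x f \<Longrightarrow> sat x g \<Longrightarrow> agree f g"
  by (auto simp: sat_def agree_def)

text \<open>No point satisfies two disagreeing assignments, so the convention that such pairs have
  value 0 agrees with the pseudo-expectation of the product of the two indicators.\<close>

lemma comb2_ysol: "comb2 ysol f g = Re (pE (\<lambda>x. if sat x f \<and> sat x g then 1 else 0))"
proof (cases "agree f g")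
  case True
  then show ?thesis by (simp add: comb2_def ysol_def sat_combine)
next
  case False
  then have "\<not> (sat x f \<and> sat x g)" for x using sat_agree by blast
  then have "(\<lambda>x. if sat x f \<and> sat x g then 1 else (0::complex)) = (\<lambda>x. 0)" by auto
  then show ?thesis using False by (simp add: comb2_def pE_def)
qed

lemma comb3_ysol:
  "comb3 ysol f g h = Re (pE (\<lambda>x. if sat x f \<and> sat x g \<and> sat x h then 1 else 0))"
proof (cases "agree f g")
  case True
  then show ?thesis by (simp add: comb3_def comb2_ysol sat_combine)
next
  case False
  then have "\<not> (sat x f \<and> sat x g \<and> sat x h)" for x using sat_agree by blast
  then have "(\<lambda>x. if sat x f \<and> sat x g \<and> sat x h then 1 else (0::complex)) = (\<lambda>x. 0)" by auto
  then show ?thesis using False by (simp add: comb3_def pE_def)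
qed

text \<open>Whether a vertex is selected depends on the single variable
  \<open>(u - 1) div q\<close>, or on none if \<open>u > n * q\<close>; hence the number of
  variables is at most the number of vertices.\<close>

lemma local_sat:
  assumes "finite (dom f)" "0 \<notin> dom f"
  obtains A where "A \<subseteq> {..<n}" "card A \<le> card (dom f)" "local A (\<lambda>x. sat x f)"
proof
  let ?A = "(\<lambda>u. (u - 1) div q) ` {u\<in>dom f. u \<le> n * q}"
  show "?A \<subseteq> {..<n}"
  proof
    fix v assume "v \<in> ?A"
    then obtain u where u: "u \<in> dom f" "u \<le> n * q" "v = (u - 1) div q" by auto
    then have "u \<noteq> 0" using assms(2) by metis
    then have "u - 1 < n * q" using u by linarith
    then show "v \<in> {..<n}" using u q_pos by (simp add: less_mult_imp_div_less)
  qed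
  have "card ?A \<le> card {u\<in>dom f. u \<le> n * q}" by (rule card_image_le) (use assms in simp)
  also have "\<dots> \<le> card (dom f)" by (rule card_mono) (use assms in auto)
  finally show "card ?A \<le> card (dom f)" .
  have v: "val x u = val y u" if "\<forall>v\<in>?A. x v = y v" "u \<in> dom f" for x y u
    using that by (auto simp: val_def)
  have "sat x f = sat y f" if "\<forall>v\<in>?A. x v = y v" for x y
    unfolding sat_def using v[OF that] by simp
  then show "local ?A (\<lambda>x. sat x f)" unfolding local_def by blast
qed

lemma card_val:
  assumes x: "x \<in> points" and N: "n * q \<le> N"
  shows "card {u\<in>{1..N}. val x u} = n + (N - n * q)"
proof -
  have xq: "x v < q" if "v < n" for v using x that by (auto simp: points_def PiE_def Pi_def)
  let ?f = "\<lambda>v. v * q + x v + 1"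
  have dm: "(v * q + x v) div q = v" "(v * q + x v) mod q = x v" if "v < n" for v
    using xq[OF that] by (auto simp: div_mult_self3)
  have "{u\<in>{1..N}. val x u} = ?f ` {..<n} \<union> {n * q + 1..N}"
  proof (intro equalityI subsetI)
    fix u assume u: "u \<in> {u\<in>{1..N}. val x u}"
    show "u \<in> ?f ` {..<n} \<union> {n * q + 1..N}"
    proof (cases "u \<le> n * q")
      case True
      then have v: "x ((u - 1) div q) = (u - 1) mod q" using u by (simp add: val_def)
      have "u - 1 < n * q" using True u by auto
      then have "(u - 1) div q < n" by (simp add: less_mult_imp_div_less)
      moreover have "u = ?f ((u - 1) div q)"
        unfolding v using u div_mult_mod_eq[of "u - 1" q] by auto
      ultimately show ?thesis by blast
    qed (use u in auto)
  next
    fix u assume "u \<in> ?f ` {..<n} \<union> {n * q + 1..N}"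
    then show "u \<in> {u\<in>{1..N}. val x u}"
    proof
      assume "u \<in> ?f ` {..<n}"
      then obtain v where v: "v < n" "u = ?f v" by auto
      have "u \<le> v * q + q" using v xq[of v] by simp
      also have "\<dots> = (v + 1) * q" by simp
      also have "\<dots> \<le> n * q" using v by (intro mult_right_mono) auto
      finally have "u \<le> n * q" .
      then show ?thesis using v N dm by (simp add: val_def)
    qed (auto simp: val_def)
  qed
  moreover have "?f ` {..<n} \<inter> {n * q + 1..N} = {}"
  proof -
    have "?f v \<le> n * q" if "v < n" for v
    proof -
      have "?f v \<le> (v + 1) * q" using xq[OF that] by simp
      also have "\<dots> \<le> n * q" using that by (intro mult_right_mono) auto
      finally show ?thesis .
    qed
    then show ?thesis by (fastforce)
  qed
  moreover have "inj_on ?f {..<n}"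
  proof (rule inj_onI)
    fix v v' assume "v \<in> {..<n}" "v' \<in> {..<n}" "?f v = ?f v'"
    then have "(v * q + x v) div q = (v' * q + x v') div q" "v < n" "v' < n" by auto
    then show "v = v'" using dm(1) by simp
  qed
  ultimately show ?thesis by (simp add: card_Un_disjoint card_image)
qed

text \<open>The form is the pseudo-expectation of the square of a combination of indicators, each
  depending on at most \<open>t \<le> T\<close> variables.\<close>

lemma moment_psd:
  assumes "t \<le> T"
  shows "0 \<le> (\<Sum>f\<in>lasserre_index N t. \<Sum>g\<in>lasserre_index N t. c f * comb2 ysol f g * c g)"
proof -
  let ?I = "lasserre_index N t"
  let ?p = "\<lambda>x. \<Sum>f\<in>?I. c f * (if sat x f then 1 else 0)"
  have "spanned (\<lambda>x. \<Sum>f\<in>?I. of_real (c f) * (if sat x f then 1 else 0))"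
  proof (rule spanned_sum)
    fix f assume f: "f \<in> ?I"
    then have "finite (dom f)" "0 \<notin> dom f"
      using finite_subset[of "dom f" "{1..N}"] by (auto simp: lasserre_index_def)
    then obtain A where A: "A \<subseteq> {..<n}" "card A \<le> card (dom f)" "local A (\<lambda>x. sat x f)"
      by (rule local_sat)
    have "card A \<le> T" using A(2) f assms by (simp add: lasserre_index_def)
    moreover have "local A (\<lambda>x. if sat x f then 1 else (0::complex))"
      using A(3) unfolding local_def by metis
    ultimately show "spanned (\<lambda>x. if sat x f then 1 else 0)"
      using local_spanned A(1) by blast
  qed
  then have "spanned (\<lambda>x. of_real (?p x))"
    by (rule spanned_cong) (auto intro!: sum.cong)
  then have "0 \<le> Re (pE (\<lambda>x. of_real ((?p x)\<^sup>2)))" by (rule pE_square_nonneg)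
  also have "pE (\<lambda>x. of_real ((?p x)\<^sup>2))
      = pE (\<lambda>x. \<Sum>f\<in>?I. \<Sum>g\<in>?I. of_real (c f * c g) * (if sat x f \<and> sat x g then 1 else 0))"
    unfolding power2_eq_square sum_product of_real_sum by (intro pE_cong sum.cong refl) simp
  also have "\<dots> = (\<Sum>f\<in>?I. \<Sum>g\<in>?I. of_real (c f * c g) * pE (\<lambda>x. if sat x f \<and> sat x g then 1 else 0))"
    by (simp only: pE_sum pE_scale)
  also have "Re \<dots> = (\<Sum>f\<in>?I. \<Sum>g\<in>?I. c f * comb2 ysol f g * c g)"
    unfolding Re_sum comb2_ysol by (intro sum.cong refl) (simp del: of_real_mult add: algebra_simps)
  finally show ?thesis .
qed

lemma sum_comb3_ysol:
  assumes "n * q \<le> N"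
  shows "(\<Sum>i=1..N. comb3 ysol f g [i \<mapsto> True]) = real (n + (N - n * q)) * comb2 ysol f g"
proof -
  have "(\<Sum>i=1..N. comb3 ysol f g [i \<mapsto> True])
      = Re (pE (\<lambda>x. \<Sum>i=1..N. if sat x f \<and> sat x g \<and> sat x [i \<mapsto> True] then 1 else 0))"
    by (simp add: comb3_ysol pE_sum)
  also have "pE (\<lambda>x. \<Sum>i=1..N. if sat x f \<and> sat x g \<and> sat x [i \<mapsto> True] then 1 else 0)
      = pE (\<lambda>x. of_nat (n + (N - n * q)) * (if sat x f \<and> sat x g then 1 else 0))"
  proof (rule pE_cong)
    fix x assume x: "x \<in> points"
    have "(\<Sum>i=1..N. if sat x f \<and> sat x g \<and> sat x [i \<mapsto> True] then 1 else 0)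
        = (\<Sum>i\<in>{i\<in>{1..N}. val x i}. if sat x f \<and> sat x g then 1 else (0::complex))"
      by (subst sum.inter_filter) (auto simp: sat_def[of _ "[_ \<mapsto> True]"] intro!: sum.cong)
    also have "\<dots> = of_nat (n + (N - n * q)) * (if sat x f \<and> sat x g then 1 else 0)"
      unfolding sum_constant card_val[OF x assms] ..
    finally show "(\<Sum>i=1..N. if sat x f \<and> sat x g \<and> sat x [i \<mapsto> True] then 1 else (0::complex)) = \<dots>" .
  qed
  also have "Re \<dots> = real (n + (N - n * q)) * comb2 ysol f g"
    unfolding pE_scale comb2_ysol by (simp del: of_nat_add)
  finally show ?thesis .
qed

text \<open>Exactly \<open>n + (N - n * q)\<close> vertices are selected at every point, so the
  second matrix is the first times the scalar \<open>?e\<close>. It is nonnegative because an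
  isolated vertex counts 1 in the selection but only \<open>1 / q\<close> in
  \<open>N / q\<close>.\<close>

lemma ysol_feasible:
  assumes "t \<le> T" "n * q \<le> N"
  shows "lasserre_feasible N (1 / real q) t ysol"
proof -
  let ?e = "real (n + (N - n * q)) - 1 / real q * real N"
  have sym: "comb2 ysol f g = comb2 ysol g f" for f g
    unfolding comb2_ysol by (simp add: conj_commute)
  have mat: "(\<Sum>i=1..N. comb3 ysol f g [i \<mapsto> True]) - 1 / real q * real N * comb2 ysol f g
      = ?e * comb2 ysol f g" for f g
    unfolding sum_comb3_ysol[OF assms(2)] by (simp add: algebra_simps)
  have e: "0 \<le> ?e"
  proof -
    have "real N = real n * real q + real (N - n * q)" using assms(2)
      by (metis of_nat_add of_nat_mult le_add_diff_inverse)
    then have "real N / real q = real n + real (N - n * q) / real q"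
      using q_pos by (simp add: field_simps)
    moreover have "real (N - n * q) / real q \<le> real (N - n * q) / 1"
      using q_pos by (intro divide_left_mono) auto
    ultimately show ?thesis by simp
  qed
  have "ysol Map.empty = 1" by (simp add: ysol_def sat_def pE_one)
  moreover have "psd_on (lasserre_index N t) (comb2 ysol)"
    unfolding psd_on_def using sym moment_psd[OF assms(1)] by auto
  moreover have "psd_on (lasserre_index N t) (\<lambda>f g. ?e * comb2 ysol f g)"
    unfolding psd_on_def
  proof (intro conjI ballI allI)
    fix c :: "assignment \<Rightarrow> real"
    have "(\<Sum>f\<in>lasserre_index N t. \<Sum>g\<in>lasserre_index N t. c f * (?e * comb2 ysol f g) * c g)
        = ?e * (\<Sum>f\<in>lasserre_index N t. \<Sum>g\<in>lasserre_index N t. c f * comb2 ysol f g * c g)"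
      unfolding sum_distrib_left by (intro sum.cong refl) (simp add: algebra_simps)
    then show "0 \<le> (\<Sum>f\<in>lasserre_index N t. \<Sum>g\<in>lasserre_index N t. c f * (?e * comb2 ysol f g) * c g)"
      using moment_psd[OF assms(1)] e by (simp only: mult_nonneg_nonneg)
  qed (use sym in auto)
  ultimately show ?thesis unfolding lasserre_feasible_def mat by blast
qed

lemma sat_all_zero: "sat x (all_zero R) \<longleftrightarrow> (\<forall>u\<in>R. \<not> val x u)"
  by (auto simp: sat_def all_zero_def dom_def)

text \<open>Caps at 1 the cost of a right vertex whose constraint is given up.\<close>

lemma ysol_nonneg:
  assumes "finite R" "0 \<notin> R" "card R \<le> T"
  shows "0 \<le> ysol (all_zero R)"
proof -
  have dom: "dom (all_zero R) = R" by (auto simp: all_zero_def dom_def)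
  then obtain A where "A \<subseteq> {..<n}" "card A \<le> card R" "local A (\<lambda>x. sat x (all_zero R))"
    using local_sat[of "all_zero R"] assms by metis
  then show ?thesis unfolding ysol_def using assms(3) by (intro pE_local_nonneg[of A]) auto
qed

text \<open>Only part of the full tuple may remain as neighbours after degrees are cut. Removing
  neighbours enlarges the event that none is selected, and the added event is local, hence has
  nonnegative weight.\<close>

lemma ysol_zero_ge:
  assumes j: "j \<in> J" and R: "R \<subseteq> (\<lambda>k. w j k * q + b j k + 1) ` {..<d}"
  shows "1 - real d / real q + real d * (real d - 1) / (2 * (real q)\<^sup>2) \<le> ysol (all_zero R)"
proof -
  have vl: "val x (w j k * q + b j k + 1) \<longleftrightarrow> x (w j k) = b j k" if k: "k < d" for x k
  proof -
    have "w j k * q + b j k + 1 \<le> (w j k + 1) * q" using shift_less[OF j k] by simp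
    also have "\<dots> \<le> n * q" using var_less[OF j k] by (intro mult_right_mono) auto
    finally show ?thesis using shift_less[OF j k] by (simp add: val_def div_mult_self3)
  qed
  define S where "S = {k. k < d \<and> w j k * q + b j k + 1 \<in> R}"
  have RS: "R = (\<lambda>k. w j k * q + b j k + 1) ` S" using R by (auto simp: S_def)
  have s: "sat x (all_zero R) \<longleftrightarrow> zeros j x \<inter> S = {}" for x
    unfolding sat_all_zero RS using vl by (auto simp: zeros_def S_def)
  have A: "w j ` {..<d} \<subseteq> {..<n}" "card (w j ` {..<d}) \<le> T"
    using var_less[OF j] arity_le card_image_le[of "{..<d}" "w j"] by auto
  let ?P = "\<lambda>x. zeros j x \<inter> S = {} \<and> zeros j x \<noteq> {}"
  have "pE (\<lambda>x. if sat x (all_zero R) then 1 else 0)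
      = pE (\<lambda>x. (if zeros j x = {} then 1 else 0) + (if ?P x then 1 else 0))"
    by (rule pE_cong) (auto simp: s)
  also have "\<dots> = pE (\<lambda>x. if zeros j x = {} then 1 else 0) + pE (\<lambda>x. if ?P x then 1 else 0)"
    by (simp only: pE_add)
  finally have "ysol (all_zero R) = (1 - real d / real q + real d * (real d - 1) / (2 * (real q)\<^sup>2))
      + Re (pE (\<lambda>x. if ?P x then 1 else 0))"
    unfolding ysol_def pE_no_zeros[OF j] by (simp only: plus_complex.simps Re_complex_of_real)
  moreover have "0 \<le> Re (pE (\<lambda>x. if ?P x then 1 else 0))"
    by (rule pE_local_nonneg[OF A local_zeros])
  ultimately show ?thesis by simp
qed

end

section \<open>The code of monic quadratics\<close>

text \<open>On elements killed by \<open>p\<close> this yields a subgroup: the negative is the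
  \<open>(p - 1)\<close>-fold sum.\<close>

definition (in ring) add_closed :: "'a set \<Rightarrow> bool" where
  "add_closed S \<longleftrightarrow> S \<subseteq> carrier R \<and> \<zero> \<in> S \<and> (\<forall>x\<in>S. \<forall>y\<in>S. x \<oplus> y \<in> S)"

lemma (in ring) add_closed_add_pow:
  assumes "add_closed S" "x \<in> S" shows "[(k::nat)] \<cdot> x \<in> S"
  using assms by (induction k) (auto simp: add_closed_def)

text \<open>A maximal proper subgroup \<open>H\<close> of an elementary abelian \<open>p\<close>-group has index \<open>p\<close>, so sending
  \<open>h + k x\<close> to the \<open>k\<close>-th power of a primitive \<open>p\<close>-th root of unity is a character.\<close>

lemma (in ring) exists_additive_character:
  fixes p :: nat
  assumes p: "prime p" and F: "add_closed F" "finite F" "F \<noteq> {\<zero>}"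
    and tors: "\<And>x. x \<in> F \<Longrightarrow> [p] \<cdot> x = \<zero>"
  obtains \<psi> :: "'a \<Rightarrow> complex" where "\<And>x y. x \<in> F \<Longrightarrow> y \<in> F \<Longrightarrow> \<psi> (x \<oplus> y) = \<psi> x * \<psi> y"
    "\<And>x. \<psi> x * cnj (\<psi> x) = 1" "\<exists>z\<in>F. \<psi> z \<noteq> 1"
proof -
  let ?\<H> = "{H. add_closed H \<and> H \<subset> F}"
  have Fc: "F \<subseteq> carrier R" using F(1) by (simp add: add_closed_def)
  have "{\<zero>} \<in> ?\<H>" using F by (auto simp: add_closed_def)
  moreover have "finite ?\<H>" by (rule finite_subset[of _ "Pow F"]) (use F(2) in auto)
  ultimately have "\<exists>H\<in>?\<H>. \<forall>H'\<in>?\<H>. H \<subseteq> H' \<longrightarrow> H = H'"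
    by (intro finite_has_maximal) auto
  then obtain H where H: "H \<in> ?\<H>" and max: "\<And>H'. H' \<in> ?\<H> \<Longrightarrow> H \<subseteq> H' \<Longrightarrow> H = H'"
    by (elim bexE) simp
  have Hc: "add_closed H" "H \<subseteq> F" "H \<noteq> F" using H by auto
  then obtain x where x: "x \<in> F" "x \<notin> H" by blast
  have xc: "x \<in> carrier R" using x Fc by blast
  have cl: "h \<in> carrier R" if "h \<in> H" for h using that Hc(2) Fc by blast
  \<comment> \<open>The subgroup generated by \<open>H\<close> and \<open>x\<close>; by maximality
    of \<open>H\<close> it is all of \<open>F\<close>.\<close>
  define H' where "H' = (\<lambda>(h, k::nat). h \<oplus> [k] \<cdot> x) ` (H \<times> UNIV)"
  have H'I: "h \<oplus> [k] \<cdot> x \<in> H'" if "h \<in> H" for h and k :: nat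
    unfolding H'_def using that by (intro image_eqI[of _ _ "(h, k)"]) auto
  have H'E: "\<exists>h k. h \<in> H \<and> u = h \<oplus> [(k::nat)] \<cdot> x" if "u \<in> H'" for u
    using that by (auto simp: H'_def)
  have H0: "\<zero> \<in> H" using Hc(1) by (simp add: add_closed_def)
  have H'F: "H' \<subseteq> F"
  proof
    fix u assume "u \<in> H'"
    then obtain h and k :: nat where "h \<in> H" "u = h \<oplus> [k] \<cdot> x" using H'E by blast
    then show "u \<in> F" using F(1) Hc(2) add_closed_add_pow[OF F(1) x(1), of k] by (auto simp: add_closed_def)
  qed
  have "add_closed H'"
    unfolding add_closed_def
  proof (intro conjI ballI)
    show "H' \<subseteq> carrier R" using H'F Fc by blast
    show "\<zero> \<in> H'" using H'I[OF H0, of 0] by simp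
    fix u v assume "u \<in> H'" "v \<in> H'"
    then obtain h k g l where *: "h \<in> H" "g \<in> H" "u = h \<oplus> [(k::nat)] \<cdot> x" "v = g \<oplus> [(l::nat)] \<cdot> x"
      using H'E by blast
    then have "u \<oplus> v = (h \<oplus> g) \<oplus> ([k] \<cdot> x \<oplus> [l] \<cdot> x)"
      using cl xc by (simp add: a_ac)
    also have "\<dots> = (h \<oplus> g) \<oplus> [(k + l)] \<cdot> x" using xc by (simp add: add.nat_pow_mult)
    finally show "u \<oplus> v \<in> H'" using H'I[of "h \<oplus> g" "k + l"] * Hc(1) by (simp add: add_closed_def)
  qed
  moreover have "H \<subseteq> H'"
  proof
    fix h assume h: "h \<in> H"
    then show "h \<in> H'" using H'I[OF h, of 0] cl by simp
  qed
  moreover have "x \<in> H'"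
    using H'I[OF H0, of 1] xc by simp
  ultimately have H'eq: "H' = F" using max[of H'] H'F x(2) by blast
  have neg: "\<exists>h'\<in>H. h \<oplus> h' = \<zero>" if h: "h \<in> H" for h
  proof
    show "[(p - 1)] \<cdot> h \<in> H" by (rule add_closed_add_pow[OF Hc(1) h])
    have "h \<oplus> [(p - 1)] \<cdot> h = [(Suc (p - 1))] \<cdot> h" using add.nat_pow_Suc2[OF cl[OF h], of "p - 1"] by simp
    then show "h \<oplus> [(p - 1)] \<cdot> h = \<zero>" using tors[of h] h Hc(2) prime_gt_0_nat[OF p] by auto
  qed
  \<comment> \<open>If \<open>p\<close> did not divide \<open>m\<close>, some multiple of
    \<open>m\<close> would be 1 mod \<open>p\<close>, and \<open>x\<close> itself would lie in
    \<open>H\<close>.\<close>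
  have dvd: "p dvd m" if m: "[m] \<cdot> x \<in> H" for m :: nat
  proof (rule ccontr)
    assume "\<not> p dvd m"
    then have "coprime m p" using p by (metis prime_imp_coprime coprime_commute)
    then obtain a where a: "[m * a = Suc 0] (mod p)" using cong_solve_coprime_nat by blast
    have xx: "[(k::nat)] \<cdot> x = [(k mod p)] \<cdot> x" for k
    proof -
      have "[k] \<cdot> x = [(p * (k div p) + k mod p)] \<cdot> x" by simp
      also have "\<dots> = [(p * (k div p))] \<cdot> x \<oplus> [(k mod p)] \<cdot> x" using xc by (simp only: add.nat_pow_mult)
      also have "[(p * (k div p))] \<cdot> x = [(k div p)] \<cdot> ([p] \<cdot> x)" using xc by (simp add: add.nat_pow_pow)
      finally show ?thesis using tors[OF x(1)] xc by simp
    qed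
    have "[a] \<cdot> ([m] \<cdot> x) \<in> H" by (rule add_closed_add_pow[OF Hc(1) m])
    then have "[(m * a)] \<cdot> x \<in> H" using xc by (simp add: add.nat_pow_pow)
    moreover have "[(m * a)] \<cdot> x = x"
      using xx[of "m * a"] xx[of 1] a xc unfolding cong_def by simp
    ultimately show False using x(2) by simp
  qed
  have cong': "[k = l] (mod p)" if e: "h \<oplus> [k] \<cdot> x = g \<oplus> [l] \<cdot> x" "h \<in> H" "g \<in> H" "k \<le> l" for h g and k l :: nat
  proof -
    obtain g' where g': "g' \<in> H" "g \<oplus> g' = \<zero>" using neg[OF e(3)] by blast
    have kx: "[k] \<cdot> x \<in> carrier R" "[(l - k)] \<cdot> x \<in> carrier R" using xc by auto
    have gc: "g \<in> carrier R" "g' \<in> carrier R" "h \<in> carrier R" using cl e g' by auto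
    have "[l] \<cdot> x = [(l - k)] \<cdot> x \<oplus> [k] \<cdot> x" using e(4) xc by (simp add: add.nat_pow_mult)
    then have "h \<oplus> [k] \<cdot> x = (g \<oplus> [(l - k)] \<cdot> x) \<oplus> [k] \<cdot> x" using e(1) gc kx by (simp add: a_assoc)
    then have "h = g \<oplus> [(l - k)] \<cdot> x" using gc kx by (metis add.m_closed add.r_cancel)
    then have "h \<oplus> g' = (g \<oplus> g') \<oplus> [(l - k)] \<cdot> x" using gc kx by (simp add: a_ac)
    then have "[(l - k)] \<cdot> x = h \<oplus> g'" using g' kx by simp
    then have "[(l - k)] \<cdot> x \<in> H" using e(2) g'(1) Hc(1) by (simp add: add_closed_def)
    then have "p dvd (l - k)" by (rule dvd)
    then show ?thesis using e(4) by (metis cong_altdef_nat cong_sym)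
  qed
  have cong: "[k = l] (mod p)" if e: "h \<oplus> [k] \<cdot> x = g \<oplus> [l] \<cdot> x" "h \<in> H" "g \<in> H" for h g and k l :: nat
    using cong'[OF e] cong'[OF e(1)[symmetric] e(3,2)] cong_sym by (cases "k \<le> l") auto
  define \<omega> where "\<omega> = cis (2 * pi / real p)"
  have p0: "0 < p" using prime_gt_0_nat[OF p] .
  have \<omega>p: "\<omega> ^ p = 1" using p0 by (simp add: \<omega>_def DeMoivre)
  have \<omega>cong: "\<omega> ^ k = \<omega> ^ l" if "[k = l] (mod p)" for k l
  proof -
    have "\<omega> ^ k = \<omega> ^ (k mod p)" for k
    proof -
      have "\<omega> ^ k = \<omega> ^ (p * (k div p) + k mod p)" by simp
      also have "\<dots> = (\<omega> ^ p) ^ (k div p) * \<omega> ^ (k mod p)" by (simp only: power_add power_mult)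
      finally show ?thesis using \<omega>p by simp
    qed
    then show ?thesis using that unfolding cong_def by metis
  qed
  have \<omega>1: "\<omega> \<noteq> 1"
  proof
    assume "\<omega> = 1"
    then have "cos (2 * pi / real p) = 1" by (simp add: \<omega>_def complex_eq_iff)
    then obtain i :: int where i: "2 * pi / real p = of_int i * 2 * pi" using cos_one_2pi_int by auto
    then have "1 = of_int i * real p" using p0 by (simp add: field_simps)
    then have "real_of_int 1 = real_of_int (i * int p)" by simp
    then have "1 = i * int p" by (simp only: of_int_eq_iff)
    then have "int p dvd 1" by (metis dvd_triv_right)
    then show False using prime_gt_1_nat[OF p] by simp
  qed
  \<comment> \<open>An arbitrary exponent is chosen; by \<open>cong\<close> it is determined mod
    \<open>p\<close>, which is all that a power of \<open>\<omega>\<close> sees.\<close>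
  define kk where "kk u = (SOME k::nat. \<exists>h\<in>H. u = h \<oplus> [k] \<cdot> x)" for u
  have kk: "\<exists>h\<in>H. u = h \<oplus> [kk u] \<cdot> x" if "u \<in> F" for u
  proof -
    have "\<exists>k::nat. \<exists>h\<in>H. u = h \<oplus> [k] \<cdot> x" using H'E[of u] that H'eq by blast
    then show ?thesis unfolding kk_def by (rule someI_ex)
  qed
  show ?thesis
  proof (rule that[of "\<lambda>u. \<omega> ^ kk u"])
    show "\<omega> ^ kk (u \<oplus> v) = \<omega> ^ kk u * \<omega> ^ kk v" if uv: "u \<in> F" "v \<in> F" for u v
    proof -
      obtain h g where hg: "h \<in> H" "u = h \<oplus> [kk u] \<cdot> x" "g \<in> H" "v = g \<oplus> [kk v] \<cdot> x"
        using kk uv by metis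
      have "u \<oplus> v \<in> F" using F(1) uv by (simp add: add_closed_def)
      then obtain f where f: "f \<in> H" "u \<oplus> v = f \<oplus> [kk (u \<oplus> v)] \<cdot> x" using kk by blast
      have "u \<oplus> v = (h \<oplus> [kk u] \<cdot> x) \<oplus> (g \<oplus> [kk v] \<cdot> x)" using hg by metis
      also have "\<dots> = (h \<oplus> g) \<oplus> ([kk u] \<cdot> x \<oplus> [kk v] \<cdot> x)" using hg(1,3) cl xc by (simp add: a_ac)
      also have "\<dots> = (h \<oplus> g) \<oplus> [(kk u + kk v)] \<cdot> x" using xc by (simp add: add.nat_pow_mult)
      finally have "f \<oplus> [kk (u \<oplus> v)] \<cdot> x = (h \<oplus> g) \<oplus> [(kk u + kk v)] \<cdot> x" using f(2) by simp
      moreover have "h \<oplus> g \<in> H" using hg Hc(1) by (simp add: add_closed_def)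
      ultimately have "[kk (u \<oplus> v) = kk u + kk v] (mod p)" using f(1) by (intro cong)
      then show ?thesis using \<omega>cong by (simp add: power_add[symmetric])
    qed
    show "\<omega> ^ kk u * cnj (\<omega> ^ kk u) = 1" for u
      by (simp add: \<omega>_def cis_cnj power_mult_distrib[symmetric] cis_mult)
    have "\<exists>h\<in>H. x = h \<oplus> [kk x] \<cdot> x" using kk x(1) .
    then obtain h where h: "h \<in> H" "x = h \<oplus> [kk x] \<cdot> x" by blast
    have "h \<oplus> [kk x] \<cdot> x = \<zero> \<oplus> [(1::nat)] \<cdot> x" using h(2) xc by simp
    then have "[kk x = 1] (mod p)" using h(1) H0 by (intro cong)
    then have "\<omega> ^ kk x = \<omega>" using \<omega>cong[of "kk x" 1] by simp
    then show "\<exists>z\<in>F. \<omega> ^ kk z \<noteq> 1" using \<omega>1 x(1) by (intro bexI[of _ x]) simp_all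
  qed
qed

text \<open>The finite field stays a subset \<open>F\<close> of an ambient field. \<open>e\<close>
  attaches the labels below \<open>q\<close> to its elements, and since \<open>d \<le> q\<close> the
  elements \<open>e k\<close> with \<open>k < d\<close> double as distinct evaluation
  points.\<close>

locale field_with_character = field R for R (structure) +
  fixes F :: "'a set" and \<psi> :: "'a \<Rightarrow> complex" and e :: "nat \<Rightarrow> 'a" and q d :: nat
  assumes F_carrier: "F \<subseteq> carrier R"
    and F_zero: "\<zero> \<in> F" and F_add: "\<And>x y. x \<in> F \<Longrightarrow> y \<in> F \<Longrightarrow> x \<oplus> y \<in> F"
    and F_neg: "\<And>x. x \<in> F \<Longrightarrow> \<ominus> x \<in> F"
    and F_mult: "\<And>x y. x \<in> F \<Longrightarrow> y \<in> F \<Longrightarrow> x \<otimes> y \<in> F"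
    and F_inv: "\<And>x. x \<in> F \<Longrightarrow> x \<noteq> \<zero> \<Longrightarrow> inv x \<in> F"
    and psi_add: "\<And>x y. x \<in> F \<Longrightarrow> y \<in> F \<Longrightarrow> \<psi> (x \<oplus> y) = \<psi> x * \<psi> y"
    and psi_unimodular: "\<And>x. \<psi> x * cnj (\<psi> x) = 1"
    and psi_nontrivial: "\<exists>z\<in>F. \<psi> z \<noteq> 1"
    and bij_e: "bij_betw e {..<q} F"
    and d_le: "d \<le> q"
begin

section \<open>Additive characters of the finite field\<close>

lemma Fc: "x \<in> F \<Longrightarrow> x \<in> carrier R" using F_carrier by blast

lemma e_F: "x < q \<Longrightarrow> e x \<in> F" using bij_e by (auto simp: bij_betw_def)

lemma psi_zero: "\<psi> \<zero> = 1"
proof -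
  have "\<psi> \<zero> * \<psi> \<zero> = \<psi> \<zero>" using psi_add[OF F_zero F_zero] by simp
  moreover have "\<psi> \<zero> \<noteq> 0" using psi_unimodular[of \<zero>] by auto
  ultimately show ?thesis by simp
qed

lemma psi_neg: "x \<in> F \<Longrightarrow> \<psi> (\<ominus> x) = cnj (\<psi> x)"
proof -
  assume x: "x \<in> F"
  have "\<psi> x * \<psi> (\<ominus> x) = 1" using psi_add[OF x F_neg[OF x]] psi_zero Fc[OF x] by (simp add: r_neg)
  then have "\<psi> x * \<psi> (\<ominus> x) = \<psi> x * cnj (\<psi> x)" using psi_unimodular by simp
  moreover have "\<psi> x \<noteq> 0" using psi_unimodular[of x] by auto
  ultimately show ?thesis by simp
qed

definition idx :: "'a \<Rightarrow> nat" where "idx = inv_into {..<q} e"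

lemma idx_less: "x \<in> F \<Longrightarrow> idx x < q"
  using bij_e inv_into_into[of x e "{..<q}"] by (auto simp: bij_betw_def idx_def)

lemma e_idx: "x \<in> F \<Longrightarrow> e (idx x) = x"
  using bij_e by (auto simp: bij_betw_def idx_def f_inv_into_f)

lemma idx_e: "x < q \<Longrightarrow> idx (e x) = x"
  using bij_e by (auto simp: bij_betw_def idx_def inv_into_f_f)

text \<open>Multiplying the argument of one nontrivial character by \<open>a\<close> yields all
  additive characters of the field as \<open>a\<close> varies; here they are tabulated on
  labels.\<close>

definition chr :: "'a \<Rightarrow> nat \<Rightarrow> complex" where
  "chr a = (\<lambda>x. if x < q then \<psi> (a \<otimes> e x) else 1)"

lemma chr_idx: "y \<in> F \<Longrightarrow> chr a (idx y) = \<psi> (a \<otimes> y)"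
  by (simp add: chr_def idx_less e_idx)

lemma chr_zero: "chr \<zero> = 1"
  by (auto simp: chr_def fun_eq_iff psi_zero Fc e_F)

lemma chr_add: "a \<in> F \<Longrightarrow> b \<in> F \<Longrightarrow> chr (a \<oplus> b) = chr a * chr b"
  by (auto simp: chr_def fun_eq_iff l_distr Fc e_F psi_add F_mult)

lemma chr_neg: "a \<in> F \<Longrightarrow> chr (\<ominus> a) = (\<lambda>x. cnj (chr a x))"
  by (auto simp: chr_def fun_eq_iff l_minus Fc e_F psi_neg F_mult)

lemma chr_unimodular: "chr a x * cnj (chr a x) = 1"
  by (simp add: chr_def psi_unimodular)

lemma finite_F: "finite F" using bij_e bij_betw_finite by blast
lemma card_F: "card F = q" using bij_betw_same_card[OF bij_e] by simp

text \<open>Translation by an element \<open>y0\<close> with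
  \<open>\<psi> (a \<otimes> y0) \<noteq> 1\<close> permutes \<open>F\<close> and multiplies the sum
  by that value.\<close>

lemma sum_psi:
  assumes a: "a \<in> F" "a \<noteq> \<zero>"
  shows "(\<Sum>y\<in>F. \<psi> (a \<otimes> y)) = 0"
proof -
  obtain z where z: "z \<in> F" "\<psi> z \<noteq> 1" using psi_nontrivial by blast
  define y0 where "y0 = inv a \<otimes> z"
  have y0: "y0 \<in> F" using a z by (simp add: y0_def F_mult F_inv)
  have au: "a \<in> Units R" using a Fc field_Units by auto
  have "a \<otimes> y0 = z"
    unfolding y0_def using au z Fc a by (simp add: m_assoc[symmetric] Units_r_inv)
  then have p0: "\<psi> (a \<otimes> y0) \<noteq> 1" using z by simp
  have inj: "inj_on (\<lambda>y. y \<oplus> y0) F"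
    by (rule inj_onI) (use Fc y0 in \<open>auto simp: add.r_cancel\<close>)
  have "(\<lambda>y. y \<oplus> y0) ` F = F"
    by (rule endo_inj_surj[OF finite_F _ inj]) (use F_add y0 in auto)
  then have "(\<Sum>y\<in>F. \<psi> (a \<otimes> y)) = (\<Sum>y\<in>F. \<psi> (a \<otimes> (y \<oplus> y0)))"
    using sum.reindex[OF inj, of "\<lambda>y. \<psi> (a \<otimes> y)"] by simp
  also have "\<dots> = (\<Sum>y\<in>F. \<psi> (a \<otimes> y)) * \<psi> (a \<otimes> y0)"
    unfolding sum_distrib_right
    by (intro sum.cong refl) (use a y0 Fc in \<open>simp add: r_distr psi_add F_mult\<close>)
  finally have "(\<Sum>y\<in>F. \<psi> (a \<otimes> y)) * (1 - \<psi> (a \<otimes> y0)) = 0" by (simp add: algebra_simps)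
  then show ?thesis using p0 by simp
qed

lemma sum_chr: "(\<Sum>x<q. chr a x) = (\<Sum>y\<in>F. \<psi> (a \<otimes> y))"
proof -
  have "(\<Sum>x<q. chr a x) = (\<Sum>x\<in>{..<q}. \<psi> (a \<otimes> e x))" by (intro sum.cong refl) (simp add: chr_def)
  also have "\<dots> = (\<Sum>y\<in>F. \<psi> (a \<otimes> y))" by (rule sum.reindex_bij_betw[OF bij_e])
  finally show ?thesis .
qed

lemma q_pos': "0 < q" using card_F F_zero finite_F by (metis card_gt_0_iff empty_iff)

lemma chr_trivial: "a \<in> F \<Longrightarrow> chr a = 1 \<Longrightarrow> a = \<zero>"
proof (rule ccontr)
  assume a: "a \<in> F" "chr a = 1" "a \<noteq> \<zero>"
  have "(\<Sum>x<q. chr a x) = 0" using sum_psi[OF a(1,3)] by (simp add: sum_chr)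
  then show False using a(2) q_pos' by simp
qed

lemma inj_chr: "inj_on chr F"
proof (rule inj_onI)
  fix a b assume ab: "a \<in> F" "b \<in> F" "chr a = chr b"
  have "chr (a \<oplus> \<ominus> b) = 1"
    using ab chr_unimodular[of b] by (simp add: chr_add chr_neg F_neg fun_eq_iff)
  then have "a \<oplus> \<ominus> b = \<zero>" using ab by (intro chr_trivial F_add F_neg)
  then show "a = b" using ab Fc by (metis a_minus_def r_right_minus_eq)
qed

section \<open>The dual code and its weights\<close>

definition \<Phi> :: "(nat \<Rightarrow> complex) set" where "\<Phi> = chr ` F"

definition line :: "'a \<Rightarrow> 'a \<Rightarrow> nat \<Rightarrow> 'a" where "line a b k = a \<oplus> b \<otimes> e k"

text \<open>The annihilator of the Reed-Solomon code of evaluated polynomials of degree at most 1,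
  its words written multiplicatively as tuples of characters.\<close>

definition code :: "(nat \<Rightarrow> nat \<Rightarrow> complex) set" where
  "code = {h. (\<forall>k. h k \<in> \<Phi>) \<and> (\<forall>k\<ge>d. h k = 1) \<and> (\<forall>a\<in>F. \<forall>b\<in>F. (\<Prod>k<d. h k (idx (line a b k))) = 1)}"

definition gam :: "(nat \<Rightarrow> nat \<Rightarrow> complex) \<Rightarrow> complex" where
  "gam h = (\<Prod>k<d. h k (idx (e k \<otimes> e k)))"

lemma line_F: "a \<in> F \<Longrightarrow> b \<in> F \<Longrightarrow> k < d \<Longrightarrow> line a b k \<in> F"
  using d_le by (auto simp: line_def F_add F_mult e_F)

lemma e_inj: "k < d \<Longrightarrow> l < d \<Longrightarrow> e k = e l \<Longrightarrow> k = l"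
  using bij_e d_le by (auto simp: bij_betw_def inj_on_def)

lemma interpolate:
  assumes kl: "k < d" "l < d" "k \<noteq> l" and z: "z \<in> F"
  obtains a b where "a \<in> F" "b \<in> F" "line a b k = z" "line a b l = \<zero>"
proof -
  have ek: "e k \<in> F" "e l \<in> F" using kl d_le by (auto simp: e_F)
  define u where "u = e k \<ominus> e l"
  have u: "u \<in> F" "u \<noteq> \<zero>" using ek kl e_inj[of k l] Fc by (auto simp: u_def a_minus_def F_add F_neg r_right_minus_eq[unfolded a_minus_def])
  define b where "b = z \<otimes> inv u"
  define a where "a = \<ominus> (b \<otimes> e l)"
  have b: "b \<in> F" using z u by (simp add: b_def F_mult F_inv)
  have a: "a \<in> F" using b ek by (simp add: a_def F_mult F_neg)
  have uu: "u \<in> Units R" using u Fc field_Units by auto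
  have "line a b l = \<zero>" using b ek Fc by (simp add: line_def a_def l_neg)
  moreover have "line a b k = z"
  proof -
    have "line a b k = b \<otimes> u"
      using b ek Fc[OF b] Fc[OF ek(1)] Fc[OF ek(2)] unfolding line_def a_def u_def by algebra
    also have "\<dots> = z" unfolding b_def using uu Fc[OF z] Fc[OF u(1)] by (simp add: m_assoc)
    finally show ?thesis .
  qed
  ultimately show ?thesis using that a b by blast
qed

lemma Phi_idx_zero: "f \<in> \<Phi> \<Longrightarrow> f (idx \<zero>) = 1"
  by (auto simp: \<Phi>_def chr_idx F_zero psi_zero Fc)

lemma Phi_eq_one: 
  assumes "f \<in> \<Phi>" "\<And>z. z \<in> F \<Longrightarrow> f (idx z) = 1" shows "f = 1"
proof
  fix x
  show "f x = 1 x"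
  proof (cases "x < q")
    case True
    then show ?thesis using assms(2)[OF e_F[OF True]] by (simp add: idx_e)
  next
    case False
    then show ?thesis using assms(1) by (auto simp: \<Phi>_def chr_def)
  qed
qed

text \<open>If at most one position besides \<open>k\<close> is nontrivial, some line is 0 there and
  takes an arbitrary value \<open>z\<close> at \<open>k\<close>, so the word condition says that
  \<open>h k\<close> is 1 at every \<open>z\<close>.\<close>

lemma code_weight_ge:
  assumes h: "h \<in> code" "h \<noteq> 1"
  shows "3 \<le> card {k. k < d \<and> h k \<noteq> 1}"
proof (rule ccontr)
  let ?S = "{k. k < d \<and> h k \<noteq> 1}"
  assume "\<not> 3 \<le> card ?S"
  then have c: "card ?S \<le> 2" by simp
  have fin: "finite ?S" by simp
  obtain k where "h k \<noteq> 1" using h(2) by (auto simp: fun_eq_iff)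
  then have k: "k < d" "h k \<noteq> 1" using h(1) by (auto simp: code_def not_le[symmetric])
  have hk: "h i \<in> \<Phi>" for i using h(1) by (simp add: code_def)
  have "h k (idx z) = 1" if z: "z \<in> F" for z
  proof -
    obtain a b where ab: "a \<in> F" "b \<in> F" "line a b k = z" "\<And>l. l \<in> ?S \<Longrightarrow> l \<noteq> k \<Longrightarrow> line a b l = \<zero>"
    proof (cases "?S = {k}")
      case True
      have "line z \<zero> k = z" using z k Fc e_F d_le by (simp add: line_def)
      then show ?thesis using that[of z \<zero>] z F_zero True by blast
    next
      case False
      then obtain l where l: "l \<in> ?S" "l \<noteq> k" using k by blast
      then have "?S = {k, l}"
        using card_seteq[of ?S "{k, l}"] c k by (simp add: fin)
      moreover obtain a b where "a \<in> F" "b \<in> F" "line a b k = z" "line a b l = \<zero>"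
        using interpolate[of k l z] k l z by auto
      ultimately show ?thesis using that[of a b] by blast
    qed
    have "1 = (\<Prod>i<d. h i (idx (line a b i)))" using h(1) ab by (simp add: code_def)
    also have "\<dots> = (\<Prod>i<d. if i = k then h k (idx z) else 1)"
    proof (rule prod.cong[OF refl])
      fix i assume i: "i \<in> {..<d}"
      show "h i (idx (line a b i)) = (if i = k then h k (idx z) else 1)"
        using ab(3) ab(4)[of i] i Phi_idx_zero[OF hk[of i]] by (cases "h i = 1") auto
    qed
    also have "\<dots> = h k (idx z)" using k by simp
    finally show ?thesis by simp
  qed
  then have "h k = 1" using Phi_eq_one[OF hk] by blast
  then show False using k by simp
qed

text \<open>Up to a scalar the coefficients \<open>c\<close> are those of the second divided
  difference at three points, which kills constants and linear functions. On squares the unscaled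
  functional takes the value \<open>v\<close>, a Vandermonde determinant up to sign and hence
  nonzero; the scalar \<open>t\<close> turns \<open>v\<close> into an element \<open>z\<close> with
  \<open>\<psi> z \<noteq> 1\<close>.\<close>

lemma code_triple_ex:
  assumes klm: "k < l" "l < m" "m < d"
  shows "\<exists>h\<in>code. (\<forall>i. i \<notin> {k, l, m} \<longrightarrow> h i = 1) \<and> gam h \<noteq> 1"
proof -
  have ef: "e k \<in> F" "e l \<in> F" "e m \<in> F" using klm d_le by (auto simp: e_F)
  note ec = ef[THEN Fc]
  define v where "v = (e l \<ominus> e m) \<otimes> (e k \<otimes> e k) \<oplus> (e m \<ominus> e k) \<otimes> (e l \<otimes> e l) \<oplus> (e k \<ominus> e l) \<otimes> (e m \<otimes> e m)"
  have v_eq: "v = \<ominus> ((e k \<ominus> e l) \<otimes> (e l \<ominus> e m) \<otimes> (e m \<ominus> e k))"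
    unfolding v_def using ec by algebra
  have ne: "e i \<ominus> e j \<noteq> \<zero>" if "i < d" "j < d" "i \<noteq> j" for i j
    using that e_inj[of i j] Fc e_F d_le by (auto simp: r_right_minus_eq)
  have nz: "(e k \<ominus> e l) \<otimes> (e l \<ominus> e m) \<otimes> (e m \<ominus> e k) \<noteq> \<zero>"
    using ne[of k l] ne[of l m] ne[of m k] klm ec by (simp add: integral_iff)
  have vF: "v \<in> F" unfolding v_def a_minus_def using ef by (intro F_add F_mult F_neg)
  have v0: "v \<noteq> \<zero>"
  proof
    assume "v = \<zero>"
    then have "\<ominus> v = \<zero>" by simp
    moreover have "\<ominus> v = (e k \<ominus> e l) \<otimes> (e l \<ominus> e m) \<otimes> (e m \<ominus> e k)"
      unfolding v_eq using ec by (simp add: minus_minus)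
    ultimately show False using nz by simp
  qed
  have vu: "v \<in> Units R" using vF v0 Fc field_Units by auto
  obtain z where z: "z \<in> F" "\<psi> z \<noteq> 1" using psi_nontrivial by blast
  define t where "t = z \<otimes> inv v"
  have t: "t \<in> F" using z vF v0 by (simp add: t_def F_mult F_inv)
  have tv: "t \<otimes> v = z" unfolding t_def using vu z Fc vF by (simp add: m_assoc Units_l_inv)
  define c where "c i = (if i = k then t \<otimes> (e l \<ominus> e m) else if i = l then t \<otimes> (e m \<ominus> e k)
     else if i = m then t \<otimes> (e k \<ominus> e l) else \<zero>)" for i
  define h where "h i = chr (c i)" for i
  have cF: "c i \<in> F" for i
    unfolding c_def a_minus_def using t ef by (auto intro!: F_add F_mult F_neg F_zero)
  have off: "h i = 1" if "i \<notin> {k, l, m}" for i using that by (simp add: h_def c_def chr_zero)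
  have prod: "(\<Prod>i<d. h i (idx (y i))) = \<psi> (c k \<otimes> y k \<oplus> c l \<otimes> y l \<oplus> c m \<otimes> y m)"
    if y: "\<And>i. i < d \<Longrightarrow> y i \<in> F" for y
  proof -
    have yF: "y k \<in> F" "y l \<in> F" "y m \<in> F" using y klm by auto
    have "(\<Prod>i<d. h i (idx (y i))) = (\<Prod>i\<in>{k, l, m}. h i (idx (y i)))"
      by (rule prod.mono_neutral_right) (use klm off in auto)
    also have "\<dots> = h k (idx (y k)) * h l (idx (y l)) * h m (idx (y m))"
      using klm by (simp add: mult.assoc)
    also have "\<dots> = \<psi> (c k \<otimes> y k) * \<psi> (c l \<otimes> y l) * \<psi> (c m \<otimes> y m)"
      using yF by (simp add: h_def chr_idx)
    also have "\<dots> = \<psi> (c k \<otimes> y k \<oplus> c l \<otimes> y l \<oplus> c m \<otimes> y m)"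
      using yF cF by (simp add: psi_add F_add F_mult)
    finally show ?thesis .
  qed
  have ck: "c k = t \<otimes> (e l \<ominus> e m)" "c l = t \<otimes> (e m \<ominus> e k)" "c m = t \<otimes> (e k \<ominus> e l)"
    using klm by (auto simp: c_def)
  note tc = Fc[OF t]
  have "h \<in> code"
    unfolding code_def
  proof (intro CollectI conjI allI ballI impI)
    show "h i \<in> \<Phi>" for i using cF by (simp add: h_def \<Phi>_def)
    show "h i = 1" if "d \<le> i" for i using that klm by (intro off) auto
    fix a b assume ab: "a \<in> F" "b \<in> F"
    have "(\<Prod>i<d. h i (idx (line a b i))) = \<psi> (c k \<otimes> line a b k \<oplus> c l \<otimes> line a b l \<oplus> c m \<otimes> line a b m)"
      by (rule prod) (use line_F ab in auto)
    also have "c k \<otimes> line a b k \<oplus> c l \<otimes> line a b l \<oplus> c m \<otimes> line a b m = \<zero>"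
      unfolding ck line_def using tc ec ab[THEN Fc] by algebra
    finally show "(\<Prod>i<d. h i (idx (line a b i))) = 1" by (simp add: psi_zero)
  qed
  moreover have "gam h \<noteq> 1"
  proof -
    have "gam h = \<psi> (c k \<otimes> (e k \<otimes> e k) \<oplus> c l \<otimes> (e l \<otimes> e l) \<oplus> c m \<otimes> (e m \<otimes> e m))"
      unfolding gam_def by (rule prod) (use e_F d_le in \<open>auto intro!: F_mult\<close>)
    also have "c k \<otimes> (e k \<otimes> e k) \<oplus> c l \<otimes> (e l \<otimes> e l) \<oplus> c m \<otimes> (e m \<otimes> e m) = t \<otimes> v"
      unfolding ck v_def using tc ec by algebra
    finally show ?thesis using tv z by simp
  qed
  ultimately show ?thesis using off by blast
qed

lemma Phi_unimodular: "f \<in> \<Phi> \<Longrightarrow> f x * cnj (f x) = 1"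
  by (auto simp: \<Phi>_def chr_unimodular)

lemma char_code: "char_code q d \<Phi> code gam"
proof
  show "0 < q" by (rule q_pos')
  show "finite \<Phi>" by (simp add: \<Phi>_def finite_F)
  show "1 \<in> \<Phi>" using F_zero chr_zero unfolding \<Phi>_def by (metis imageI)
  show "f * g \<in> \<Phi>" if fg: "f \<in> \<Phi>" "g \<in> \<Phi>" for f g
  proof -
    obtain a b where ab: "a \<in> F" "b \<in> F" "f = chr a" "g = chr b" using fg by (auto simp: \<Phi>_def)
    then have "f * g = chr (a \<oplus> b)" by (simp add: chr_add)
    then show ?thesis using ab F_add unfolding \<Phi>_def by (intro image_eqI[of _ _ "a \<oplus> b"]) auto
  qed
  show cnjP: "(\<lambda>x. cnj (f x)) \<in> \<Phi>" if fP: "f \<in> \<Phi>" for f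
  proof -
    obtain a where a: "a \<in> F" "f = chr a" using fP by (auto simp: \<Phi>_def)
    then show ?thesis using F_neg unfolding \<Phi>_def by (intro image_eqI[of _ _ "\<ominus> a"]) (auto simp: chr_neg)
  qed
  show "f x * cnj (f x) = 1" if "f \<in> \<Phi>" for f x using that by (rule Phi_unimodular)
  show "(\<Sum>x<q. f x) = 0" if f: "f \<in> \<Phi>" "f \<noteq> 1" for f
  proof -
    obtain a where a: "a \<in> F" "f = chr a" using f(1) by (auto simp: \<Phi>_def)
    then have "a \<noteq> \<zero>" using f(2) chr_zero by auto
    then show ?thesis using a sum_psi sum_chr by simp
  qed
  show "(\<Sum>f\<in>\<Phi>. f x * cnj (f y)) = (if x = y then of_nat q else 0)" if xy: "x < q" "y < q" for x y
  proof -
    define u where "u = e x \<ominus> e y"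
    have ef: "e x \<in> F" "e y \<in> F" using xy e_F by auto
    have uF: "u \<in> F" using ef by (simp add: u_def a_minus_def F_add F_neg)
    have "(\<Sum>f\<in>\<Phi>. f x * cnj (f y)) = (\<Sum>a\<in>F. chr a x * cnj (chr a y))"
      unfolding \<Phi>_def by (subst sum.reindex[OF inj_chr]) simp
    also have "\<dots> = (\<Sum>a\<in>F. \<psi> (u \<otimes> a))"
    proof (rule sum.cong[OF refl])
      fix a assume a: "a \<in> F"
      have "u \<otimes> a = a \<otimes> e x \<oplus> \<ominus> (a \<otimes> e y)"
        unfolding u_def using ef[THEN Fc] Fc[OF a] by algebra
      then show "chr a x * cnj (chr a y) = \<psi> (u \<otimes> a)"
        using a ef xy by (simp add: chr_def psi_add psi_neg F_mult F_neg)
    qed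
    also have "\<dots> = (if x = y then of_nat q else 0)"
    proof (cases "x = y")
      case True
      then have "u = \<zero>" using ef Fc by (simp add: u_def)
      then have "(\<Sum>a\<in>F. \<psi> (u \<otimes> a)) = (\<Sum>a\<in>F. 1)" using Fc psi_zero by (intro sum.cong) auto
      then show ?thesis using True card_F by simp
    next
      case False
      then have "u \<noteq> \<zero>" using xy ef Fc bij_e by (auto simp: u_def r_right_minus_eq bij_betw_def inj_on_def)
      then show ?thesis using False sum_psi[OF uF] by simp
    qed
    finally show ?thesis .
  qed
  have "code \<subseteq> {h. \<forall>k. (k \<in> {..<d} \<longrightarrow> h k \<in> \<Phi>) \<and> (k \<notin> {..<d} \<longrightarrow> h k = 1)}"
    by (auto simp: code_def)
  then show "finite code"
    by (rule finite_subset) (rule finite_set_of_finite_funs, auto simp: \<Phi>_def finite_F)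
  show "h k \<in> \<Phi>" if "h \<in> code" for h k using that by (simp add: code_def)
  show "1 \<in> code" using \<open>1 \<in> \<Phi>\<close> by (simp add: code_def)
  show "h * h' \<in> code" if "h \<in> code" "h' \<in> code" for h h'
    using that \<open>\<And>f g. f \<in> \<Phi> \<Longrightarrow> g \<in> \<Phi> \<Longrightarrow> f * g \<in> \<Phi>\<close> by (auto simp: code_def prod.distrib)
  show "conj_family h \<in> code" if "h \<in> code" for h
  proof -
    have "(\<Prod>k<d. cnj (h k (idx (line a b k)))) = 1" if "a \<in> F" "b \<in> F" for a b
      using \<open>h \<in> code\<close> that by (simp add: code_def flip: cnj_prod)
    moreover have "(\<lambda>x. cnj (h k x)) = 1" if "d \<le> k" for k
      using \<open>h \<in> code\<close> that by (auto simp: code_def fun_eq_iff)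
    ultimately show ?thesis using that cnjP by (auto simp: code_def conj_family_def)
  qed
  show "3 \<le> card {k. k < d \<and> h k \<noteq> 1}" if "h \<in> code" "h \<noteq> 1" for h using that by (rule code_weight_ge)
  show "gam (h * h') = gam h * gam h'" for h h' by (simp add: gam_def prod.distrib)
  show "gam h * cnj (gam h) = 1" if "h \<in> code" for h
    using that Phi_unimodular by (simp add: gam_def code_def prod.distrib[symmetric])
  show "\<exists>h\<in>code. (\<forall>i. i \<notin> {k, l, m} \<longrightarrow> h i = 1) \<and> gam h \<noteq> 1" if "k < l" "l < m" "m < d" for k l m
    using that by (rule code_triple_ex)
qed

end

theorem exists_char_code:
  assumes "primepow q" "d \<le> q"
  obtains \<Phi> C \<gamma> where "char_code q d \<Phi> C \<gamma>"
proof -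
  obtain p m :: nat where p: "prime p" "0 < m" "q = p ^ m" using assms(1) by (auto simp: primepow_def)
  obtain L :: "((int list \<times> nat) multiset \<Rightarrow> int) ring"
    where L: "field L" "add_pow L p \<one>\<^bsub>L\<^esub> = \<zero>\<^bsub>L\<^esub>" "card {x \<in> carrier L. x [^]\<^bsub>L\<^esub> (p ^ m) = x} = p ^ m"
    using exists_field_card_frobenius_fixed[OF p(1,2)] by blast
  interpret L: field L by fact
  define F where "F = {x \<in> carrier L. x [^]\<^bsub>L\<^esub> q = x}"
  have q2: "2 \<le> q" using primepow_gt_Suc_0[OF assms(1)] by simp
  have cardF: "card F = q" using L(3) p(3) by (simp add: F_def)
  have finF: "finite F" using cardF q2 card.infinite by fastforce
  have Fc: "F \<subseteq> carrier L" by (auto simp: F_def)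
  have frob: "(x \<oplus>\<^bsub>L\<^esub> y) [^]\<^bsub>L\<^esub> q = x [^]\<^bsub>L\<^esub> q \<oplus>\<^bsub>L\<^esub> y [^]\<^bsub>L\<^esub> q" if "x \<in> carrier L" "y \<in> carrier L" for x y
    using L.frobenius_add[OF p(1) L(2) that] p(3) by simp
  have zero: "\<zero>\<^bsub>L\<^esub> \<in> F" using q2 by (simp add: F_def L.nat_pow_zero)
  have add: "x \<oplus>\<^bsub>L\<^esub> y \<in> F" if "x \<in> F" "y \<in> F" for x y using that frob by (auto simp: F_def)
  have neg: "\<ominus>\<^bsub>L\<^esub> x \<in> F" if "x \<in> F" for x
  proof -
    have x: "x \<in> carrier L" "x [^]\<^bsub>L\<^esub> q = x" using that by (auto simp: F_def)
    have "x \<oplus>\<^bsub>L\<^esub> (\<ominus>\<^bsub>L\<^esub> x) [^]\<^bsub>L\<^esub> q = (x \<oplus>\<^bsub>L\<^esub> \<ominus>\<^bsub>L\<^esub> x) [^]\<^bsub>L\<^esub> q" using frob[of x "\<ominus>\<^bsub>L\<^esub> x"] x by simp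
    also have "\<dots> = \<zero>\<^bsub>L\<^esub>" using x zero by (simp add: L.r_neg F_def)
    finally have "(\<ominus>\<^bsub>L\<^esub> x) [^]\<^bsub>L\<^esub> q = \<ominus>\<^bsub>L\<^esub> x"
      using x by (metis L.a_inv_closed L.add.m_comm L.minus_equality L.nat_pow_closed)
    then show ?thesis using x by (simp add: F_def)
  qed
  have mult: "x \<otimes>\<^bsub>L\<^esub> y \<in> F" if "x \<in> F" "y \<in> F" for x y
    using that by (auto simp: F_def L.nat_pow_distrib)
  have inv: "inv\<^bsub>L\<^esub> x \<in> F" if "x \<in> F" "x \<noteq> \<zero>\<^bsub>L\<^esub>" for x
  proof -
    have x: "x \<in> carrier L" "x [^]\<^bsub>L\<^esub> q = x" using that by (auto simp: F_def)
    have u: "x \<in> Units L" using x that(2) L.field_Units by auto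
    have "x \<otimes>\<^bsub>L\<^esub> (inv\<^bsub>L\<^esub> x) [^]\<^bsub>L\<^esub> q = (x \<otimes>\<^bsub>L\<^esub> inv\<^bsub>L\<^esub> x) [^]\<^bsub>L\<^esub> q"
      by (simp only: L.nat_pow_distrib[OF x(1) L.Units_inv_closed[OF u]] x(2))
    also have "\<dots> = \<one>\<^bsub>L\<^esub>" using u by simp
    finally have "inv\<^bsub>L\<^esub> x = (inv\<^bsub>L\<^esub> x) [^]\<^bsub>L\<^esub> q"
      using x u by (intro L.comm_inv_char) auto
    then show ?thesis using u by (simp add: F_def)
  qed
  have closed: "L.add_closed F" using Fc zero add by (auto simp: L.add_closed_def)
  have ne: "F \<noteq> {\<zero>\<^bsub>L\<^esub>}" using cardF q2 by auto
  have tors: "add_pow L p x = \<zero>\<^bsub>L\<^esub>" if "x \<in> F" for x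
    using L.add_pow_zero_of_dvd[OF L(2), of p x] that Fc by auto
  obtain \<psi> :: "_ \<Rightarrow> complex" where \<psi>: "\<And>x y. x \<in> F \<Longrightarrow> y \<in> F \<Longrightarrow> \<psi> (x \<oplus>\<^bsub>L\<^esub> y) = \<psi> x * \<psi> y"
    "\<And>x. \<psi> x * cnj (\<psi> x) = 1" "\<exists>z\<in>F. \<psi> z \<noteq> 1"
    by (rule L.exists_additive_character[OF p(1) closed finF ne]) (erule tors, rule that)
  obtain e where e: "bij_betw e {..<q} F"
    using ex_bij_betw_nat_finite[OF finF] cardF by (auto simp: lessThan_atLeast0)
  interpret field_with_character L F \<psi> e q d
    by unfold_locales (use Fc zero add neg mult inv \<psi> e assms(2) in auto)
  show ?thesis using that char_code .
qed

section \<open>Random constraints\<close>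

lemma pow_self_le_fact: "real k ^ k \<le> 3 ^ k * fact k"
proof (induction k)
  case (Suc k)
  have e3: "exp 1 \<le> (3::real)" using exp_bound[of 1] by simp
  have "real (Suc k) ^ k \<le> 3 * real k ^ k"
  proof (cases "k = 0")
    case False
    have "(1 + 1 / real k) ^ k \<le> exp (1 / real k) ^ k"
      by (intro power_mono) (auto simp: exp_ge_add_one_self)
    also have "\<dots> = exp 1" using False by (simp add: exp_of_nat_mult[symmetric])
    finally have "(1 + 1 / real k) ^ k \<le> 3" using e3 by linarith
    then have "(1 + 1 / real k) ^ k * real k ^ k \<le> 3 * real k ^ k" by (intro mult_right_mono) auto
    moreover have "(1 + 1 / real k) * real k = real (Suc k)" using False by (simp add: field_simps)
    ultimately show ?thesis by (metis power_mult_distrib)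
  qed simp
  then have "real (Suc k) ^ Suc k \<le> real (Suc k) * (3 * real k ^ k)"
    by (simp del: of_nat_Suc add: mult_left_mono)
  also have "\<dots> \<le> real (Suc k) * (3 * (3 ^ k * fact k))"
    using Suc.IH by (intro mult_left_mono) auto
  finally show ?case by (simp add: algebra_simps)
qed simp

text \<open>The usual bound \<open>(3 * n / k) ^ k\<close> on a binomial coefficient, cleared of the
  denominator so that \<open>k = 0\<close> is no exception.\<close>

lemma binomial_mult_pow_le: "real (n choose k) * real k ^ k \<le> (3 * real n) ^ k"
proof -
  have "real (n choose k) * real k ^ k \<le> real (n choose k) * (3 ^ k * fact k)"
    by (intro mult_left_mono pow_self_le_fact) auto
  also have "\<dots> = 3 ^ k * real ((n choose k) * fact k)" by simp
  also have "\<dots> \<le> 3 ^ k * real (n ^ k)"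
    by (intro mult_left_mono) (simp_all only: of_nat_le_iff binomial_fact_pow zero_le_numeral zero_le_power)
  finally show ?thesis by (simp add: power_mult_distrib)
qed

lemma prod_le_mean_power:
  fixes x :: "nat \<Rightarrow> real"
  assumes "0 < d" "\<And>i. i < d \<Longrightarrow> 0 \<le> x i"
  shows "(\<Prod>i<d. x i) \<le> ((\<Sum>i<d. x i) / real d) ^ d"
proof -
  let ?p = "\<Prod>i<d. x i"
  have p0: "0 \<le> ?p" using assms by (intro prod_nonneg) auto
  have "?p powr (1 / real d) \<le> (\<Sum>i<d. x i) / real d"
    using arith_geom_mean[of "{..<d}" x] assms by (simp add: sum_divide_distrib lessThan_empty_iff)
  then have "(?p powr (1 / real d)) ^ d \<le> ((\<Sum>i<d. x i) / real d) ^ d"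
    by (intro power_mono) auto
  moreover have "(?p powr (1 / real d)) ^ d = ?p"
  proof (cases "?p = 0")
    case False
    then have "0 < ?p" using p0 by linarith
    then have "0 < ?p powr (1 / real d)" unfolding powr_gt_zero by linarith
    then have "(?p powr (1 / real d)) ^ d = (?p powr (1 / real d)) powr real d"
      by (rule powr_realpow[symmetric])
    also have "\<dots> = ?p" using \<open>0 < ?p\<close> assms(1) by (simp add: powr_powr)
    finally show ?thesis .
  next
    case True
    show ?thesis unfolding True using assms(1) by simp
  qed
  ultimately show ?thesis by simp
qed

text \<open>Markov's inequality for the exponential moment with \<open>l = \<eta> / 2\<close>: by
  \<open>exp y \<le> 1 + y + y^2\<close> on the unit interval the exponent per factor is at most
  \<open>l * \<mu> + l^2 - l * (\<mu> + \<eta>) = - \<eta>^2 / 4\<close>. Probabilities are counts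
  in a product set, and one tail suffices because both uses are upper bounds.\<close>

lemma chernoff_count:
  fixes g :: "'a \<Rightarrow> real"
  assumes T: "finite T" "\<And>t. t \<in> T \<Longrightarrow> 0 \<le> g t \<and> g t \<le> 1"
    and mean: "(\<Sum>t\<in>T. g t) \<le> \<mu> * real (card T)" and \<eta>: "0 < \<eta>" "\<eta> \<le> 1"
  shows "real (card {\<omega>\<in>(\<Pi>\<^sub>E j\<in>{..<M}. T). (\<mu> + \<eta>) * real M \<le> (\<Sum>j<M. g (\<omega> j))})
     \<le> exp (- (real M * \<eta>\<^sup>2 / 4)) * real (card T) ^ M"
proof -
  let ?\<Omega> = "\<Pi>\<^sub>E j\<in>{..<M}. T"
  let ?B = "{\<omega>\<in>?\<Omega>. (\<mu> + \<eta>) * real M \<le> (\<Sum>j<M. g (\<omega> j))}"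
  define l where "l = \<eta> / 2"
  have l: "0 < l" "l \<le> 1" using \<eta> by (auto simp: l_def)
  have fin: "finite ?\<Omega>" using T by (simp add: finite_PiE)
  have "real (card ?B) * exp (l * ((\<mu> + \<eta>) * real M)) = (\<Sum>\<omega>\<in>?B. exp (l * ((\<mu> + \<eta>) * real M)))"
    by simp
  also have "\<dots> \<le> (\<Sum>\<omega>\<in>?B. exp (l * (\<Sum>j<M. g (\<omega> j))))"
    using l by (intro sum_mono) auto
  also have "\<dots> \<le> (\<Sum>\<omega>\<in>?\<Omega>. exp (l * (\<Sum>j<M. g (\<omega> j))))"
    by (rule sum_mono2) (use fin in auto)
  also have "\<dots> = (\<Sum>\<omega>\<in>?\<Omega>. \<Prod>j<M. exp (l * g (\<omega> j)))"
    by (simp add: exp_sum sum_distrib_left)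
  also have "\<dots> = (\<Prod>j<M. \<Sum>t\<in>T. exp (l * g t))"
    by (rule prod_sum_PiE[symmetric]) (use T in auto)
  also have "\<dots> = (\<Sum>t\<in>T. exp (l * g t)) ^ M" by simp
  also have "\<dots> \<le> (exp (l * \<mu> + l\<^sup>2) * real (card T)) ^ M"
  proof (rule power_mono)
    have "exp (l * g t) \<le> 1 + l * g t + l\<^sup>2" if "t \<in> T" for t
    proof -
      have g: "0 \<le> g t" "g t \<le> 1" using T(2)[OF that] by auto
      have "exp (l * g t) \<le> 1 + l * g t + (l * g t)\<^sup>2"
        by (rule exp_bound) (use g l in \<open>auto intro: mult_le_one\<close>)
      also have "(l * g t)\<^sup>2 \<le> l\<^sup>2"
        using g l by (intro power_mono) (auto simp: mult_left_le)
      finally show ?thesis by simp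
    qed
    then have "(\<Sum>t\<in>T. exp (l * g t)) \<le> (\<Sum>t\<in>T. 1 + l * g t + l\<^sup>2)" by (rule sum_mono)
    also have "\<dots> = real (card T) + l * (\<Sum>t\<in>T. g t) + l\<^sup>2 * real (card T)"
      by (simp add: sum.distrib sum_distrib_left)
    also have "\<dots> \<le> real (card T) + l * (\<mu> * real (card T)) + l\<^sup>2 * real (card T)"
      using l mean by (intro add_mono mult_left_mono) auto
    also have "\<dots> = (1 + (l * \<mu> + l\<^sup>2)) * real (card T)" by (simp add: algebra_simps)
    also have "\<dots> \<le> exp (l * \<mu> + l\<^sup>2) * real (card T)"
      by (intro mult_right_mono exp_ge_add_one_self) auto
    finally show "(\<Sum>t\<in>T. exp (l * g t)) \<le> exp (l * \<mu> + l\<^sup>2) * real (card T)" .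
  qed (auto intro: sum_nonneg)
  also have "\<dots> = exp (real M * (l * \<mu> + l\<^sup>2)) * real (card T) ^ M"
    by (simp add: power_mult_distrib exp_of_nat_mult[symmetric])
  finally have "real (card ?B) * exp (l * ((\<mu> + \<eta>) * real M))
      \<le> exp (real M * (l * \<mu> + l\<^sup>2)) * real (card T) ^ M" .
  then have "real (card ?B) \<le> exp (real M * (l * \<mu> + l\<^sup>2)) * real (card T) ^ M / exp (l * ((\<mu> + \<eta>) * real M))"
    by (simp add: pos_le_divide_eq)
  also have "\<dots> = exp (real M * (l * \<mu> + l\<^sup>2) - l * ((\<mu> + \<eta>) * real M)) * real (card T) ^ M"
    by (simp add: exp_diff)
  also have "real M * (l * \<mu> + l\<^sup>2) - l * ((\<mu> + \<eta>) * real M) = - (real M * \<eta>\<^sup>2 / 4)"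
    by (simp add: l_def power2_eq_square field_simps)
  finally show ?thesis .
qed

lemma block_less:
  fixes k l m d :: nat
  assumes "k < d" "l < m" shows "k * m + l < d * m"
proof -
  have "k * m + l < (k + 1) * m" using assms by simp
  also have "\<dots> \<le> d * m" using assms by (intro mult_right_mono) auto
  finally show ?thesis .
qed

lemma block_inj:
  fixes k k' l l' m :: nat
  assumes "l < m" "l' < m" "k * m + l = k' * m + l'" shows "k = k' \<and> l = l'"
proof -
  have "(i * m + r) div m = i" if "r < m" for i r :: nat using that by (simp add: div_mult_self3)
  then have "k = k'" using assms by metis
  then show ?thesis using assms(3) by simp
qed

lemma sum_blocks:
  fixes d m :: nat
  assumes "S \<subseteq> {..<d * m}" "0 < m"
  shows "(\<Sum>k<d. card {l. l < m \<and> k * m + l \<in> S}) = card S"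
proof -
  let ?A = "SIGMA k:{..<d}. {l. l < m \<and> k * m + l \<in> S}"
  have "bij_betw (\<lambda>(k, l). k * m + l) ?A S"
    unfolding bij_betw_def
  proof
    show "inj_on (\<lambda>(k, l). k * m + l) ?A"
    proof (rule inj_onI)
      fix x y assume "x \<in> ?A" "y \<in> ?A" "(\<lambda>(k, l). k * m + l) x = (\<lambda>(k, l). k * m + l) y"
      then show "x = y" using block_inj[of "snd x" m "snd y" "fst x" "fst y"]
        by (cases x; cases y) auto
    qed
    show "(\<lambda>(k, l). k * m + l) ` ?A = S"
    proof (intro equalityI subsetI)
      fix u assume u: "u \<in> S"
      have "u div m < d" using u assms by (auto simp: less_mult_imp_div_less)
      moreover have "u mod m < m" "(u div m) * m + u mod m = u" using assms by auto
      ultimately show "u \<in> (\<lambda>(k, l). k * m + l) ` ?A"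
        using u by (intro image_eqI[of _ _ "(u div m, u mod m)"]) auto
    qed auto
  qed
  then have "card ?A = card S" by (rule bij_betw_same_card)
  then show ?thesis by (simp add: card_SigmaI)
qed

text \<open>Left vertices, numbered from 0, come in \<open>d\<close> blocks of size \<open>q \<nu>\<close>, variables in \<open>d\<close> blocks of size \<open>\<nu>\<close>;
  the \<open>k\<close>-th neighbour of the right vertex \<open>j\<close> is vertex \<open>\<omega> j k\<close> of block \<open>k\<close>.\<close>

definition good_tuples ::
    "nat \<Rightarrow> nat \<Rightarrow> nat \<Rightarrow> real \<Rightarrow> real \<Rightarrow> nat \<Rightarrow> nat \<Rightarrow> (nat \<Rightarrow> nat \<Rightarrow> nat) \<Rightarrow> bool" where
  "good_tuples q d D \<eta> \<beta> B \<nu> \<omega> \<longleftrightarrow>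
    (\<forall>j<D * (q * \<nu>). \<forall>k<d. \<omega> j k < q * \<nu>) \<and>
    (\<forall>S\<subseteq>{..<d * (q * \<nu>)}. real (card {j. j < D * (q * \<nu>) \<and> (\<forall>k<d. k * (q * \<nu>) + \<omega> j k \<notin> S)})
           \<le> ((1 - real (card S) / real (d * (q * \<nu>))) ^ d + \<eta>) * real (D * (q * \<nu>))) \<and>
    (\<forall>S\<subseteq>{..<d * (q * \<nu>)}. real (\<Sum>j<D * (q * \<nu>). card {k. k < d \<and> k * (q * \<nu>) + \<omega> j k \<in> S})
           \<le> real D * real (card S) + \<eta> * real d * real (D * (q * \<nu>))) \<and>
    (\<forall>I\<subseteq>{..<D * (q * \<nu>)}. real (card I) \<le> \<beta> * real \<nu> \<longrightarrow>
           5 * d * card I \<le> 5 * card (\<Union>j\<in>I. (\<lambda>k. k * \<nu> + \<omega> j k div q) ` {..<d}) + 6 * card I) \<and>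
    card {(i, j). i < j \<and> j < D * (q * \<nu>) \<and>
        card (\<Union>l\<in>{i, j}. (\<lambda>k. k * \<nu> + \<omega> l k div q) ` {..<d}) + 2 \<le> 2 * d} \<le> B"

text \<open>Taking one neighbour from each block makes the \<open>d\<close> variables of a
  constraint distinct and the \<open>d\<close> choices independent, so that the counts over
  \<open>\<Omega>\<close> factor.\<close>

locale random_tuples =
  fixes q d D \<nu> :: nat
  assumes q0: "0 < q" and d0: "0 < d" and D0: "0 < D" and \<nu>0: "0 < \<nu>"
begin

abbreviation L where "L \<equiv> q * \<nu>"
abbreviation M where "M \<equiv> D * (q * \<nu>)"

definition tuples :: "(nat \<Rightarrow> nat) set" where
  "tuples = (\<Pi>\<^sub>E k\<in>{..<d}. {..<L})"

definition \<Omega> :: "(nat \<Rightarrow> nat \<Rightarrow> nat) set" where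
  "\<Omega> = (\<Pi>\<^sub>E j\<in>{..<M}. tuples)"

definition var :: "(nat \<Rightarrow> nat) \<Rightarrow> nat \<Rightarrow> nat" where
  "var t k = k * \<nu> + t k div q"

lemma var_eq: "var t = (\<lambda>k. k * \<nu> + t k div q)"
  by (simp add: var_def fun_eq_iff)

definition cover :: "(nat \<Rightarrow> nat \<Rightarrow> nat) \<Rightarrow> nat set \<Rightarrow> nat set" where
  "cover \<omega> I = (\<Union>j\<in>I. var (\<omega> j) ` {..<d})"

lemma finite_tuples: "finite tuples" by (simp add: tuples_def finite_PiE)
lemma finite_\<Omega>: "finite \<Omega>" by (simp add: \<Omega>_def finite_PiE finite_tuples)
lemma card_tuples: "card tuples = L ^ d" by (simp add: tuples_def card_PiE)
lemma card_\<Omega>: "card \<Omega> = card tuples ^ M" by (simp add: \<Omega>_def card_PiE)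
lemma L0: "0 < L" using q0 \<nu>0 by simp
lemma card_tuples_pos: "0 < card tuples" using L0 unfolding card_tuples by simp
lemma card_\<Omega>_pos: "0 < card \<Omega>" using card_tuples_pos unfolding card_\<Omega> by simp

lemma tuple_less: "t \<in> tuples \<Longrightarrow> k < d \<Longrightarrow> t k < L"
  by (auto simp: tuples_def PiE_def Pi_def)

text \<open>The probability of missing \<open>S\<close> is the product over blocks of the fractions
  outside \<open>S\<close>; by the inequality of the means it is largest when \<open>S\<close> is
  spread evenly.\<close>

lemma mean_miss:
  assumes S: "S \<subseteq> {..<d * L}"
  shows "(\<Sum>t\<in>tuples. if \<forall>k<d. k * L + t k \<notin> S then 1 else 0)
    \<le> (1 - real (card S) / real (d * L)) ^ d * real (card tuples)"
proof -
  let ?c = "\<lambda>k. card {l. l < L \<and> k * L + l \<in> S}"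
  have c: "?c k \<le> L" for k using card_mono[of "{..<L}" "{l. l < L \<and> k * L + l \<in> S}"] by auto
  have "(\<Sum>t\<in>tuples. if \<forall>k<d. k * L + t k \<notin> S then 1 else 0)
      = (\<Sum>t\<in>tuples. \<Prod>k<d. if k * L + t k \<notin> S then 1 else (0::real))"
    by (intro sum.cong refl) (auto simp: prod_zero_iff)
  also have "\<dots> = (\<Prod>k<d. \<Sum>l<L. if k * L + l \<notin> S then 1 else 0)"
    unfolding tuples_def by (rule prod_sum_PiE[symmetric]) auto
  also have "\<dots> = (\<Prod>k<d. real L - real (?c k))"
  proof (rule prod.cong[OF refl])
    fix k
    have "(\<Sum>l<L. if k * L + l \<notin> S then 1 else (0::real)) = real (card {l\<in>{..<L}. k * L + l \<notin> S})"
      by (subst sum.inter_filter[symmetric]) auto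
    also have "{l\<in>{..<L}. k * L + l \<notin> S} = {..<L} - {l. l < L \<and> k * L + l \<in> S}" by auto
    also have "real (card \<dots>) = real L - real (?c k)"
      using c[of k] by (subst card_Diff_subset) (auto simp: of_nat_diff)
    finally show "(\<Sum>l<L. if k * L + l \<notin> S then 1 else (0::real)) = real L - real (?c k)" .
  qed
  also have "\<dots> \<le> ((\<Sum>k<d. real L - real (?c k)) / real d) ^ d"
  proof (rule prod_le_mean_power[OF d0])
    show "0 \<le> real L - real (?c k)" for k using c[of k] by (simp del: of_nat_mult)
  qed
  also have "(\<Sum>k<d. real L - real (?c k)) = real d * real L - real (card S)"
    using sum_blocks[OF S L0] by (simp add: sum_subtractf flip: of_nat_sum)
  also have "((real d * real L - real (card S)) / real d) ^ d
      = ((1 - real (card S) / real (d * L)) * real L) ^ d"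
  proof -
    have "(real d * real L - real (card S)) / real d = (1 - real (card S) / (real d * real L)) * real L"
      using d0 L0 by (simp add: field_simps del: of_nat_mult)
    then show ?thesis by simp
  qed
  finally show ?thesis by (simp add: power_mult_distrib card_tuples)
qed

text \<open>Division by \<open>d\<close> brings the number of hits into the unit interval, as
  \<open>chernoff_count\<close> requires.\<close>

lemma mean_hits:
  assumes S: "S \<subseteq> {..<d * L}"
  shows "(\<Sum>t\<in>tuples. real (card {k. k < d \<and> k * L + t k \<in> S}) / real d)
    \<le> real (card S) / real (d * L) * real (card tuples)"
proof -
  let ?c = "\<lambda>k. card {l. l < L \<and> k * L + l \<in> S}"
  have one: "(\<Sum>t\<in>tuples. if k * L + t k \<in> S then 1 else (0::real)) * real L = real (?c k) * real (card tuples)"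
    if k: "k < d" for k
  proof -
    have "(\<Sum>t\<in>tuples. if k * L + t k \<in> S then 1 else (0::real))
       = (\<Sum>t\<in>tuples. \<Prod>i<d. if i = k then (if k * L + t i \<in> S then 1 else 0) else 1)"
      using k by (intro sum.cong refl) simp
    also have "\<dots> = (\<Prod>i<d. \<Sum>l<L. if i = k then (if k * L + l \<in> S then 1 else 0) else 1)"
      unfolding tuples_def by (rule prod_sum_PiE[symmetric]) auto
    also have "\<dots> = (\<Prod>i<d. if i = k then real (?c k) else real L)"
    proof (rule prod.cong[OF refl])
      fix i
      have "(\<Sum>l<L. if k * L + l \<in> S then 1 else (0::real)) = real (card {l\<in>{..<L}. k * L + l \<in> S})"
        by (subst sum.inter_filter[symmetric]) auto
      also have "{l\<in>{..<L}. k * L + l \<in> S} = {l. l < L \<and> k * L + l \<in> S}" by auto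
      finally show "(\<Sum>l<L. if i = k then (if k * L + l \<in> S then 1 else 0) else 1) = (if i = k then real (?c k) else real L)"
        by simp
    qed
    also have "\<dots> = real (?c k) * real L ^ (d - 1)"
    proof -
      have "(\<Prod>i<d. if i = k then real (?c k) else real L)
         = real (?c k) * (\<Prod>i\<in>{..<d} - {k}. if i = k then real (?c k) else real L)"
        using k by (subst prod.remove[of _ k]) auto
      also have "(\<Prod>i\<in>{..<d} - {k}. if i = k then real (?c k) else real L) = (\<Prod>i\<in>{..<d} - {k}. real L)"
        by (intro prod.cong) auto
      finally show ?thesis using k by simp
    qed
    finally have "(\<Sum>t\<in>tuples. if k * L + t k \<in> S then 1 else (0::real)) = real (?c k) * real L ^ (d - 1)" .
    moreover have "real L ^ (d - 1) * real L = real L ^ d" using d0 by (metis power_minus_mult)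
    ultimately show ?thesis by (simp only: card_tuples of_nat_power mult.assoc)
  qed
  have "(\<Sum>t\<in>tuples. real (card {k. k < d \<and> k * L + t k \<in> S}))
      = (\<Sum>t\<in>tuples. \<Sum>k<d. if k * L + t k \<in> S then 1 else 0)"
  proof (rule sum.cong[OF refl])
    fix t
    have "(\<Sum>k<d. if k * L + t k \<in> S then 1 else (0::real)) = real (card {k\<in>{..<d}. k * L + t k \<in> S})"
      by (subst sum.inter_filter[symmetric]) auto
    also have "{k\<in>{..<d}. k * L + t k \<in> S} = {k. k < d \<and> k * L + t k \<in> S}" by auto
    finally show "real (card {k. k < d \<and> k * L + t k \<in> S}) = (\<Sum>k<d. if k * L + t k \<in> S then 1 else 0)" ..
  qed
  also have "\<dots> = (\<Sum>k<d. \<Sum>t\<in>tuples. if k * L + t k \<in> S then 1 else 0)" by (rule sum.swap)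
  finally have "(\<Sum>t\<in>tuples. real (card {k. k < d \<and> k * L + t k \<in> S})) * real L
      = (\<Sum>k<d. real (?c k) * real (card tuples))"
    using one by (simp add: sum_distrib_right)
  also have "\<dots> = real (card S) * real (card tuples)"
    using sum_blocks[OF S L0] by (simp add: sum_distrib_right[symmetric] flip: of_nat_sum)
  finally have "(\<Sum>t\<in>tuples. real (card {k. k < d \<and> k * L + t k \<in> S})) = real (card S) * real (card tuples) / real L"
    using L0 by (simp add: field_simps del: of_nat_mult)
  then show ?thesis using d0 L0 by (simp add: sum_divide_distrib[symmetric] field_simps)
qed


section \<open>Variables covered by small sets of constraints\<close>

lemma var_less: "t \<in> tuples \<Longrightarrow> k < d \<Longrightarrow> var t k < d * \<nu>"
  unfolding var_def using tuple_less[of t k] q0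
  by (intro block_less) (auto simp: less_mult_imp_div_less mult.commute)

lemma cover_subset: "\<omega> \<in> \<Omega> \<Longrightarrow> I \<subseteq> {..<M} \<Longrightarrow> cover \<omega> I \<subseteq> {..<d * \<nu>}"
proof -
  assume "\<omega> \<in> \<Omega>" "I \<subseteq> {..<M}"
  then have "\<omega> j \<in> tuples" if "j \<in> I" for j using that by (auto simp: \<Omega>_def PiE_def Pi_def)
  then show ?thesis using var_less by (auto simp: cover_def)
qed

text \<open>Each of the \<open>d * card I\<close> independent choices lands in \<open>U\<close> with
  probability at most \<open>card U / \<nu>\<close>. Counting all of \<open>U\<close> instead of its
  part in one block is crude but harmless, since only the power of \<open>card U / \<nu>\<close>
  matters in the end.\<close>

lemma card_confined:
  assumes U: "finite U" and I: "I \<subseteq> {..<M}"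
  shows "real (card {\<omega>\<in>\<Omega>. cover \<omega> I \<subseteq> U}) \<le> (real (card U) / real \<nu>) ^ (d * card I) * real (card \<Omega>)"
proof -
  define TU where "TU = (\<Pi>\<^sub>E k\<in>{..<d}. {l. l < L \<and> k * \<nu> + l div q \<in> U})"
  have finI: "finite I" using I finite_subset by blast
  have sI: "card I \<le> M" using card_mono[OF _ I] by simp
  have "card {l. l < L \<and> k * \<nu> + l div q \<in> U} \<le> card (U \<times> {..<q})" for k
  proof (rule card_inj_on_le[of "\<lambda>l. (k * \<nu> + l div q, l mod q)"])
    show "inj_on (\<lambda>l. (k * \<nu> + l div q, l mod q)) {l. l < L \<and> k * \<nu> + l div q \<in> U}"
      by (rule inj_onI) (metis Pair_inject add_left_imp_eq div_mult_mod_eq)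
  qed (use U q0 in auto)
  then have "card {l. l < L \<and> k * \<nu> + l div q \<in> U} \<le> card U * q" for k
    by (simp add: card_cartesian_product)
  then have "card TU \<le> (card U * q) ^ d"
    unfolding TU_def by (simp add: card_PiE) (use prod_mono[of "{..<d}" _ "\<lambda>_. card U * q"] in auto)
  then have TU: "real (card TU) \<le> (real (card U) * real q) ^ d"
    by (metis of_nat_le_iff of_nat_mult of_nat_power)
  have "{\<omega>\<in>\<Omega>. cover \<omega> I \<subseteq> U} \<subseteq> (\<Pi>\<^sub>E j\<in>{..<M}. if j \<in> I then TU else tuples)"
  proof
    fix \<omega> assume \<omega>: "\<omega> \<in> {\<omega>\<in>\<Omega>. cover \<omega> I \<subseteq> U}"
    have "\<omega> j \<in> TU" if "j \<in> I" for j
    proof -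
      have "\<omega> j \<in> tuples" using \<omega> that I by (auto simp: \<Omega>_def PiE_def Pi_def)
      moreover have "var (\<omega> j) k \<in> U" if "k < d" for k using \<omega> \<open>j \<in> I\<close> that by (auto simp: cover_def)
      ultimately show ?thesis by (auto simp: TU_def tuples_def var_def PiE_def Pi_def)
    qed
    then show "\<omega> \<in> (\<Pi>\<^sub>E j\<in>{..<M}. if j \<in> I then TU else tuples)"
      using \<omega> by (auto simp: \<Omega>_def PiE_def Pi_def)
  qed
  moreover have finTU: "finite TU" by (simp add: TU_def finite_PiE)
  ultimately have "card {\<omega>\<in>\<Omega>. cover \<omega> I \<subseteq> U} \<le> card (\<Pi>\<^sub>E j\<in>{..<M}. if j \<in> I then TU else tuples)"
    by (intro card_mono finite_PiE) (auto simp: finite_tuples)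
  also have "\<dots> = (\<Prod>j<M. if j \<in> I then card TU else card tuples)"
    by (subst card_PiE) (auto intro!: prod.cong)
  also have "\<dots> = card TU ^ card I * card tuples ^ (M - card I)"
  proof -
    have "{..<M} \<inter> {j. j \<in> I} = I" "{..<M} \<inter> - {j. j \<in> I} = {..<M} - I" using I by auto
    then show ?thesis using finI I by (simp add: prod.If_cases card_Diff_subset)
  qed
  finally have "real (card {\<omega>\<in>\<Omega>. cover \<omega> I \<subseteq> U}) \<le> real (card TU ^ card I * card tuples ^ (M - card I))"
    by (rule of_nat_mono)
  also have "\<dots> = real (card TU) ^ card I * real (card tuples) ^ (M - card I)"
    by (simp only: of_nat_mult of_nat_power)
  also have "\<dots> \<le> ((real (card U) * real q) ^ d) ^ card I * real (card tuples) ^ (M - card I)"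
    using TU by (intro mult_right_mono power_mono) auto
  also have "(real (card U) * real q) ^ d = (real (card U) / real \<nu>) ^ d * real (card tuples)"
    unfolding card_tuples using \<nu>0 by (simp add: power_mult_distrib power_divide)
  also have "((real (card U) / real \<nu>) ^ d * real (card tuples)) ^ card I * real (card tuples) ^ (M - card I)
      = (real (card U) / real \<nu>) ^ (d * card I) * (real (card tuples) ^ card I * real (card tuples) ^ (M - card I))"
    by (simp add: power_mult_distrib power_mult)
  also have "real (card tuples) ^ card I * real (card tuples) ^ (M - card I) = real (card \<Omega>)"
    unfolding card_\<Omega> power_add[symmetric] using sI by simp
  finally show ?thesis .
qed

definition cramped :: "nat \<Rightarrow> nat \<Rightarrow> (nat \<Rightarrow> nat \<Rightarrow> nat) set" where
  "cramped s u = {\<omega>\<in>\<Omega>. \<exists>I. I \<subseteq> {..<M} \<and> card I = s \<and> card (cover \<omega> I) \<le> u}"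

text \<open>A union bound over the sets \<open>U\<close> of exactly \<open>u\<close> variables that
  contain the cover; \<open>u \<le> d * \<nu>\<close> lets a smaller cover be enlarged to that
  size.\<close>

lemma card_cramped_set:
  assumes I: "I \<subseteq> {..<M}" and u: "u \<le> d * \<nu>"
  shows "real (card {\<omega>\<in>\<Omega>. card (cover \<omega> I) \<le> u})
    \<le> real (d * \<nu> choose u) * (real u / real \<nu>) ^ (d * card I) * real (card \<Omega>)"
proof -
  let ?\<U> = "{U. U \<subseteq> {..<d * \<nu>} \<and> card U = u}"
  have fin: "finite ?\<U>" by simp
  have "{\<omega>\<in>\<Omega>. card (cover \<omega> I) \<le> u} \<subseteq> (\<Union>U\<in>?\<U>. {\<omega>\<in>\<Omega>. cover \<omega> I \<subseteq> U})"
  proof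
    fix \<omega> assume \<omega>: "\<omega> \<in> {\<omega>\<in>\<Omega>. card (cover \<omega> I) \<le> u}"
    then have "cover \<omega> I \<subseteq> {..<d * \<nu>}" using cover_subset I by blast
    then obtain U where "cover \<omega> I \<subseteq> U" "U \<subseteq> {..<d * \<nu>}" "card U = u"
      using exists_subset_between[of "cover \<omega> I" u "{..<d * \<nu>}"] \<omega> u by auto
    then show "\<omega> \<in> (\<Union>U\<in>?\<U>. {\<omega>\<in>\<Omega>. cover \<omega> I \<subseteq> U})" using \<omega> by auto
  qed
  then have "card {\<omega>\<in>\<Omega>. card (cover \<omega> I) \<le> u} \<le> card (\<Union>U\<in>?\<U>. {\<omega>\<in>\<Omega>. cover \<omega> I \<subseteq> U})"
    by (intro card_mono) (auto simp: finite_\<Omega>)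
  also have "\<dots> \<le> (\<Sum>U\<in>?\<U>. card {\<omega>\<in>\<Omega>. cover \<omega> I \<subseteq> U})" by (rule card_UN_le[OF fin])
  finally have "real (card {\<omega>\<in>\<Omega>. card (cover \<omega> I) \<le> u}) \<le> (\<Sum>U\<in>?\<U>. real (card {\<omega>\<in>\<Omega>. cover \<omega> I \<subseteq> U}))"
    unfolding of_nat_sum[symmetric] by (rule of_nat_mono)
  also have "\<dots> \<le> (\<Sum>U\<in>?\<U>. (real u / real \<nu>) ^ (d * card I) * real (card \<Omega>))"
  proof (rule sum_mono)
    fix U assume U: "U \<in> ?\<U>"
    then have "finite U" using finite_subset by blast
    from card_confined[OF this I] U
    show "real (card {\<omega>\<in>\<Omega>. cover \<omega> I \<subseteq> U}) \<le> (real u / real \<nu>) ^ (d * card I) * real (card \<Omega>)" by simp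
  qed
  also have "\<dots> = real (card ?\<U>) * ((real u / real \<nu>) ^ (d * card I) * real (card \<Omega>))" by simp
  also have "card ?\<U> = (d * \<nu> choose u)" using n_subsets[of "{..<d * \<nu>}" u] by simp
  finally show ?thesis by (simp only: mult.assoc)
qed

lemma card_cramped:
  assumes u: "u \<le> d * \<nu>"
  shows "real (card (cramped s u))
    \<le> real (M choose s) * (real (d * \<nu> choose u) * (real u / real \<nu>) ^ (d * s)) * real (card \<Omega>)"
proof -
  let ?\<I> = "{I. I \<subseteq> {..<M} \<and> card I = s}"
  have fin: "finite ?\<I>" by simp
  have "cramped s u = (\<Union>I\<in>?\<I>. {\<omega>\<in>\<Omega>. card (cover \<omega> I) \<le> u})" by (auto simp: cramped_def)
  then have "card (cramped s u) \<le> (\<Sum>I\<in>?\<I>. card {\<omega>\<in>\<Omega>. card (cover \<omega> I) \<le> u})"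
    using card_UN_le[OF fin, of "\<lambda>I. {\<omega>\<in>\<Omega>. card (cover \<omega> I) \<le> u}"] by simp
  then have "real (card (cramped s u)) \<le> (\<Sum>I\<in>?\<I>. real (card {\<omega>\<in>\<Omega>. card (cover \<omega> I) \<le> u}))"
    unfolding of_nat_sum[symmetric] by (rule of_nat_mono)
  also have "\<dots> \<le> (\<Sum>I\<in>?\<I>. real (d * \<nu> choose u) * (real u / real \<nu>) ^ (d * s) * real (card \<Omega>))"
  proof (rule sum_mono)
    fix I assume "I \<in> ?\<I>"
    then show "real (card {\<omega>\<in>\<Omega>. card (cover \<omega> I) \<le> u})
        \<le> real (d * \<nu> choose u) * (real u / real \<nu>) ^ (d * s) * real (card \<Omega>)"
      using card_cramped_set[of I, OF _ u] by simp
  qed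
  also have "\<dots> = real (card ?\<I>) * (real (d * \<nu> choose u) * (real u / real \<nu>) ^ (d * s) * real (card \<Omega>))"
    by simp
  also have "card ?\<I> = (M choose s)" using n_subsets[of "{..<M}" s] by simp
  finally show ?thesis by (simp only: mult.assoc)
qed

text \<open>\<open>A\<close> gathers the constant factors per constraint in the union bound;
  \<open>\<beta>\<close> is chosen so that \<open>s \<le> \<beta> * \<nu>\<close> gives
  \<open>A * z \<le> 1 / 8\<close> for \<open>z = root 5 (d * s / \<nu>)\<close>.\<close>

definition A :: real where "A = 3 * real D * real q * real d * (3 * real d) ^ d"
definition \<beta> :: real where "\<beta> = (1 / (8 * A)) ^ 5 / real d"

lemma A_ge_1: "1 \<le> A"
proof -
  have "1 \<le> (3 * real d) ^ d" using d0 by (intro one_le_power) simp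
  moreover have "1 \<le> 3 * (real D * real q * real d)"
  proof -
    have "1 \<le> D * q * d" using D0 q0 d0 by (simp add: Suc_le_eq)
    then have "real 1 \<le> real (D * q * d)" by (rule of_nat_mono)
    then show ?thesis by simp
  qed
  ultimately have "1 * 1 \<le> (3 * (real D * real q * real d)) * (3 * real d) ^ d" by (intro mult_mono) auto
  then show ?thesis by (simp add: A_def algebra_simps)
qed

lemma \<beta>_pos: "0 < \<beta>" using A_ge_1 d0 by (simp add: \<beta>_def)

text \<open>Put \<open>d * s / \<nu> = z ^ 5\<close>; the fifth root keeps exponents integral.
  Choosing \<open>s\<close> constraints costs order \<open>z ^ (- 5 * s)\<close>, choosing the
  variables is paid for by \<open>u\<close> of the confinement factors up to constants, and the
  remaining factors, at least \<open>6 * s / 5\<close> many, gain \<open>z ^ (6 * s)\<close>. What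
  is left is \<open>(A * z) ^ s\<close>; here the shortfall per constraint has to exceed 1.\<close>

lemma cramped_term:
  assumes d: "2 \<le> d" and s: "1 \<le> s" "real s \<le> \<beta> * real \<nu>" and u: "u = (5 * d - 6) * s div 5"
  shows "real (M choose s) * (real (d * \<nu> choose u) * (real u / real \<nu>) ^ (d * s)) \<le> (1 / 8) ^ s"
    and "u \<le> d * \<nu>"
proof -
  define x where "x = real d * real s / real \<nu>"
  define z where "z = root 5 x"
  have x0: "0 < x" using d s \<nu>0 by (simp add: x_def)
  have z0: "0 < z" using x0 by (simp add: z_def)
  have zx: "z ^ 5 = x" using x0 by (simp add: z_def)
  have "x \<le> (1 / (8 * A)) ^ 5"
  proof -
    have "x \<le> real d * (\<beta> * real \<nu>) / real \<nu>"
      unfolding x_def using s(2) by (intro divide_right_mono mult_left_mono) auto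
    also have "\<dots> = (1 / (8 * A)) ^ 5" using d0 \<nu>0 by (simp add: \<beta>_def)
    finally show ?thesis .
  qed
  then have "z \<le> root 5 ((1 / (8 * A)) ^ 5)" unfolding z_def by (intro real_root_le_mono) auto
  also have "\<dots> = 1 / (8 * A)" using A_ge_1 by (subst real_root_power_cancel) auto
  finally have z: "z \<le> 1 / (8 * A)" .
  then have Az: "A * z \<le> 1 / 8" using A_ge_1 by (simp add: field_simps)
  have "1 * z \<le> A * z" using A_ge_1 z0 by (intro mult_right_mono) auto
  then have z1: "z \<le> 1" using Az by linarith
  have u5: "5 * u \<le> (5 * d - 6) * s" unfolding u by simp
  also have "(5 * d - 6) * s = 5 * (d * s) - 6 * s" by (simp add: diff_mult_distrib)
  finally have "5 * u \<le> 5 * (d * s) - 6 * s" .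
  moreover have "6 * s \<le> 5 * (d * s)" using mult_le_mono1[OF d, of s] by linarith
  ultimately have us: "u \<le> d * s" "6 * s \<le> 5 * (d * s - u)" by linarith+
  have "x \<le> 1" using zx z0 z1 by (metis less_eq_real_def power_le_one)
  then have "real (d * s) \<le> real \<nu>" using \<nu>0 by (simp add: x_def)
  then have "d * s \<le> \<nu>" by (simp only: of_nat_le_iff)
  moreover have "\<nu> \<le> d * \<nu>" using d0 by simp
  ultimately show "u \<le> d * \<nu>" using us by linarith
  have 1: "real (d * \<nu> choose u) * (real u / real \<nu>) ^ u \<le> (3 * real d) ^ (d * s)"
  proof -
    have "real (d * \<nu> choose u) * (real u / real \<nu>) ^ u = real (d * \<nu> choose u) * real u ^ u / real \<nu> ^ u"
      by (simp add: power_divide)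
    also have "\<dots> \<le> (3 * real (d * \<nu>)) ^ u / real \<nu> ^ u"
      by (intro divide_right_mono binomial_mult_pow_le) auto
    also have "\<dots> = (3 * real d) ^ u" using \<nu>0 by (simp add: power_mult_distrib)
    also have "\<dots> \<le> (3 * real d) ^ (d * s)" using us d by (intro power_increasing) auto
    finally show ?thesis .
  qed
  have 2: "(real u / real \<nu>) ^ (d * s - u) \<le> z ^ (6 * s)"
  proof -
    have "real u / real \<nu> \<le> x" unfolding x_def using us(1) \<nu>0
      by (intro divide_right_mono) (simp_all flip: of_nat_mult)
    then have "(real u / real \<nu>) ^ (d * s - u) \<le> x ^ (d * s - u)" by (intro power_mono) auto
    also have "\<dots> = z ^ (5 * (d * s - u))" by (simp add: zx[symmetric] power_mult)
    also have "\<dots> \<le> z ^ (6 * s)" using us z0 z1 by (intro power_decreasing) auto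
    finally show ?thesis .
  qed
  have 3: "real (M choose s) \<le> (3 * real D * real q * real d / z ^ 5) ^ s"
  proof -
    have "real (M choose s) * real s ^ s \<le> (3 * real M) ^ s" by (rule binomial_mult_pow_le)
    then have "real (M choose s) \<le> (3 * real M) ^ s / real s ^ s"
      using s by (simp add: pos_le_divide_eq)
    also have "\<dots> = (3 * real M / real s) ^ s" by (simp add: power_divide)
    also have "3 * real M / real s = 3 * real D * real q * real d / z ^ 5"
      unfolding zx x_def using d s \<nu>0 by (simp add: field_simps)
    finally show ?thesis .
  qed
  have "real (M choose s) * (real (d * \<nu> choose u) * (real u / real \<nu>) ^ (d * s))
     = real (M choose s) * ((real (d * \<nu> choose u) * (real u / real \<nu>) ^ u) * (real u / real \<nu>) ^ (d * s - u))"
    using us(1) by (simp add: power_add[symmetric] mult.assoc)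
  also have "\<dots> \<le> (3 * real D * real q * real d / z ^ 5) ^ s * ((3 * real d) ^ (d * s) * z ^ (6 * s))"
    by (intro mult_mono 1 2 3) (use z0 in auto)
  also have "\<dots> = (A * z) ^ s"
  proof -
    have "(3 * real D * real q * real d / z ^ 5) ^ s * ((3 * real d) ^ (d * s) * z ^ (6 * s))
        = (3 * real D * real q * real d / z ^ 5 * ((3 * real d) ^ d * z ^ 6)) ^ s"
      by (simp only: power_mult power_mult_distrib)
    also have "3 * real D * real q * real d / z ^ 5 * ((3 * real d) ^ d * z ^ 6) = A * z"
    proof -
      have "z ^ 6 = z ^ 5 * z" by (simp add: eval_nat_numeral)
      then show ?thesis using z0 by (simp add: A_def)
    qed
    finally show ?thesis .
  qed
  also have "\<dots> \<le> (1 / 8) ^ s" using Az A_ge_1 z0 by (intro power_mono) auto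
  finally show "real (M choose s) * (real (d * \<nu> choose u) * (real u / real \<nu>) ^ (d * s)) \<le> (1 / 8) ^ s" .
qed


definition bad_pairs :: "(nat \<Rightarrow> nat \<Rightarrow> nat) \<Rightarrow> (nat \<times> nat) set" where
  "bad_pairs \<omega> = {(i, j). i < j \<and> j < M \<and> card (cover \<omega> {i, j}) + 2 \<le> 2 * d}"

definition B :: nat where "B = (D * q)\<^sup>2 * d ^ (2 * d - 2) * (2 * d) ^ (2 * d)"

text \<open>For one pair, \<open>2 * d - 2\<close> variables can be chosen in at most
  \<open>(d * \<nu>) ^ (2 * d - 2)\<close> ways and confinement has probability at most
  \<open>(2 * d / \<nu>) ^ (2 * d)\<close>. This leaves order \<open>1 / \<nu>^2\<close> against at
  most \<open>M^2\<close> pairs, so the bound is constant but not below 1: bad pairs get limited in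
  number rather than excluded.\<close>

lemma sum_bad_pairs:
  assumes "2 \<le> \<nu>"
  shows "(\<Sum>\<omega>\<in>\<Omega>. real (card (bad_pairs \<omega>))) \<le> real B * real (card \<Omega>)"
proof -
  let ?P = "{(i, j). i < j \<and> j < M}"
  let ?u = "2 * d - 2"
  have P: "?P \<subseteq> {..<M} \<times> {..<M}" by auto
  then have finP: "finite ?P" using finite_subset by blast
  have cardP: "card ?P \<le> M\<^sup>2" using card_mono[OF _ P] by (simp add: power2_eq_square)
  have u: "?u \<le> d * \<nu>" using assms mult_le_mono2[of 2 \<nu> d] by linarith
  have "real (card (bad_pairs \<omega>)) = (\<Sum>p\<in>?P. if card (cover \<omega> {fst p, snd p}) + 2 \<le> 2 * d then 1 else 0)" for \<omega>
  proof -
    have "bad_pairs \<omega> = {p\<in>?P. card (cover \<omega> {fst p, snd p}) + 2 \<le> 2 * d}"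
      by (auto simp: bad_pairs_def)
    then show ?thesis using finP by (simp add: sum.inter_filter[symmetric])
  qed
  then have "(\<Sum>\<omega>\<in>\<Omega>. real (card (bad_pairs \<omega>)))
      = (\<Sum>p\<in>?P. \<Sum>\<omega>\<in>\<Omega>. if card (cover \<omega> {fst p, snd p}) + 2 \<le> 2 * d then 1 else 0)"
    by (simp only: sum.swap[of _ ?P \<Omega>])
  also have "\<dots> = (\<Sum>p\<in>?P. real (card {\<omega>\<in>\<Omega>. card (cover \<omega> {fst p, snd p}) + 2 \<le> 2 * d}))"
    using finite_\<Omega> by (simp add: sum.inter_filter[symmetric])
  also have "\<dots> \<le> (\<Sum>p\<in>?P. real d ^ ?u * (2 * real d) ^ (2 * d) / real \<nu> ^ 2 * real (card \<Omega>))"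
  proof (rule sum_mono)
    fix p assume p: "p \<in> ?P"
    then have I: "{fst p, snd p} \<subseteq> {..<M}" "card {fst p, snd p} = 2" by auto
    have "{\<omega>\<in>\<Omega>. card (cover \<omega> {fst p, snd p}) + 2 \<le> 2 * d} \<subseteq> {\<omega>\<in>\<Omega>. card (cover \<omega> {fst p, snd p}) \<le> ?u}"
      by auto
    then have "card {\<omega>\<in>\<Omega>. card (cover \<omega> {fst p, snd p}) + 2 \<le> 2 * d} \<le> card {\<omega>\<in>\<Omega>. card (cover \<omega> {fst p, snd p}) \<le> ?u}"
      by (intro card_mono) (auto simp: finite_\<Omega>)
    then have "real (card {\<omega>\<in>\<Omega>. card (cover \<omega> {fst p, snd p}) + 2 \<le> 2 * d})
        \<le> real (card {\<omega>\<in>\<Omega>. card (cover \<omega> {fst p, snd p}) \<le> ?u})" by (rule of_nat_mono)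
    also have "\<dots> \<le> real (d * \<nu> choose ?u) * (real ?u / real \<nu>) ^ (d * 2) * real (card \<Omega>)"
      using card_cramped_set[OF I(1) u] I(2) by simp
    also have "\<dots> \<le> (real d * real \<nu>) ^ ?u * ((2 * real d) / real \<nu>) ^ (d * 2) * real (card \<Omega>)"
    proof (intro mult_right_mono mult_mono power_mono divide_right_mono)
      have "(d * \<nu> choose ?u) \<le> (d * \<nu>) ^ ?u" by (rule binomial_le_pow[OF u])
      then show "real (d * \<nu> choose ?u) \<le> (real d * real \<nu>) ^ ?u" by (metis of_nat_le_iff of_nat_mult of_nat_power)
    qed auto
    also have "(real d * real \<nu>) ^ ?u * ((2 * real d) / real \<nu>) ^ (d * 2) = real d ^ ?u * (2 * real d) ^ (2 * d) / real \<nu> ^ 2"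
    proof -
      have e: "d * 2 = ?u + 2" using d0 by simp
      have "real \<nu> ^ (d * 2) = real \<nu> ^ ?u * real \<nu> ^ 2" unfolding e power_add ..
      then show ?thesis using \<nu>0 by (simp add: power_mult_distrib power_divide mult.commute[of 2 d])
    qed
    finally show "real (card {\<omega>\<in>\<Omega>. card (cover \<omega> {fst p, snd p}) + 2 \<le> 2 * d})
        \<le> real d ^ ?u * (2 * real d) ^ (2 * d) / real \<nu> ^ 2 * real (card \<Omega>)" .
  qed
  also have "\<dots> = real (card ?P) * (real d ^ ?u * (2 * real d) ^ (2 * d) / real \<nu> ^ 2 * real (card \<Omega>))"
    by simp
  also have "\<dots> \<le> real (M\<^sup>2) * (real d ^ ?u * (2 * real d) ^ (2 * d) / real \<nu> ^ 2 * real (card \<Omega>))"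
    using cardP by (intro mult_right_mono of_nat_mono) auto
  also have "\<dots> = real B * real (card \<Omega>)"
    using \<nu>0 by (simp add: B_def power_mult_distrib field_simps)
  finally show ?thesis .
qed

text \<open>First moment method: the four kinds of failure take up at most 1/8, 1/8, 1/7 and 1/4 of
  \<open>\<Omega>\<close>. The condition on \<open>D\<close> makes each concentration failure have
  probability at most \<open>exp (- (d + 3) * L)\<close>, which beats the \<open>2 ^ (d * L)\<close>
  vertex sets; the third share is a geometric series of ratio 1/8, and the last is Markov's
  inequality at the threshold \<open>4 * B\<close>.\<close>

lemma exists_good_tuples:
  fixes \<eta> :: real
  assumes \<nu>2: "2 \<le> \<nu>" and \<eta>: "0 < \<eta>" "\<eta> \<le> 1" and D: "4 * (real d + 3) \<le> real D * \<eta>\<^sup>2"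
  shows "\<exists>\<omega>. good_tuples q d D \<eta> \<beta> (4 * B) \<nu> \<omega>"
proof -
  define F1 where "F1 S = {\<omega>\<in>\<Omega>. ((1 - real (card S) / real (d * L)) ^ d + \<eta>) * real M
      \<le> (\<Sum>j<M. if \<forall>k<d. k * L + \<omega> j k \<notin> S then 1 else 0)}" for S
  define F2 where "F2 S = {\<omega>\<in>\<Omega>. (real (card S) / real (d * L) + \<eta>) * real M
      \<le> (\<Sum>j<M. real (card {k. k < d \<and> k * L + \<omega> j k \<in> S}) / real d)}" for S
  \<comment> \<open>For \<open>d = 1\<close> the cover bound holds trivially, whereas
    \<open>5 * d - 6\<close> would be truncated to 0.\<close>
  define F3 where "F3 s = (if 2 \<le> d then cramped s ((5 * d - 6) * s div 5) else {})" for s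
  define F4 where "F4 = {\<omega>\<in>\<Omega>. 4 * B < card (bad_pairs \<omega>)}"
  define \<S> where "\<S> = Pow {..<d * L}"
  define K where "K = nat \<lfloor>\<beta> * real \<nu>\<rfloor>"
  let ?e = "exp (- (real M * \<eta>\<^sup>2 / 4))"
  have card\<S>: "card \<S> = 2 ^ (d * L)" and fin\<S>: "finite \<S>" by (auto simp: \<S>_def card_Pow)
  have B1: "1 \<le> B" using D0 q0 d0 by (simp add: B_def Suc_le_eq)
  have small: "2 ^ (d * L) * ?e \<le> (1 / 8 :: real)"
  proof -
    have "real ((d + 3) * L) \<le> real M * \<eta>\<^sup>2 / 4"
    proof -
      have "(4 * (real d + 3)) * real L \<le> (real D * \<eta>\<^sup>2) * real L" using D by (intro mult_right_mono) auto
      then show ?thesis by (simp add: algebra_simps)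
    qed
    then have "?e \<le> exp (- real ((d + 3) * L))" by simp
    also have "\<dots> = exp (-1) ^ ((d + 3) * L)"
      by (simp add: exp_of_nat_mult[symmetric] del: of_nat_mult)
    also have "\<dots> \<le> (1 / 2) ^ ((d + 3) * L)"
    proof (rule power_mono)
      have "2 \<le> exp (1::real)" using exp_ge_add_one_self[of 1] by simp
      then show "exp (-1) \<le> (1 / 2 :: real)" by (simp add: exp_minus field_simps)
    qed simp
    finally have "2 ^ (d * L) * ?e \<le> 2 ^ (d * L) * (1 / 2) ^ ((d + 3) * L)" by simp
    also have "(d + 3) * L = d * L + 3 * L" by (simp add: algebra_simps)
    also have "2 ^ (d * L) * (1 / 2) ^ (d * L + 3 * L) = (1 / 2 :: real) ^ (3 * L)"
      by (simp add: power_add power_divide)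
    also have "\<dots> \<le> (1 / 2) ^ 3"
    proof (rule power_decreasing)
      show "3 \<le> 3 * L" using L0 by (simp add: Suc_le_eq)
    qed auto
    finally show ?thesis by (simp add: eval_nat_numeral)
  qed
  have c1: "real (card (F1 S)) \<le> ?e * real (card \<Omega>)" if "S \<in> \<S>" for S
  proof -
    have "S \<subseteq> {..<d * L}" using that by (simp add: \<S>_def)
    from chernoff_count[OF finite_tuples _ mean_miss[OF this] \<eta>, of M]
    show ?thesis unfolding F1_def \<Omega>_def card_\<Omega>[unfolded \<Omega>_def] by simp
  qed
  have c2: "real (card (F2 S)) \<le> ?e * real (card \<Omega>)" if "S \<in> \<S>" for S
  proof -
    have S: "S \<subseteq> {..<d * L}" using that by (simp add: \<S>_def)
    have "0 \<le> real (card {k. k < d \<and> k * L + t k \<in> S}) / real d \<and>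
        real (card {k. k < d \<and> k * L + t k \<in> S}) / real d \<le> 1" for t
      using card_mono[of "{..<d}" "{k. k < d \<and> k * L + t k \<in> S}"] d0 by auto
    from chernoff_count[OF finite_tuples this mean_hits[OF S] \<eta>, of M]
    show ?thesis unfolding F2_def \<Omega>_def card_\<Omega>[unfolded \<Omega>_def] by simp
  qed
  have u: "real (card (\<Union>S\<in>\<S>. F S)) \<le> real (card \<Omega>) / 8"
    if "\<And>S. S \<in> \<S> \<Longrightarrow> real (card (F S)) \<le> ?e * real (card \<Omega>)" for F :: "nat set \<Rightarrow> (nat \<Rightarrow> nat \<Rightarrow> nat) set"
  proof -
    have "real (card (\<Union>S\<in>\<S>. F S)) \<le> (\<Sum>S\<in>\<S>. real (card (F S)))"
      unfolding of_nat_sum[symmetric] by (intro of_nat_mono card_UN_le fin\<S>)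
    also have "\<dots> \<le> (\<Sum>S\<in>\<S>. ?e * real (card \<Omega>))" by (intro sum_mono that)
    also have "\<dots> = (2 ^ (d * L) * ?e) * real (card \<Omega>)" by (simp add: card\<S>)
    also have "\<dots> \<le> (1 / 8) * real (card \<Omega>)" using small by (intro mult_right_mono) auto
    finally show ?thesis by simp
  qed
  have c3: "real (card (\<Union>s\<in>{1..K}. F3 s)) \<le> real (card \<Omega>) / 7"
  proof -
    have one: "real (card (F3 s)) \<le> (1 / 8) ^ s * real (card \<Omega>)" if s: "s \<in> {1..K}" for s
    proof (cases "2 \<le> d")
      case True
      have "real s \<le> \<beta> * real \<nu>" using s \<beta>_pos unfolding K_def by (simp add: le_nat_floor le_nat_iff le_floor_iff)
      then have *: "real (M choose s) * (real (d * \<nu> choose ((5 * d - 6) * s div 5)) * (real ((5 * d - 6) * s div 5) / real \<nu>) ^ (d * s)) \<le> (1 / 8) ^ s"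
         "(5 * d - 6) * s div 5 \<le> d * \<nu>"
        using cramped_term[OF True _ _ refl, of s] s by auto
      have "real (card (F3 s)) \<le> real (M choose s) * (real (d * \<nu> choose ((5 * d - 6) * s div 5)) * (real ((5 * d - 6) * s div 5) / real \<nu>) ^ (d * s)) * real (card \<Omega>)"
        using card_cramped[OF *(2)] True by (simp add: F3_def)
      also have "\<dots> \<le> (1 / 8) ^ s * real (card \<Omega>)" by (intro mult_right_mono *(1)) simp
      finally show ?thesis .
    qed (simp add: F3_def)
    have geo: "(\<Sum>s\<in>{1..k}. (1 / 8 :: real) ^ s) = (1 - (1 / 8) ^ k) / 7" for k
    proof (induction k)
      case (Suc k)
      have "(\<Sum>s\<in>{1..Suc k}. (1 / 8 :: real) ^ s) = (1 - (1 / 8) ^ k) / 7 + (1 / 8) ^ k / 8"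
        using Suc by simp
      moreover have "(1 - x) / 7 + x / 8 = (1 - 1 / 8 * x) / 7" for x :: real by (simp add: field_simps)
      ultimately show ?case unfolding power_Suc by (simp only:)
    qed simp
    have "real (card (\<Union>s\<in>{1..K}. F3 s)) \<le> (\<Sum>s\<in>{1..K}. real (card (F3 s)))"
      unfolding of_nat_sum[symmetric] by (intro of_nat_mono card_UN_le) simp
    also have "\<dots> \<le> (\<Sum>s\<in>{1..K}. (1 / 8) ^ s * real (card \<Omega>))" by (intro sum_mono one)
    also have "\<dots> = (1 - (1 / 8) ^ K) / 7 * real (card \<Omega>)" by (simp only: sum_distrib_right[symmetric] geo)
    also have "\<dots> \<le> 1 / 7 * real (card \<Omega>)" by (intro mult_right_mono) auto
    finally show ?thesis by simp
  qed
  have c4: "real (card F4) \<le> real (card \<Omega>) / 4"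
  proof -
    have "real (card F4) * real (4 * B) = (\<Sum>\<omega>\<in>F4. real (4 * B))" by simp
    also have "\<dots> \<le> (\<Sum>\<omega>\<in>F4. real (card (bad_pairs \<omega>)))"
      by (intro sum_mono of_nat_mono) (auto simp: F4_def)
    also have "\<dots> \<le> (\<Sum>\<omega>\<in>\<Omega>. real (card (bad_pairs \<omega>)))"
      by (rule sum_mono2) (auto simp: F4_def finite_\<Omega>)
    also have "\<dots> \<le> real B * real (card \<Omega>)" by (rule sum_bad_pairs[OF \<nu>2])
    finally have "real B * (4 * real (card F4)) \<le> real B * real (card \<Omega>)" by (simp add: algebra_simps)
    then show ?thesis using B1 by simp
  qed
  let ?F = "(\<Union>S\<in>\<S>. F1 S) \<union> (\<Union>S\<in>\<S>. F2 S) \<union> (\<Union>s\<in>{1..K}. F3 s) \<union> F4"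
  have "card ?F \<le> card (\<Union>S\<in>\<S>. F1 S) + card (\<Union>S\<in>\<S>. F2 S) + card (\<Union>s\<in>{1..K}. F3 s) + card F4"
    by (intro order.trans[OF card_Un_le] add_mono order_refl)
  then have "real (card ?F) \<le> real (card (\<Union>S\<in>\<S>. F1 S)) + real (card (\<Union>S\<in>\<S>. F2 S)) + real (card (\<Union>s\<in>{1..K}. F3 s)) + real (card F4)"
    by linarith
  also have "\<dots> \<le> real (card \<Omega>) / 8 + real (card \<Omega>) / 8 + real (card \<Omega>) / 7 + real (card \<Omega>) / 4"
    by (intro add_mono u c1 c2 c3 c4)
  also have "\<dots> < real (card \<Omega>)" using card_\<Omega>_pos by simp
  finally have "card ?F < card \<Omega>" by simp
  moreover have "finite ?F"
    by (intro finite_UnI finite_UN_I fin\<S>) (auto simp: F1_def F2_def F3_def F4_def cramped_def finite_\<Omega>)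
  ultimately have "\<not> \<Omega> \<subseteq> ?F" using card_mono by (metis not_le)
  then obtain \<omega> where \<omega>: "\<omega> \<in> \<Omega>" "\<omega> \<notin> ?F" by blast
  have "good_tuples q d D \<eta> \<beta> (4 * B) \<nu> \<omega>"
    unfolding good_tuples_def var_eq[symmetric] cover_def[symmetric] bad_pairs_def[symmetric]
  proof (intro conjI allI impI)
    show "\<omega> j k < L" if "j < M" "k < d" for j k
      using \<omega>(1) that tuple_less by (auto simp: \<Omega>_def PiE_def Pi_def)
    show "real (card {j. j < M \<and> (\<forall>k<d. k * L + \<omega> j k \<notin> S)})
        \<le> ((1 - real (card S) / real (d * L)) ^ d + \<eta>) * real M" if "S \<subseteq> {..<d * L}" for S
    proof -
      have "\<omega> \<notin> F1 S" using \<omega>(2) that by (auto simp: \<S>_def)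
      then have "(\<Sum>j<M. if \<forall>k<d. k * L + \<omega> j k \<notin> S then 1 else 0) \<le> ((1 - real (card S) / real (d * L)) ^ d + \<eta>) * real M"
        using \<omega>(1) unfolding F1_def mem_Collect_eq by (simp only: simp_thms not_le less_imp_le)
      moreover have "(\<Sum>j<M. if \<forall>k<d. k * L + \<omega> j k \<notin> S then 1 else (0::real)) = real (card {j\<in>{..<M}. \<forall>k<d. k * L + \<omega> j k \<notin> S})"
        by (subst sum.inter_filter[symmetric]) auto
      moreover have "{j\<in>{..<M}. \<forall>k<d. k * L + \<omega> j k \<notin> S} = {j. j < M \<and> (\<forall>k<d. k * L + \<omega> j k \<notin> S)}" by auto
      ultimately show ?thesis by simp
    qed
    show "real (\<Sum>j<M. card {k. k < d \<and> k * L + \<omega> j k \<in> S}) \<le> real D * real (card S) + \<eta> * real d * real M"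
      if "S \<subseteq> {..<d * L}" for S
    proof -
      have "\<omega> \<notin> F2 S" using \<omega>(2) that by (auto simp: \<S>_def)
      then have "(\<Sum>j<M. real (card {k. k < d \<and> k * L + \<omega> j k \<in> S}) / real d) \<le> (real (card S) / real (d * L) + \<eta>) * real M"
        using \<omega>(1) unfolding F2_def mem_Collect_eq by (simp only: simp_thms not_le less_imp_le)
      then have "real (\<Sum>j<M. card {k. k < d \<and> k * L + \<omega> j k \<in> S}) / real d \<le> (real (card S) / real (d * L) + \<eta>) * real M"
        by (simp add: sum_divide_distrib)
      then have "real (\<Sum>j<M. card {k. k < d \<and> k * L + \<omega> j k \<in> S}) \<le> (real (card S) / real (d * L) + \<eta>) * real M * real d"
        using d0 by (simp add: pos_divide_le_eq)
      also have "\<dots> = real D * real (card S) + \<eta> * real d * real M"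
        using d0 q0 \<nu>0 by (simp add: field_simps)
      finally show ?thesis .
    qed
    show "5 * d * card I \<le> 5 * card (cover \<omega> I) + 6 * card I"
      if I: "I \<subseteq> {..<M}" "real (card I) \<le> \<beta> * real \<nu>" for I
    proof (rule ccontr)
      assume neg: "\<not> 5 * d * card I \<le> 5 * card (cover \<omega> I) + 6 * card I"
      have d2: "2 \<le> d"
      proof (rule ccontr)
        assume "\<not> 2 \<le> d"
        then have "d = 1" using d0 by simp
        then show False using neg by simp
      qed
      have "card I \<noteq> 0" using neg by (intro notI) simp
      moreover have "card I \<le> K" using I(2) by (simp add: K_def le_nat_floor)
      ultimately have s: "card I \<in> {1..K}" by simp
      have "5 * card (cover \<omega> I) \<le> (5 * d - 6) * card I" using neg by (simp add: diff_mult_distrib)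
      then have "card (cover \<omega> I) \<le> (5 * d - 6) * card I div 5" by linarith
      then have "\<omega> \<in> F3 (card I)" using \<omega>(1) I(1) d2 by (auto simp: F3_def cramped_def)
      then show False using \<omega>(2) s by blast
    qed
    show "card (bad_pairs \<omega>) \<le> 4 * B" using \<omega> by (auto simp: F4_def not_less)
  qed
  then show ?thesis by blast
qed

end

section \<open>The graph\<close>

text \<open>The order of quantifiers is the point: \<open>\<beta>\<close> and \<open>B\<close> do
  not depend on \<open>\<nu>\<close>, so the level is linear in \<open>N\<close> and the number of
  constraints given up is bounded.\<close>

lemma good_tuples_exist:
  fixes \<eta> :: real and q d D :: nat
  assumes "0 < q" "0 < d" "0 < D" and \<eta>: "0 < \<eta>" "\<eta> \<le> 1" and D: "4 * (real d + 3) \<le> real D * \<eta>\<^sup>2"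
  shows "\<exists>\<beta>>0. \<exists>B. \<forall>\<nu>\<ge>2. \<exists>\<omega>. good_tuples q d D \<eta> \<beta> B \<nu> \<omega>"
proof -
  have rt: "random_tuples q d D \<nu>" if "0 < \<nu>" for \<nu> using assms that by unfold_locales
  have "0 < random_tuples.\<beta> q d D" using random_tuples.\<beta>_pos[OF rt[of 1]] by simp
  moreover have "\<exists>\<omega>. good_tuples q d D \<eta> (random_tuples.\<beta> q d D) (4 * random_tuples.B q d D) \<nu> \<omega>"
    if "2 \<le> \<nu>" for \<nu>
    using random_tuples.exists_good_tuples[OF rt that \<eta> D] that by simp
  ultimately show ?thesis by blast
qed

lemma Max_image_eqI:
  assumes "finite A" "\<And>x. x \<in> A \<Longrightarrow> f x \<le> (m::nat)" "x0 \<in> A" "f x0 = m"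
  shows "(MAX x\<in>A. f x) = m"
  using assms by (intro Max_eqI) auto

locale tuple_graph =
  fixes q d D :: nat and \<eta> \<beta> :: real and B \<nu> :: nat and \<omega> :: "nat \<Rightarrow> nat \<Rightarrow> nat"
  assumes q0: "0 < q" and d0: "0 < d" and D0: "0 < D" and \<nu>0: "0 < \<nu>"
    and \<eta>: "0 < \<eta>" "\<eta> * real d < 1"
    and good: "good_tuples q d D \<eta> \<beta> B \<nu> \<omega>"
begin

abbreviation L where "L \<equiv> q * \<nu>"
abbreviation M where "M \<equiv> D * (q * \<nu>)"

lemma \<omega>: "j < M \<Longrightarrow> k < d \<Longrightarrow> \<omega> j k < L"
  using good unfolding good_tuples_def by blast

lemma miss: "S \<subseteq> {..<d * L} \<Longrightarrow> real (card {j. j < M \<and> (\<forall>k<d. k * L + \<omega> j k \<notin> S)})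
    \<le> ((1 - real (card S) / real (d * L)) ^ d + \<eta>) * real M"
  using good unfolding good_tuples_def by blast

lemma hits: "S \<subseteq> {..<d * L} \<Longrightarrow> real (\<Sum>j<M. card {k. k < d \<and> k * L + \<omega> j k \<in> S})
    \<le> real D * real (card S) + \<eta> * real d * real M"
  using good unfolding good_tuples_def by blast

lemma cover_ge: "I \<subseteq> {..<M} \<Longrightarrow> real (card I) \<le> \<beta> * real \<nu> \<Longrightarrow>
    5 * d * card I \<le> 5 * card (\<Union>j\<in>I. (\<lambda>k. k * \<nu> + \<omega> j k div q) ` {..<d}) + 6 * card I"
  using good unfolding good_tuples_def by blast

lemma few_bad_pairs: "card {(i, j). i < j \<and> j < M \<and>
    card (\<Union>l\<in>{i, j}. (\<lambda>k. k * \<nu> + \<omega> l k div q) ` {..<d}) + 2 \<le> 2 * d} \<le> B"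
  using good unfolding good_tuples_def by blast

definition nb :: "nat \<Rightarrow> nat \<Rightarrow> nat" where "nb j k = k * L + \<omega> j k + 1"

definition E0 :: "(nat \<times> nat) set" where
  "E0 = (\<lambda>(j, k). (nb j k, j + 1)) ` ({..<M} \<times> {..<d})"

definition full :: "nat \<Rightarrow> nat set" where "full u = {j. (u, j) \<in> E0}"

text \<open>Which edges of an overfull vertex survive is immaterial; only the number removed is
  counted.\<close>

definition keep :: "nat \<Rightarrow> nat set" where
  "keep u = (SOME K. K \<subseteq> full u \<and> card K = min D (card (full u)))"

definition E :: "(nat \<times> nat) set" where "E = {(u, j). j \<in> keep u}"

section \<open>Degrees and the number of removed edges\<close>

lemma finite_E0: "finite E0" by (simp add: E0_def)

lemma nb_le: "j < M \<Longrightarrow> k < d \<Longrightarrow> nb j k \<in> {1..d * L}"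
  using block_less[of k d "\<omega> j k" L] \<omega>[of j k] by (simp add: nb_def Suc_le_eq)

lemma nb_inj: "j < M \<Longrightarrow> inj_on (nb j) {..<d}"
proof (rule inj_onI)
  fix k k' assume "j < M" "k \<in> {..<d}" "k' \<in> {..<d}" "nb j k = nb j k'"
  then show "k = k'"
    using block_inj[of "\<omega> j k" L "\<omega> j k'" k k'] \<omega>[of j k] \<omega>[of j k'] by (simp add: nb_def)
qed

lemma E0_subset: "E0 \<subseteq> {1..d * L} \<times> {1..M}"
proof
  fix x assume "x \<in> E0"
  then obtain j k where "j < M" "k < d" "x = (nb j k, j + 1)" by (auto simp: E0_def)
  then show "x \<in> {1..d * L} \<times> {1..M}" using nb_le[of j k] by auto
qed

lemma card_E0: "card E0 = M * d"
proof -
  have "inj_on (\<lambda>(j, k). (nb j k, j + 1)) ({..<M} \<times> {..<d})"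
  proof (rule inj_onI)
    fix x y assume xy: "x \<in> {..<M} \<times> {..<d}" "y \<in> {..<M} \<times> {..<d}"
      "(\<lambda>(j, k). (nb j k, j + 1)) x = (\<lambda>(j, k). (nb j k, j + 1)) y"
    obtain j k j' k' where "x = (j, k)" "y = (j', k')" by (cases x; cases y)
    then show "x = y" using xy nb_inj[of j] by (auto simp: inj_on_def)
  qed
  then show ?thesis unfolding E0_def by (subst card_image) (auto simp: card_cartesian_product)
qed

lemma finite_full: "finite (full u)"
  by (rule finite_subset[of _ "snd ` E0"]) (force simp: full_def finite_E0)+

lemma keep: "keep u \<subseteq> full u" "card (keep u) = min D (card (full u))"
proof -
  obtain K where "K \<subseteq> full u" "card K = min D (card (full u))"
    using obtain_subset_with_card_n[of "min D (card (full u))" "full u"] by auto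
  then have "\<exists>K. K \<subseteq> full u \<and> card K = min D (card (full u))" by blast
  then have "keep u \<subseteq> full u \<and> card (keep u) = min D (card (full u))" unfolding keep_def by (rule someI_ex)
  then show "keep u \<subseteq> full u" "card (keep u) = min D (card (full u))" by auto
qed

lemma finite_keep: "finite (keep u)" using keep(1) finite_full finite_subset by blast

lemma E_subset_E0: "E \<subseteq> E0" using keep(1) by (auto simp: E_def full_def)

lemma full_outside: "u \<notin> {1..d * L} \<Longrightarrow> full u = {}"
  using E0_subset by (auto simp: full_def)

lemma sum_full: "U \<subseteq> {1..d * L} \<Longrightarrow> (\<Sum>u\<in>U. card (full u)) = card {(u, j)\<in>E0. u \<in> U}"
proof -
  assume U: "U \<subseteq> {1..d * L}"
  then have finU: "finite U" using finite_subset by blast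
  have "{(u, j)\<in>E0. u \<in> U} = (SIGMA u:U. full u)" by (auto simp: full_def)
  then show ?thesis using finU finite_full by (simp add: card_SigmaI)
qed

text \<open>The \<open>M * d\<close> edges are spread over \<open>d * L\<close> vertices, so the
  average degree is exactly \<open>D\<close>. Hence cutting degrees at \<open>D\<close> makes the
  maximum equal to \<open>D\<close>.\<close>

lemma exists_full_degree: "\<exists>u\<in>{1..d * L}. D \<le> card (full u)"
proof (rule ccontr)
  assume "\<not> ?thesis"
  then have lt: "card (full u) < D" if "u \<in> {1..d * L}" for u using that by (meson not_le)
  have "{(u, j)\<in>E0. u \<in> {1..d * L}} = E0" using E0_subset by auto
  then have "(\<Sum>u\<in>{1..d * L}. card (full u)) = M * d"
    using sum_full[OF order_refl] card_E0 by simp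
  moreover have "(\<Sum>u\<in>{1..d * L}. card (full u)) < (\<Sum>u\<in>{1..d * L}. D)"
    by (rule sum_strict_mono) (use lt d0 q0 \<nu>0 in \<open>auto simp: Suc_le_eq\<close>)
  ultimately show False by (simp add: mult.commute mult.left_commute)
qed

text \<open>Applied to the vertices of degree above \<open>D\<close>, \<open>hits\<close> bounds
  their total degree by \<open>D\<close> each plus \<open>\<eta> * d * M\<close>, and the excess
  over \<open>D\<close> is precisely what is cut.\<close>

lemma card_removed: "real (card (E0 - E)) \<le> \<eta> * real d * real M"
proof -
  define V where "V = {u\<in>{1..d * L}. D < card (full u)}"
  \<comment> \<open>The tuples number left vertices from 0, the graph from 1.\<close>
  define S where "S = (\<lambda>u. u - 1) ` V"
  have V: "V \<subseteq> {1..d * L}" by (auto simp: V_def)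
  then have finV: "finite V" using finite_subset by blast
  have S: "S \<subseteq> {..<d * L}"
  proof
    fix s assume "s \<in> S"
    then obtain u where "u \<in> V" "s = u - 1" by (auto simp: S_def)
    moreover have "u \<in> {1..d * L}" using \<open>u \<in> V\<close> V by blast
    ultimately show "s \<in> {..<d * L}" by auto
  qed
  have cardS: "card S = card V"
    unfolding S_def
  proof (rule card_image, rule inj_onI)
    fix u v assume "u \<in> V" "v \<in> V" "u - 1 = v - 1"
    moreover have "1 \<le> u" "1 \<le> v" using \<open>u \<in> V\<close> \<open>v \<in> V\<close> V by auto
    ultimately show "u = v" by linarith
  qed
  have mem: "u \<in> V \<longleftrightarrow> u - 1 \<in> S" if "1 \<le> u" for u
  proof
    assume "u - 1 \<in> S"
    then obtain v where v: "v \<in> V" "u - 1 = v - 1" by (auto simp: S_def)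
    then have "1 \<le> v" using V by auto
    then have "u = v" using v(2) that by simp
    then show "u \<in> V" using v(1) by simp
  qed (auto simp: S_def)
  have "E0 - E = (SIGMA u:V. full u - keep u)"
  proof (intro equalityI subsetI)
    fix x assume x: "x \<in> E0 - E"
    obtain u j where uj: "x = (u, j)" by (cases x)
    have j: "j \<in> full u" "j \<notin> keep u" using x uj by (auto simp: full_def E_def)
    then have "u \<in> {1..d * L}" using full_outside by blast
    moreover have "D < card (full u)"
    proof (rule ccontr)
      assume "\<not> D < card (full u)"
      then have "card (keep u) = card (full u)" using keep(2) by simp
      then have "keep u = full u" using keep(1) finite_full by (intro card_subset_eq) auto
      then show False using j by simp
    qed
    ultimately show "x \<in> (SIGMA u:V. full u - keep u)" using j uj by (simp add: V_def)
  qed (auto simp: full_def E_def)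
  then have "card (E0 - E) = (\<Sum>u\<in>V. card (full u - keep u))"
    using finV finite_full by (simp add: card_SigmaI)
  also have "\<dots> = (\<Sum>u\<in>V. card (full u) - D)"
  proof (rule sum.cong[OF refl])
    fix u assume "u \<in> V"
    then have "card (keep u) = D" using keep(2) by (simp add: V_def)
    then show "card (full u - keep u) = card (full u) - D"
      using card_Diff_subset[OF finite_keep keep(1)] by simp
  qed
  finally have "card (E0 - E) + D * card V = (\<Sum>u\<in>V. (card (full u) - D) + D)"
    by (simp add: sum.distrib mult.commute)
  also have "\<dots> = (\<Sum>u\<in>V. card (full u))"
  proof (rule sum.cong[OF refl])
    fix u assume "u \<in> V"
    then have "D < card (full u)" unfolding V_def by blast
    then show "card (full u) - D + D = card (full u)" by simp
  qed
  also have "\<dots> = card {(u, j)\<in>E0. u \<in> V}" by (rule sum_full[OF V])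
  also have "\<dots> \<le> card (SIGMA j:{..<M}. {k. k < d \<and> k * L + \<omega> j k \<in> S})"
  proof (rule surj_card_le[where f = "\<lambda>(j, k). (nb j k, j + 1)"])
    show "{(u, j)\<in>E0. u \<in> V} \<subseteq> (\<lambda>(j, k). (nb j k, j + 1)) ` (SIGMA j:{..<M}. {k. k < d \<and> k * L + \<omega> j k \<in> S})"
    proof
      fix x assume "x \<in> {(u, j)\<in>E0. u \<in> V}"
      then obtain j k where "j < M" "k < d" "x = (nb j k, j + 1)" "nb j k \<in> V" by (auto simp: E0_def)
      moreover have "k * L + \<omega> j k \<in> S" using mem[of "nb j k"] \<open>nb j k \<in> V\<close> by (simp add: nb_def)
      ultimately show "x \<in> (\<lambda>(j, k). (nb j k, j + 1)) ` (SIGMA j:{..<M}. {k. k < d \<and> k * L + \<omega> j k \<in> S})"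
        by (intro image_eqI[of _ _ "(j, k)"]) auto
    qed
  qed auto
  also have "\<dots> = (\<Sum>j<M. card {k. k < d \<and> k * L + \<omega> j k \<in> S})" by (simp add: card_SigmaI)
  finally have "real (card (E0 - E) + D * card V) \<le> real (\<Sum>j<M. card {k. k < d \<and> k * L + \<omega> j k \<in> S})"
    by (rule of_nat_mono)
  also have "\<dots> \<le> real D * real (card S) + \<eta> * real d * real M" by (rule hits[OF S])
  finally show ?thesis using cardS by simp
qed

lemma graph: "d * L \<le> N \<Longrightarrow> bipartite_graph N M E"
  unfolding bipartite_graph_def
  by (rule order.trans[OF order.trans[OF E_subset_E0 E0_subset]]) auto

lemma left_degree:
  assumes "d * L \<le> N" shows "largest_left_degree N E = D"
proof -
  have nbrs: "left_nbrs E {u} = keep u" for u by (auto simp: left_nbrs_def E_def)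
  obtain u where u: "u \<in> {1..d * L}" "D \<le> card (full u)" using exists_full_degree by blast
  show ?thesis unfolding largest_left_degree_def nbrs
    by (rule Max_image_eqI[where ?x0.0 = u]) (use u assms keep(2) in auto)
qed

lemma right_nbrs_subset:
  assumes "j < M" shows "right_nbrs E (j + 1) \<subseteq> nb j ` {..<d}"
  using E_subset_E0 by (auto simp: right_nbrs_def E0_def)

text \<open>Leaves a right vertex that lost no edge and so keeps degree \<open>d\<close>; this is
  what \<open>\<eta> * real d < 1\<close> is for.\<close>

lemma card_touched: "card (snd ` (E0 - E)) < M"
proof -
  have "real (card (snd ` (E0 - E))) \<le> real (card (E0 - E))"
    by (intro of_nat_mono card_image_le) (simp add: finite_E0)
  also have "\<dots> \<le> \<eta> * real d * real M" by (rule card_removed)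
  also have "\<dots> < 1 * real M" using \<eta> D0 q0 \<nu>0 by (intro mult_strict_right_mono) auto
  finally show ?thesis by (simp only: mult_1 of_nat_less_iff)
qed

lemma right_degree: "largest_right_degree M E = d"
proof -
  have "snd ` (E0 - E) \<subseteq> {1..M}" using E0_subset by auto
  moreover have "snd ` (E0 - E) \<noteq> {1..M}" using card_touched by auto
  ultimately obtain j' where j': "j' \<in> {1..M}" "j' \<notin> snd ` (E0 - E)" by blast
  define j where "j = j' - 1"
  have j: "j < M" "j' = j + 1" using j' by (auto simp: j_def)
  have le: "card (right_nbrs E i) \<le> d" if "i \<in> {1..M}" for i
  proof -
    have i: "i - 1 < M" "i = (i - 1) + 1" using that by auto
    have "card (right_nbrs E i) \<le> card (nb (i - 1) ` {..<d})"
      using right_nbrs_subset[OF i(1)] i(2) by (intro card_mono) auto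
    also have "\<dots> \<le> d" using card_image_le[of "{..<d}" "nb (i - 1)"] by simp
    finally show ?thesis .
  qed
  have "nb j ` {..<d} \<subseteq> right_nbrs E j'"
  proof
    fix u assume "u \<in> nb j ` {..<d}"
    then have "(u, j') \<in> E0" using j by (auto simp: E0_def)
    then have "(u, j') \<in> E" using j'(2) by force
    then show "u \<in> right_nbrs E j'" by (simp add: right_nbrs_def)
  qed
  then have "right_nbrs E j' = nb j ` {..<d}" using right_nbrs_subset[OF j(1)] j(2) by auto
  then have "card (right_nbrs E j') = d" using card_image[OF nb_inj[OF j(1)]] by simp
  then show ?thesis unfolding largest_right_degree_def
    by (intro Max_image_eqI[where ?x0.0 = j']) (use le j' in auto)
qed

text \<open>A right vertex not adjacent to \<open>S\<close> either missed \<open>S\<close> before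
  the cut, which \<open>miss\<close> bounds, or lost an edge, which \<open>card_removed\<close>
  bounds. Isolated vertices of \<open>S\<close> contribute nothing, hence the intersection with
  \<open>{1..d * L}\<close>.\<close>

lemma left_nbrs_ge:
  assumes S: "S \<subseteq> {1..N}"
  shows "(1 - (1 - real (card (S \<inter> {1..d * L})) / real (d * L)) ^ d - \<eta> * (real d + 1)) * real M
    \<le> real (card (left_nbrs E S))"
proof -
  define S' where "S' = (\<lambda>u. u - 1) ` (S \<inter> {1..d * L})"
  have cS: "card S' = card (S \<inter> {1..d * L})"
    unfolding S'_def by (rule card_image) (auto simp: inj_on_def)
  have S': "S' \<subseteq> {..<d * L}" by (auto simp: S'_def)
  let ?miss = "{j. j < M \<and> (\<forall>k<d. k * L + \<omega> j k \<notin> S')}"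
  have "{1..M} \<subseteq> left_nbrs E S \<union> (Suc ` ?miss) \<union> snd ` (E0 - E)"
  proof
    fix j' assume j': "j' \<in> {1..M}"
    define j where "j = j' - 1"
    have j: "j < M" "j' = Suc j" using j' by (auto simp: j_def)
    show "j' \<in> left_nbrs E S \<union> (Suc ` ?miss) \<union> snd ` (E0 - E)"
    proof (cases "j \<in> ?miss")
      case False
      then obtain k where k: "k < d" "k * L + \<omega> j k \<in> S'" using j by auto
      then obtain u where u: "u \<in> S" "u \<in> {1..d * L}" "k * L + \<omega> j k = u - 1" by (auto simp: S'_def)
      then have nbu: "nb j k = u" by (auto simp: nb_def)
      have "(u, j') \<in> E0" unfolding E0_def using j k nbu by (intro image_eqI[of _ _ "(j, k)"]) auto
      then show ?thesis using u(1) by (cases "(u, j') \<in> E") (force simp: left_nbrs_def)+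
    qed (use j in auto)
  qed
  moreover have fin: "finite (left_nbrs E S)"
    by (rule finite_subset[of _ "snd ` E0"]) (use E_subset_E0 in \<open>auto simp: left_nbrs_def finite_E0 intro!: image_eqI\<close>)
  ultimately have "M \<le> card (left_nbrs E S \<union> (Suc ` ?miss) \<union> snd ` (E0 - E))"
    using card_mono[of "left_nbrs E S \<union> (Suc ` ?miss) \<union> snd ` (E0 - E)" "{1..M}"] by (simp add: finite_E0)
  also have "\<dots> \<le> card (left_nbrs E S) + card (Suc ` ?miss) + card (snd ` (E0 - E))"
    by (intro order.trans[OF card_Un_le] add_mono order_refl)
  also have "\<dots> \<le> card (left_nbrs E S) + card ?miss + card (E0 - E)"
    by (intro add_mono order_refl card_image_le) (auto simp: finite_E0)
  finally have "real M \<le> real (card (left_nbrs E S)) + real (card ?miss) + real (card (E0 - E))" by linarith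
  also have "\<dots> \<le> real (card (left_nbrs E S)) + ((1 - real (card S') / real (d * L)) ^ d + \<eta>) * real M + \<eta> * real d * real M"
    by (intro add_mono order_refl miss[OF S'] card_removed)
  finally show ?thesis unfolding cS by (simp add: algebra_simps)
qed

lemma lasserre_upper:
  assumes code: "char_code q d \<Phi> C \<gamma>" and dq: "d \<le> q" and N: "d * L \<le> N" and T: "d \<le> T" "t \<le> T"
    and T16: "16 * real T \<le> \<beta> * real \<nu>"
  shows "lasserre_value N M E (1 / real q) t
     \<le> ereal (real M * (real d / real q - real d * (real d - 1) / (2 * (real q)\<^sup>2)) + real B)"
proof -
  define bp where "bp = {(i, j). i < j \<and> j < M \<and>
        card (\<Union>l\<in>{i, j}. (\<lambda>k. k * \<nu> + \<omega> l k div q) ` {..<d}) + 2 \<le> 2 * d}"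
  \<comment> \<open>Of each pair sharing two or more variables the constraint of smaller index is
    given up, at most \<open>B\<close> in all.\<close>
  define J where "J = {..<M} - fst ` bp"
  \<comment> \<open>Position \<open>\<omega> j k\<close> of block \<open>k\<close> is read as
    variable \<open>\<omega> j k div q\<close> of that block with value
    \<open>\<omega> j k mod q\<close>, in accordance with the numbering in
    \<open>val\<close>.\<close>
  define w where "w j k = k * \<nu> + \<omega> j k div q" for j k
  define b where "b j k = \<omega> j k mod q" for j k
  have finbp: "finite bp" by (rule finite_subset[of _ "{..<M} \<times> {..<M}"]) (auto simp: bp_def)
  have w_eq: "w j = (\<lambda>k. k * \<nu> + \<omega> j k div q)" for j by (simp add: w_def fun_eq_iff)
  have div_less: "\<omega> j k div q < \<nu>" if "j < M" "k < d" for j k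
    using \<omega>[OF that] by (simp add: less_mult_imp_div_less mult.commute)
  interpret char_code q d \<Phi> C \<gamma> by fact
  interpret expanding_system q d \<Phi> C \<gamma> "d * \<nu>" T J w b
  proof
    show "finite J" by (simp add: J_def)
    show "w j k < d * \<nu>" if "j \<in> J" "k < d" for j k
      unfolding w_def using that div_less by (intro block_less) (auto simp: J_def)
    show "inj_on (w j) {..<d}" if "j \<in> J" for j
    proof (rule inj_onI)
      fix k k' assume "k \<in> {..<d}" "k' \<in> {..<d}" "w j k = w j k'"
      then show "k = k'"
        using block_inj[of "\<omega> j k div q" \<nu> "\<omega> j k' div q" k k'] div_less[of j] that
        by (auto simp: w_def J_def)
    qed
    show "b j k < q" for j k using q0 by (simp add: b_def)
    show "d \<le> T" by (rule T(1))
    show "5 * d * card I \<le> 5 * card (\<Union>j\<in>I. w j ` {..<d}) + 6 * card I"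
      if "I \<subseteq> J" "card I \<le> 16 * T" for I
      unfolding w_eq
    proof (rule cover_ge)
      show "I \<subseteq> {..<M}" using that(1) by (auto simp: J_def)
      have "real (card I) \<le> real (16 * T)" using that(2) by (rule of_nat_mono)
      then show "real (card I) \<le> \<beta> * real \<nu>" using T16 by simp
    qed
    have less: "2 * d \<le> card (w i ` {..<d} \<union> w j ` {..<d}) + 1" if "i \<in> J" "j \<in> J" "i < j" for i j
    proof -
      have "(i, j) \<notin> bp" using that(1) by (force simp: J_def)
      then show ?thesis using that by (simp add: bp_def w_eq J_def)
    qed
    show "2 * d \<le> card (w i ` {..<d} \<union> w j ` {..<d}) + 1" if "i \<in> J" "j \<in> J" "i \<noteq> j" for i j
      using less[of i j] less[of j i] that by (cases "i < j") (auto simp: Un_commute)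
  qed
  define c where "c = real d / real q - real d * (real d - 1) / (2 * (real q)\<^sup>2)"
  have c0: "0 \<le> c"
  proof -
    have "c = real d * (2 * real q - (real d - 1)) / (2 * (real q)\<^sup>2)"
      using q0 by (simp add: c_def power2_eq_square field_simps)
    moreover have "0 \<le> 2 * real q - (real d - 1)" using dq by simp
    ultimately show ?thesis by simp
  qed
  have N': "d * \<nu> * q \<le> N" using N by (simp add: mult.commute mult.left_commute)
  have feas: "lasserre_feasible N (1 / real q) t ysol" by (rule ysol_feasible[OF T(2) N'])
  have nb_eq: "nb j k = w j k * q + b j k + 1" for j k
  proof -
    have "w j k * q + b j k = k * L + (\<omega> j k div q * q + \<omega> j k mod q)"
      by (simp add: w_def b_def algebra_simps)
    then show ?thesis by (simp add: nb_def)
  qed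
  have cost: "1 - ysol (all_zero (right_nbrs E (j + 1))) \<le> c + (if j \<in> J then 0 else 1)" if j: "j < M" for j
  proof (cases "j \<in> J")
    case True
    have "right_nbrs E (j + 1) \<subseteq> (\<lambda>k. w j k * q + b j k + 1) ` {..<d}"
      using right_nbrs_subset[OF j] by (simp add: nb_eq[abs_def])
    from ysol_zero_ge[OF True this] show ?thesis using True by (simp add: c_def)
  next
    case False
    have fin: "finite (nb j ` {..<d})" by simp
    have "card (right_nbrs E (j + 1)) \<le> card (nb j ` {..<d})"
      by (rule card_mono[OF fin right_nbrs_subset[OF j]])
    also have "\<dots> \<le> d" using card_image_le[of "{..<d}" "nb j"] by simp
    finally have "card (right_nbrs E (j + 1)) \<le> T" using T(1) by simp
    moreover have "0 \<notin> right_nbrs E (j + 1)" using right_nbrs_subset[OF j] by (auto simp: nb_def)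
    ultimately have "0 \<le> ysol (all_zero (right_nbrs E (j + 1)))"
      using finite_subset[OF right_nbrs_subset[OF j] fin] by (intro ysol_nonneg) auto
    then show ?thesis using False c0 by simp
  qed
  have "lasserre_objective M E ysol = (\<Sum>j<M. 1 - ysol (all_zero (right_nbrs E (j + 1))))"
    unfolding lasserre_objective_def
    by (rule sum.reindex_bij_witness[of _ "\<lambda>j. j + 1" "\<lambda>j. j - 1"]) auto
  also have "\<dots> \<le> (\<Sum>j<M. c + (if j \<in> J then 0 else 1))" by (rule sum_mono) (use cost in auto)
  also have "\<dots> = real M * c + real (card {j\<in>{..<M}. j \<notin> J})"
  proof -
    have "(\<Sum>j<M. if j \<in> J then 0 else (1::real)) = (\<Sum>j<M. if j \<notin> J then 1 else 0)"
      by (intro sum.cong refl) auto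
    also have "\<dots> = real (card {j\<in>{..<M}. j \<notin> J})" by (subst sum.inter_filter[symmetric]) auto
    finally show ?thesis by (simp add: sum.distrib)
  qed
  also have "\<dots> \<le> real M * c + real B"
  proof -
    have "card {j\<in>{..<M}. j \<notin> J} \<le> card (fst ` bp)"
      by (rule card_mono) (auto simp: finbp J_def)
    also have "\<dots> \<le> card bp" by (rule card_image_le[OF finbp])
    also have "\<dots> \<le> B" using few_bad_pairs by (simp add: bp_def)
    finally show ?thesis by simp
  qed
  finally have "lasserre_objective M E ysol \<le> real M * c + real B" .
  moreover have "lasserre_value N M E (1 / real q) t \<le> ereal (lasserre_objective M E ysol)"
    unfolding lasserre_value_def by (rule INF_lower) (use feas in simp)
  ultimately show ?thesis unfolding c_def by (meson ereal_less_eq(3) order_trans)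
qed

end

text \<open>The power function is \<open>n\<close>-Lipschitz on the unit interval. This absorbs the
  difference between \<open>\<rho>\<close> and the share of a vertex set inside the blocks.\<close>

lemma power_le_power_add:
  fixes a b h :: real
  assumes "0 \<le> a" "a \<le> 1" "0 \<le> b" "b \<le> 1" "0 \<le> h" "a \<le> b + h"
  shows "a ^ n \<le> b ^ n + real n * h"
proof (induction n)
  case (Suc n)
  have "a ^ Suc n = a * a ^ n" by simp
  also have "\<dots> \<le> a * (b ^ n + real n * h)" using Suc assms by (intro mult_left_mono) auto
  also have "\<dots> = a * b ^ n + a * (real n * h)" by (simp add: algebra_simps)
  also have "\<dots> \<le> (b + h) * b ^ n + 1 * (real n * h)"
    using assms by (intro add_mono mult_right_mono) auto
  also have "\<dots> = b ^ Suc n + (h * b ^ n + real n * h)" by (simp add: algebra_simps)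
  also have "h * b ^ n \<le> h * 1" using assms by (intro mult_left_mono power_le_one) auto
  finally show ?case by (simp add: algebra_simps)
qed simp

text \<open>\<open>\<rho> N\<close> need not be an integer, so expansion is claimed for both of its
  roundings. \<open>1 \<le> M\<close> makes the largest right degree a maximum over a nonempty
  set.\<close>

theorem theorem11:
  fixes q d :: nat and \<delta> \<rho> \<epsilon> \<epsilon>' :: real
  assumes "primepow q" and "1 \<le> d" and "d < q" and "\<delta> > 0"
    and "\<rho> = 1 / real q"
    and "\<epsilon>' = ((1 - \<rho>) ^ d - (1 - \<rho> * real d)) / (\<rho> * real d)"
    and "\<epsilon> = \<rho> * (real d - 1) / 2"
  shows "\<exists>(D :: nat) (c :: real). c > 0 \<and>
    (\<exists>N\<^sub>0 :: nat. \<forall>N \<ge> N\<^sub>0. \<exists>(M :: nat) (E :: (nat \<times> nat) set).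
       1 \<le> M \<and> bipartite_graph N M E \<and>
       largest_left_degree N E = D \<and> largest_right_degree M E = d \<and>
       (\<forall>k \<in> {nat \<lfloor>\<rho> * real N\<rfloor>, nat \<lceil>\<rho> * real N\<rceil>}.
          expander N E k ((1 - \<epsilon>' - 2 * \<delta>) * real D)) \<and>
       lasserre_value N M E \<rho> (nat \<lfloor>c * real N\<rfloor>)
         \<le> ereal ((1 - \<epsilon> + \<delta>) * real D * (\<rho> * real N)))"
proof -
  have d0: "0 < d" and q0: "0 < q" and rd: "1 \<le> real d" and rq: "0 < real q" using assms(2,3) by auto
  note \<delta> = assms(4)
  have rho: "0 < \<rho>" "\<rho> \<le> 1" using rq assms(3) by (auto simp: assms(5))
  \<comment> \<open>\<open>\<epsilon>'\<close> is defined so that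
    \<open>1 - (1 - \<rho>) ^ d\<close>, the probability that a random tuple meets an evenly spread
    set of density \<open>\<rho>\<close>, equals
    \<open>\<rho> * d * (1 - \<epsilon>')\<close>.\<close>
  have eps': "(1 - (1 - \<rho>) ^ d) * real q = real d * (1 - \<epsilon>')"
  proof -
    have "\<epsilon>' * (\<rho> * real d) = (1 - \<rho>) ^ d - (1 - \<rho> * real d)"
      using rho rd unfolding assms(6) by simp
    then have "(1 - (1 - \<rho>) ^ d) = \<rho> * real d * (1 - \<epsilon>')" by (simp add: algebra_simps)
    then show ?thesis using rq by (simp add: assms(5))
  qed
  have eps'0: "0 \<le> \<epsilon>'"
  proof -
    have "1 + real d * (- \<rho>) \<le> (1 + - \<rho>) ^ d" by (rule Bernoulli_inequality) (use rho in auto)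
    then show ?thesis unfolding assms(6) using rho rd by (intro divide_nonneg_pos) (auto simp: mult.commute)
  qed
  have eps1: "\<epsilon> \<le> 1"
  proof -
    have "\<rho> * (real d - 1) \<le> \<rho> * real q" using rho assms(3) by (intro mult_left_mono) auto
    then show ?thesis using rq by (simp add: assms(5,7))
  qed
  obtain \<Phi> C \<gamma> where code: "char_code q d \<Phi> C \<gamma>" using exists_char_code[OF assms(1)] assms(3) by (metis less_imp_le)
  \<comment> \<open>The first bound secures \<open>\<eta> * d < 1\<close>; the second keeps the loss
    \<open>\<eta> * (d + 1) * M\<close> in the expansion below \<open>\<delta> / 2\<close> times
    \<open>D * d * \<nu>\<close>.\<close>
  define \<eta> where "\<eta> = min (1 / (2 * real d)) (\<delta> * real d / (2 * real q * (real d + 1)))"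
  have eta: "0 < \<eta>" "\<eta> \<le> 1 / (2 * real d)" "\<eta> \<le> \<delta> * real d / (2 * real q * (real d + 1))"
    using rd rq \<delta> by (auto simp: \<eta>_def)
  have eta1: "\<eta> \<le> 1" "\<eta> * real d < 1"
  proof -
    have "\<eta> * real d \<le> 1 / (2 * real d) * real d" using eta rd by (intro mult_right_mono) auto
    then show "\<eta> * real d < 1" using rd by simp
    have "1 / (2 * real d) \<le> 1" using rd by simp
    then show "\<eta> \<le> 1" using eta(2) by linarith
  qed
  have eta2: "\<eta> * (real d + 1) * real q \<le> \<delta> * real d / 2"
  proof -
    have "\<eta> * ((real d + 1) * real q) \<le> \<delta> * real d / (2 * real q * (real d + 1)) * ((real d + 1) * real q)"
      using eta rq by (intro mult_right_mono) auto
    also have "2 * real q * (real d + 1) = 2 * ((real d + 1) * real q)" by simp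
    also have "\<delta> * real d / (2 * ((real d + 1) * real q)) * ((real d + 1) * real q) = \<delta> * real d / 2"
    proof -
      have "x / (2 * y) * y = x / 2" if "y \<noteq> 0" for x y :: real using that by simp
      moreover have "(real d + 1) * real q \<noteq> 0" using rq rd by simp
      ultimately show ?thesis by blast
    qed
    finally show ?thesis by (simp add: mult.assoc)
  qed
  define D where "D = nat \<lceil>4 * (real d + 3) / \<eta>\<^sup>2\<rceil>"
  have "4 * (real d + 3) / \<eta>\<^sup>2 \<le> real D" unfolding D_def by (rule real_nat_ceiling_ge)
  then have DD: "4 * (real d + 3) \<le> real D * \<eta>\<^sup>2" using eta by (simp add: pos_divide_le_eq)
  have D0: "0 < D"
  proof (rule ccontr)
    assume "\<not> 0 < D"
    then show False using DD by simp
  qed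
  obtain \<beta> B where \<beta>: "0 < \<beta>" and tup: "\<forall>\<nu>\<ge>2. \<exists>\<omega>. good_tuples q d D \<eta> \<beta> B \<nu> \<omega>"
    using good_tuples_exist[OF q0 d0 D0 eta(1) eta1(1) DD] by blast
  \<comment> \<open>As \<open>N \<le> 2 * q * d * \<nu>\<close>, this gives
    \<open>c * N \<le> \<beta> * \<nu> / 16\<close>, the bound whose integer part is taken as
    \<open>T\<close>.\<close>
  define c where "c = \<beta> / (32 * real q * real d)"
  have c0: "0 < c" using \<beta> rq rd by (simp add: c_def)
  \<comment> \<open>The summands ensure in turn that \<open>d \<le> T\<close>, that rounding and the
    isolated vertices are absorbed by \<open>\<delta> * d * \<nu>\<close>, and that the
    \<open>B\<close> constraints given up are absorbed by
    \<open>\<delta> * D * d * \<nu>\<close>.\<close>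
  define x0 where "x0 = 16 * real d / \<beta> + (real q * real d + real d + 1) / (\<delta> * real d) + real B / (\<delta> * real D * real d)"
  define N0 where "N0 = q * d * (nat \<lceil>x0\<rceil> + 2)"
  have "\<exists>(M :: nat) (E :: (nat \<times> nat) set).
       1 \<le> M \<and> bipartite_graph N M E \<and>
       largest_left_degree N E = D \<and> largest_right_degree M E = d \<and>
       (\<forall>k \<in> {nat \<lfloor>\<rho> * real N\<rfloor>, nat \<lceil>\<rho> * real N\<rceil>}.
          expander N E k ((1 - \<epsilon>' - 2 * \<delta>) * real D)) \<and>
       lasserre_value N M E \<rho> (nat \<lfloor>c * real N\<rfloor>)
         \<le> ereal ((1 - \<epsilon> + \<delta>) * real D * (\<rho> * real N))" if N: "N0 \<le> N" for N
  proof -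
    \<comment> \<open>Fewer than \<open>q * d\<close> left vertices remain outside the blocks; these
      are the isolated ones.\<close>
    define \<nu> where "\<nu> = N div (q * d)"
    have "nat \<lceil>x0\<rceil> + 2 \<le> \<nu>"
      using div_le_mono[OF N, of "q * d"] q0 d0 by (simp add: \<nu>_def N0_def)
    then have nu2: "2 \<le> \<nu>" and "nat \<lceil>x0\<rceil> \<le> \<nu>" by linarith+
    then have "real (nat \<lceil>x0\<rceil>) \<le> real \<nu>" by (intro of_nat_mono)
    then have x0: "x0 \<le> real \<nu>" using real_nat_ceiling_ge[of x0] by linarith
    have pos: "0 \<le> 16 * real d / \<beta>" "0 \<le> (real q * real d + real d + 1) / (\<delta> * real d)" "0 \<le> real B / (\<delta> * real D * real d)"
      using \<beta> \<delta> by auto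
    have x1: "real d \<le> \<beta> * real \<nu> / 16"
    proof -
      have "16 * real d / \<beta> \<le> real \<nu>" using x0 pos unfolding x0_def by linarith
      then show ?thesis using \<beta> by (simp add: field_simps)
    qed
    have x2: "real q * real d + real d + 1 \<le> \<delta> * real d * real \<nu>"
    proof -
      have "(real q * real d + real d + 1) / (\<delta> * real d) \<le> real \<nu>" using x0 pos unfolding x0_def by linarith
      then show ?thesis using \<delta> rd by (simp add: pos_divide_le_eq mult.commute)
    qed
    have x3: "real B \<le> \<delta> * real D * real d * real \<nu>"
    proof -
      have "real B / (\<delta> * real D * real d) \<le> real \<nu>" using x0 pos unfolding x0_def by linarith
      moreover have "0 < \<delta> * real D * real d" using \<delta> rd D0 by simp
      ultimately show ?thesis by (simp add: pos_divide_le_eq mult.commute)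
    qed
    have Nlow: "d * (q * \<nu>) \<le> N"
      using div_times_less_eq_dividend[of N "q * d"] unfolding \<nu>_def by (simp add: ac_simps)
    have Nup: "N < d * (q * \<nu>) + q * d"
    proof -
      have "N = (N div (q * d)) * (q * d) + N mod (q * d)" by (rule div_mult_mod_eq[symmetric])
      moreover have "N mod (q * d) < q * d" using q0 d0 by simp
      ultimately have "N < (N div (q * d)) * (q * d) + q * d" by linarith
      then show ?thesis unfolding \<nu>_def by (simp add: ac_simps)
    qed
    have nu0: "0 < real \<nu>" using nu2 by simp
    have rhoN: "real d * real \<nu> \<le> \<rho> * real N" "\<rho> * real N \<le> real d * real \<nu> + real d"
    proof -
      have "real (d * (q * \<nu>)) \<le> real N" using Nlow by (rule of_nat_mono)
      then have "real d * real \<nu> * real q \<le> real N" by (simp add: ac_simps)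
      then show "real d * real \<nu> \<le> \<rho> * real N" using rq by (simp add: assms(5) pos_le_divide_eq)
      have "real N \<le> real (d * (q * \<nu>) + q * d)" using Nup by (intro of_nat_mono) simp
      then have "real N \<le> (real d * real \<nu> + real d) * real q" by (simp add: algebra_simps)
      then show "\<rho> * real N \<le> real d * real \<nu> + real d" using rq by (simp add: assms(5) pos_divide_le_eq)
    qed
    obtain \<omega> where om: "good_tuples q d D \<eta> \<beta> B \<nu> \<omega>" using tup nu2 by blast
    interpret tuple_graph q d D \<eta> \<beta> B \<nu> \<omega>
      by unfold_locales (use q0 d0 D0 nu2 eta eta1 om in auto)
    have rM: "real M = real D * real q * real \<nu>" by simp
    define T where "T = nat \<lfloor>\<beta> * real \<nu> / 16\<rfloor>"
    have T16: "16 * real T \<le> \<beta> * real \<nu>"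
    proof -
      have "real T \<le> \<beta> * real \<nu> / 16" unfolding T_def using \<beta> by (intro of_nat_floor) auto
      then show ?thesis by simp
    qed
    have dT: "d \<le> T" unfolding T_def using x1 by (rule le_nat_floor)
    have tT: "nat \<lfloor>c * real N\<rfloor> \<le> T"
    proof -
      have "real N = real q * (\<rho> * real N)" using rq by (simp add: assms(5))
      also have "\<dots> \<le> real q * (real d * real \<nu> + real d * real \<nu>)"
      proof (intro mult_left_mono)
        have "real d * 1 \<le> real d * real \<nu>" using nu2 by (intro mult_left_mono) auto
        then show "\<rho> * real N \<le> real d * real \<nu> + real d * real \<nu>" using rhoN(2) by linarith
      qed simp
      finally have "c * real N \<le> c * (real q * (real d * real \<nu> + real d * real \<nu>))"
        using c0 by (intro mult_left_mono) auto
      also have "\<dots> = \<beta> * real \<nu> / 16" using rq rd by (simp add: c_def field_simps)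
      finally show ?thesis unfolding T_def by (intro nat_mono floor_mono)
    qed
    have las: "lasserre_value N M E \<rho> (nat \<lfloor>c * real N\<rfloor>) \<le> ereal ((1 - \<epsilon> + \<delta>) * real D * (\<rho> * real N))"
    proof -
      have "lasserre_value N M E \<rho> (nat \<lfloor>c * real N\<rfloor>)
        \<le> ereal (real M * (real d / real q - real d * (real d - 1) / (2 * (real q)\<^sup>2)) + real B)"
        unfolding assms(5)
        by (rule lasserre_upper[OF code less_imp_le[OF assms(3)] Nlow dT tT T16])
      also have "real M * (real d / real q - real d * (real d - 1) / (2 * (real q)\<^sup>2)) = (1 - \<epsilon>) * real D * (real d * real \<nu>)"
        unfolding rM assms(5,7) using rq by (simp add: power2_eq_square field_simps)
      also have "ereal ((1 - \<epsilon>) * real D * (real d * real \<nu>) + real B) \<le> ereal ((1 - \<epsilon> + \<delta>) * real D * (\<rho> * real N))"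
      proof -
        have "(1 - \<epsilon>) * real D * (real d * real \<nu>) + real B \<le> (1 - \<epsilon> + \<delta>) * real D * (real d * real \<nu>)"
          using x3 by (simp add: algebra_simps)
        also have "\<dots> \<le> (1 - \<epsilon> + \<delta>) * real D * (\<rho> * real N)"
          using rhoN(1) eps1 \<delta> by (intro mult_left_mono) auto
        finally show ?thesis by simp
      qed
      finally show ?thesis .
    qed
    have expd: "expander N E k ((1 - \<epsilon>' - 2 * \<delta>) * real D)"
      if k: "k \<in> {nat \<lfloor>\<rho> * real N\<rfloor>, nat \<lceil>\<rho> * real N\<rceil>}" for k
      unfolding expander_def
    proof (intro allI impI, elim conjE)
      fix S assume S: "S \<subseteq> {1..N}" "card S = k"
      have rN0: "0 \<le> \<rho> * real N" using rho by simp
      have kk: "d * \<nu> \<le> k" "real k \<le> \<rho> * real N + 1"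
      proof -
        have 1: "d * \<nu> \<le> nat \<lfloor>\<rho> * real N\<rfloor>" using rhoN(1) by (intro le_nat_floor) simp
        also have "\<dots> \<le> nat \<lceil>\<rho> * real N\<rceil>" by (intro nat_mono floor_le_ceiling)
        finally show "d * \<nu> \<le> k" using k 1 by auto
        have "real (nat \<lfloor>\<rho> * real N\<rfloor>) \<le> \<rho> * real N" using rN0 by (rule of_nat_floor)
        moreover have "real (nat \<lceil>\<rho> * real N\<rceil>) \<le> \<rho> * real N + 1" using rN0 by (simp add: of_int_ceiling_le_add_one)
        ultimately show "real k \<le> \<rho> * real N + 1" using k by auto
      qed
      let ?S = "S \<inter> {1..d * L}"
      have "S \<subseteq> ?S \<union> {d * L + 1..N}" using S(1) by auto
      then have "card S \<le> card (?S \<union> {d * L + 1..N})" by (intro card_mono) auto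
      also have "\<dots> \<le> card ?S + card {d * L + 1..N}" by (rule card_Un_le)
      also have "card {d * L + 1..N} \<le> q * d" using Nup by simp
      finally have "d * \<nu> \<le> card ?S + q * d" using kk(1) S(2) by simp
      then have "real (d * \<nu>) \<le> real (card ?S + q * d)" by (rule of_nat_mono)
      then have cS: "real d * real \<nu> - real q * real d \<le> real (card ?S)" by simp
      define \<sigma> where "\<sigma> = real (card ?S) / real (d * L)"
      have dL: "0 < real (d * L)" using d0 q0 nu2 by simp
      have sig: "\<rho> - 1 / real \<nu> \<le> \<sigma>"
      proof -
        have "\<rho> - 1 / real \<nu> = (real d * real \<nu> - real q * real d) / real (d * L)"
          using rq rd nu0 by (simp add: assms(5) field_simps)
        also have "\<dots> \<le> \<sigma>" unfolding \<sigma>_def using cS by (intro divide_right_mono) auto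
        finally show ?thesis .
      qed
      have sig1: "\<sigma> \<le> 1"
      proof -
        have "card ?S \<le> card {1..d * L}" by (intro card_mono) auto
        then have "real (card ?S) \<le> real (d * L)" by (simp del: of_nat_mult)
        then show ?thesis unfolding \<sigma>_def using dL by (simp del: of_nat_mult)
      qed
      have sig0: "0 \<le> \<sigma>" by (simp add: \<sigma>_def)
      have pw: "(1 - \<sigma>) ^ d \<le> (1 - \<rho>) ^ d + real d * (1 / real \<nu>)"
        by (rule power_le_power_add) (use sig sig0 sig1 rho nu0 in auto)
      have "(1 - (1 - \<rho>) ^ d - real d * (1 / real \<nu>) - \<eta> * (real d + 1)) * real M
          \<le> (1 - (1 - \<sigma>) ^ d - \<eta> * (real d + 1)) * real M"
        using pw by (intro mult_right_mono) auto
      also have "\<dots> \<le> real (card (left_nbrs E S))" unfolding \<sigma>_def by (rule left_nbrs_ge[OF S(1)])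
      finally have low: "(1 - (1 - \<rho>) ^ d - real d * (1 / real \<nu>) - \<eta> * (real d + 1)) * real M \<le> real (card (left_nbrs E S))" .
      have "(1 - (1 - \<rho>) ^ d - real d * (1 / real \<nu>) - \<eta> * (real d + 1)) * real M
          = real D * (((1 - (1 - \<rho>) ^ d) * real q) * real \<nu> - real d * real q - \<eta> * (real d + 1) * real q * real \<nu>)"
        unfolding rM using nu0 by (simp add: field_simps)
      also have "\<dots> = real D * (real d * (1 - \<epsilon>') * real \<nu> - real d * real q - \<eta> * (real d + 1) * real q * real \<nu>)"
        unfolding eps' ..
      also have "\<dots> \<ge> real D * (real d * (1 - \<epsilon>') * real \<nu> - real d * real q - \<delta> * real d / 2 * real \<nu>)"
        using eta2 nu0 by (intro mult_left_mono diff_mono order_refl mult_right_mono) auto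
      finally have low2: "real D * (real d * (1 - \<epsilon>') * real \<nu> - real d * real q - \<delta> * real d / 2 * real \<nu>) \<le> real (card (left_nbrs E S))"
        using low by linarith
      show "(1 - \<epsilon>' - 2 * \<delta>) * real D * real k \<le> real (card (left_nbrs E S))"
      proof (cases "1 - \<epsilon>' - 2 * \<delta> \<le> 0")
        case True
        then have "(1 - \<epsilon>' - 2 * \<delta>) * (real D * real k) \<le> 0" by (intro mult_nonpos_nonneg) auto
        then show ?thesis by (simp add: mult.assoc)
      next
        case False
        have kb: "real k \<le> real d * real \<nu> + (real d + 1)" using kk(2) rhoN(2) by linarith
        have "(1 - \<epsilon>' - 2 * \<delta>) * real k \<le> (1 - \<epsilon>' - 2 * \<delta>) * (real d * real \<nu> + (real d + 1))"
          using False kb by (intro mult_left_mono) auto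
        also have "\<dots> = (1 - \<epsilon>' - 2 * \<delta>) * (real d * real \<nu>) + (1 - \<epsilon>' - 2 * \<delta>) * (real d + 1)"
          by (simp add: algebra_simps)
        also have "(1 - \<epsilon>' - 2 * \<delta>) * (real d + 1) \<le> 1 * (real d + 1)"
          using eps'0 \<delta> by (intro mult_right_mono) auto
        also have "(1 - \<epsilon>' - 2 * \<delta>) * (real d * real \<nu>) + 1 * (real d + 1)
            \<le> real d * (1 - \<epsilon>') * real \<nu> - real d * real q - \<delta> * real d / 2 * real \<nu>"
        proof -
          have "0 \<le> \<delta> * real d * real \<nu>" using \<delta> by simp
          \<comment> \<open>A quarter of the slack \<open>2 * \<delta>\<close> went into
            \<open>\<eta>\<close>; the rest covers the rounding of \<open>k\<close> and the isolated
            vertices.\<close>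
          then have "real d + 1 + real d * real q \<le> 2 * (\<delta> * real d * real \<nu>) - (\<delta> * real d * real \<nu>) / 2"
            using x2 mult.commute[of "real q" "real d"] by linarith
          then show ?thesis by (simp add: algebra_simps)
        qed
        finally have "real D * ((1 - \<epsilon>' - 2 * \<delta>) * real k)
            \<le> real D * (real d * (1 - \<epsilon>') * real \<nu> - real d * real q - \<delta> * real d / 2 * real \<nu>)"
          by (intro mult_left_mono) auto
        then show ?thesis using low2 by (simp add: mult.commute mult.left_commute)
      qed
    qed
    have "1 \<le> M" using D0 q0 nu2 by (simp add: Suc_le_eq)
    then show ?thesis
      using graph[OF Nlow] left_degree[OF Nlow] right_degree expd las by blast
  qed
  then show ?thesis using c0 by blast
qed

end
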